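(* Let $X$ be a uniformly locally finite metric space with property A, and let $\sigma$ be an automorphism of $\mathrm{C}^*_u(X)$ lying in the connected component of the identity on $\mathrm{C}^*_u(X)$. If $w$ is any unitary operator on $\ell_2(X)$ such that $\sigma=\mathrm{Ad}(w)$ (i.e. $\sigma(a)=waw^*$ for all $a\in\mathrm{C}^*_u(X)$), then $w\in\mathrm{C}^*_u(X)$.
   Context: Uniformly locally finite: $\sup_x|B_r(x)|<\infty$ for all $r>0$. A partial translation is a bijection $f\colon\mathrm{dom}(f)\subseteq X\to\mathrm{ran}(f)\subseteq X$ with $\sup_{x\in\mathrm{dom}(f)}d(x,f(x))<\infty$; $v_f\delta_x=\delta_{f(x)}$ for $x\in\mathrm{dom}(f)$ and $0$ otherwise; $\mathrm{C}^*_u(X)$ is the $\mathrm{C}^*$-subalgebra of $\mathcal{B}(\ell_2(X))$ generated by all $v_f$. Property A: for all $\varepsilon,r>0$ there is $x\mapsto\xi_x$ into the unit sphere of $\ell_2(X)$ with $\|\xi_x-\xi_y\|\le\varepsilon$ when $d(x,y)\le r$ and $\sup\{d(x,y):\langle\xi_x,\delta_y\rangle\ne0\}<\infty$. An automorphism $\sigma$ of $\mathrm{C}^*_u(X)$ is in the connected component of the identity if there is a family $(\sigma_t)_{t\in[0,1]}$ of automorphisms of $\mathrm{C}^*_u(X)$ with $t\mapsto\sigma_t(a)$ norm continuous for every $a$, $\sigma_0=\mathrm{id}$ and $\sigma_1=\sigma$. *)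

theory Defs
  imports "HOL-Analysis.Analysis"
begin

definition ell2 :: "('a \<Rightarrow> complex) set" where
  "ell2 = {\<xi>. (\<lambda>x. (cmod (\<xi> x))^2) summable_on UNIV}"

definition l2norm :: "('a \<Rightarrow> complex) \<Rightarrow> real" where
  "l2norm \<xi> = sqrt (\<Sum>\<^sub>\<infinity>x. (cmod (\<xi> x))^2)"

definition l2inner :: "('a \<Rightarrow> complex) \<Rightarrow> ('a \<Rightarrow> complex) \<Rightarrow> complex" where
  "l2inner \<xi> \<eta> = (\<Sum>\<^sub>\<infinity>x. cnj (\<xi> x) * \<eta> x)"

type_synonym 'a op = "('a \<Rightarrow> complex) \<Rightarrow> ('a \<Rightarrow> complex)"

text \<open>Bounded (complex-linear) operators on ell2. Convention: an operator is
  represented by a function that is zero outside ell2, so that equality of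
  operators is plain function equality.\<close>
definition bounded_op :: "'a op \<Rightarrow> bool" where
  "bounded_op T \<longleftrightarrow>
     (\<forall>\<xi>\<in>ell2. T \<xi> \<in> ell2) \<and>
     (\<forall>\<xi>\<in>ell2. \<forall>\<eta>\<in>ell2. \<forall>c::complex.
        T (\<lambda>x. c * \<xi> x + \<eta> x) = (\<lambda>x. c * T \<xi> x + T \<eta> x)) \<and>
     (\<exists>C. \<forall>\<xi>\<in>ell2. l2norm (T \<xi>) \<le> C * l2norm \<xi>) \<and>
     (\<forall>\<xi>. \<xi> \<notin> ell2 \<longrightarrow> T \<xi> = (\<lambda>_. 0))"

definition opnorm :: "'a op \<Rightarrow> real" where
  "opnorm T = Sup {l2norm (T \<xi>) | \<xi>. \<xi> \<in> ell2 \<and> l2norm \<xi> \<le> 1}"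

definition op_plus :: "'a op \<Rightarrow> 'a op \<Rightarrow> 'a op" where
  "op_plus T U = (\<lambda>\<xi> x. T \<xi> x + U \<xi> x)"

definition op_minus :: "'a op \<Rightarrow> 'a op \<Rightarrow> 'a op" where
  "op_minus T U = (\<lambda>\<xi> x. T \<xi> x - U \<xi> x)"

definition op_scale :: "complex \<Rightarrow> 'a op \<Rightarrow> 'a op" where
  "op_scale c T = (\<lambda>\<xi> x. c * T \<xi> x)"

definition idop :: "'a op" where
  "idop = (\<lambda>\<xi>. if \<xi> \<in> ell2 then \<xi> else (\<lambda>_. 0))"

definition op_adjoint :: "'a op \<Rightarrow> 'a op" where
  "op_adjoint T = (THE S. bounded_op S \<and>
      (\<forall>\<xi>\<in>ell2. \<forall>\<eta>\<in>ell2. l2inner (T \<xi>) \<eta> = l2inner \<xi> (S \<eta>)))"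

definition unitary_op :: "'a op \<Rightarrow> bool" where
  "unitary_op w \<longleftrightarrow> bounded_op w \<and> w \<circ> op_adjoint w = idop \<and> op_adjoint w \<circ> w = idop"

definition partial_translation :: "('a::metric_space \<rightharpoonup> 'a) \<Rightarrow> bool" where
  "partial_translation f \<longleftrightarrow>
     inj_on (\<lambda>x. the (f x)) (dom f) \<and> (\<exists>C. \<forall>x\<in>dom f. dist x (the (f x)) \<le> C)"

text \<open>v_f delta_x = delta_(f x) for x in dom f, and 0 otherwise.\<close>
definition transl_op :: "('a \<rightharpoonup> 'a) \<Rightarrow> 'a op" where
  "transl_op f = (\<lambda>\<xi>. if \<xi> \<in> ell2 then
       (\<lambda>y. if \<exists>x\<in>dom f. f x = Some y then \<xi> (THE x. f x = Some y) else 0)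
     else (\<lambda>_. 0))"

definition cstar_closed :: "'a op set \<Rightarrow> bool" where
  "cstar_closed S \<longleftrightarrow>
     S \<subseteq> {T. bounded_op T} \<and>
     (\<forall>T\<in>S. \<forall>U\<in>S. op_plus T U \<in> S \<and> T \<circ> U \<in> S) \<and>
     (\<forall>c. \<forall>T\<in>S. op_scale c T \<in> S) \<and>
     (\<forall>T\<in>S. op_adjoint T \<in> S) \<and>
     (\<forall>T A. bounded_op T \<and> (\<forall>n. A n \<in> S) \<and>
         (\<lambda>n. opnorm (op_minus (A n) T)) \<longlonglongrightarrow> 0 \<longrightarrow> T \<in> S)"

definition uniform_roe_alg :: "'a::metric_space op set" where
  "uniform_roe_alg = \<Inter>{S. cstar_closed S \<and>
       {transl_op f | f. partial_translation f} \<subseteq> S}"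

definition unif_locally_finite :: "'a::metric_space itself \<Rightarrow> bool" where
  "unif_locally_finite _ \<longleftrightarrow>
     (\<forall>r>0. \<exists>N::nat. \<forall>x::'a. finite (cball x r) \<and> card (cball x r) \<le> N)"

definition property_A :: "'a::metric_space itself \<Rightarrow> bool" where
  "property_A _ \<longleftrightarrow>
     (\<forall>\<epsilon>>0. \<forall>r>0. \<exists>\<xi>::'a \<Rightarrow> ('a \<Rightarrow> complex).
        (\<forall>x. \<xi> x \<in> ell2 \<and> l2norm (\<xi> x) = 1) \<and>
        (\<forall>x y. dist x y \<le> r \<longrightarrow> l2norm (\<lambda>z. \<xi> x z - \<xi> y z) \<le> \<epsilon>) \<and>
        (\<exists>S. \<forall>x y. \<xi> x y \<noteq> 0 \<longrightarrow> dist x y \<le> S))"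

definition is_cstar_aut :: "'a op set \<Rightarrow> ('a op \<Rightarrow> 'a op) \<Rightarrow> bool" where
  "is_cstar_aut A \<sigma> \<longleftrightarrow> bij_betw \<sigma> A A \<and>
     (\<forall>a\<in>A. \<forall>b\<in>A. \<sigma> (op_plus a b) = op_plus (\<sigma> a) (\<sigma> b) \<and> \<sigma> (a \<circ> b) = \<sigma> a \<circ> \<sigma> b) \<and>
     (\<forall>c. \<forall>a\<in>A. \<sigma> (op_scale c a) = op_scale c (\<sigma> a)) \<and>
     (\<forall>a\<in>A. \<sigma> (op_adjoint a) = op_adjoint (\<sigma> a))"

definition in_identity_component :: "'a op set \<Rightarrow> ('a op \<Rightarrow> 'a op) \<Rightarrow> bool" where
  "in_identity_component A \<sigma> \<longleftrightarrow>
     (\<exists>\<sigma>t :: real \<Rightarrow> 'a op \<Rightarrow> 'a op.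
        (\<forall>t\<in>{0..1}. is_cstar_aut A (\<sigma>t t)) \<and>
        (\<forall>a\<in>A. \<forall>t0\<in>{0..1}. \<forall>\<epsilon>>0. \<exists>\<delta>>0. \<forall>t\<in>{0..1}.
            \<bar>t - t0\<bar> < \<delta> \<longrightarrow> opnorm (op_minus (\<sigma>t t a) (\<sigma>t t0 a)) < \<epsilon>) \<and>
        (\<forall>a\<in>A. \<sigma>t 0 a = a) \<and>
        (\<forall>a\<in>A. \<sigma>t 1 a = \<sigma> a))"

end

(*
  Write chi B for the projection onto the functions supported on B. A Baire category argument on the
  power set of X gives two uniformities over all B: for an automorphism tau, the projections
  tau (chi B) are equi-quasi-local, and for a pointwise norm continuous path, t |-> sigma_t (chi B) is
  equicontinuous. Say that tau is local if for every e there is an R such that, for all B,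
  tau (chi B) is e-concentrated on the R-neighbourhood of B. The identity c q = c q p + c q (q - p)
  shows that an automorphism within 1/2 of a local one on all projections is local, so by connectedness
  of [0,1] the endpoint sigma = Ad w is local. As w chi B = sigma (chi B) w, w is quasi-local.

  Quasi-local operators belong to the uniform Roe algebra under property A (after Spakula and Zhang):
  the Schur multiplier M of w with the kernel <xi_x, xi_y> of property A has finite propagation, w - M is
  small on vectors of bounded support, and metric sparsification, a consequence of property A, localizes
  the norm of the quasi-local operator w - M to such vectors.
*)

theory Submission
  imports Defs
begin

section \<open>The Hilbert space of square-summable functions\<close>

text \<open>The path is continuous only at each operator separately, and each
  \<open>\<tau> (chi B)\<close> is quasi-local only at its own scale. Closeness 1/2 transports
  locality only if both are uniform in \<open>B\<close>; this is what the category argument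
  supplies. Its closed sets are closed because the norm is lower semicontinuous under strong limits,
  once \<open>B \<mapsto> \<tau> (chi B)\<close> is known to be strongly continuous. It yields a
  bound on one cylinder \<open>B \<inter> S = B0\<close> only; additivity on disjoint sets and the
  finiteness of the power set of \<open>S\<close> spread it to all \<open>B\<close> at the cost of a
  factor 3. In the second half the order of choices is delicate. The radius on which the norm of
  \<open>w - M\<close> is detected has to be fixed before the kernel, since the kernel must be
  almost constant at that scale. This is not circular: Schur multiplication by a normalised positive
  definite kernel preserves both contractivity and the constants of \<open>ql\<close>, so the bounds
  for \<open>w - M\<close> that determine the radius are known before \<open>M\<close>
  exists.\<close>

definition restr :: "'a set \<Rightarrow> ('a \<Rightarrow> complex) \<Rightarrow> 'a \<Rightarrow> complex" where
  "restr D \<xi> = (\<lambda>x. if x \<in> D then \<xi> x else 0)"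

definition delta :: "'a \<Rightarrow> 'a \<Rightarrow> complex" where
  "delta y = (\<lambda>x. if x = y then 1 else 0)"

text \<open>The gateway from finite sums to \<open>ell2\<close>: inequalities for
  \<open>L2_set\<close> over finite sets are imported through this test.\<close>

lemma ell2_bounded:
  assumes "\<And>F. finite F \<Longrightarrow> L2_set (\<lambda>x. cmod (\<xi> x)) F \<le> K"
  shows "\<xi> \<in> ell2" "l2norm \<xi> \<le> K"
proof -
  have K: "0 \<le> K" using assms[of "{}"] by simp
  have b: "(\<Sum>x\<in>F. (cmod (\<xi> x))\<^sup>2) \<le> K\<^sup>2" if "finite F" for F
    using assms[OF that] K unfolding L2_set_def by (simp add: real_sqrt_le_iff sqrt_le_D)
  show s: "\<xi> \<in> ell2" unfolding ell2_def
    by (auto intro!: nonneg_bdd_above_summable_on bdd_aboveI[of _ "K\<^sup>2"] b)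
  have "(\<Sum>\<^sub>\<infinity>x. (cmod (\<xi> x))\<^sup>2) \<le> K\<^sup>2"
    using s b unfolding ell2_def by (intro infsum_le_finite_sums) auto
  then show "l2norm \<xi> \<le> K" unfolding l2norm_def using K real_le_lsqrt by blast
qed

lemma L2_set_le_l2norm:
  assumes "\<xi> \<in> ell2" "finite F"
  shows "L2_set (\<lambda>x. cmod (\<xi> x)) F \<le> l2norm \<xi>"
  using assms unfolding L2_set_def l2norm_def ell2_def
  by (auto intro!: real_sqrt_le_mono finite_sum_le_infsum)

lemma l2norm_nonneg [simp]: "0 \<le> l2norm \<xi>"
  unfolding l2norm_def by (simp add: infsum_nonneg)

lemma cmod_le_l2norm: "\<xi> \<in> ell2 \<Longrightarrow> cmod (\<xi> x) \<le> l2norm \<xi>"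
  using L2_set_le_l2norm[of \<xi> "{x}"] by simp

lemma l2norm_eq_0: "\<xi> \<in> ell2 \<Longrightarrow> l2norm \<xi> = 0 \<Longrightarrow> \<xi> = (\<lambda>_. 0)"
  using cmod_le_l2norm[of \<xi>] by fastforce

lemma ell2_mono:
  assumes "\<eta> \<in> ell2" "\<And>x. cmod (\<xi> x) \<le> cmod (\<eta> x)"
  shows "\<xi> \<in> ell2" "l2norm \<xi> \<le> l2norm \<eta>"
proof -
  have "L2_set (\<lambda>x. cmod (\<xi> x)) F \<le> l2norm \<eta>" if "finite F" for F
    using L2_set_mono[of F "\<lambda>x. cmod (\<xi> x)" "\<lambda>x. cmod (\<eta> x)"] assms(2)
      L2_set_le_l2norm[OF assms(1) that] by fastforce
  from ell2_bounded[OF this] show "\<xi> \<in> ell2" "l2norm \<xi> \<le> l2norm \<eta>" by auto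
qed

lemma ell2_finite_support:
  assumes "finite F" "\<And>x. x \<notin> F \<Longrightarrow> \<xi> x = 0"
  shows "\<xi> \<in> ell2" "l2norm \<xi> = L2_set (\<lambda>x. cmod (\<xi> x)) F"
proof -
  have b: "L2_set (\<lambda>x. cmod (\<xi> x)) G \<le> L2_set (\<lambda>x. cmod (\<xi> x)) F" if "finite G" for G
  proof -
    have "(\<Sum>x\<in>G. (cmod (\<xi> x))\<^sup>2) = (\<Sum>x\<in>G\<inter>F. (cmod (\<xi> x))\<^sup>2)"
      by (rule sum.mono_neutral_right) (use that assms in auto)
    also have "\<dots> \<le> (\<Sum>x\<in>F. (cmod (\<xi> x))\<^sup>2)"
      by (rule sum_mono2) (use assms in auto)
    finally show ?thesis unfolding L2_set_def by simp
  qed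
  show e: "\<xi> \<in> ell2" using ell2_bounded(1)[OF b] by simp
  show "l2norm \<xi> = L2_set (\<lambda>x. cmod (\<xi> x)) F"
    using ell2_bounded(2)[OF b] L2_set_le_l2norm[OF e assms(1)] by simp
qed

lemma ell2_zero [simp]: "(\<lambda>_. 0) \<in> ell2" and l2norm_zero [simp]: "l2norm (\<lambda>_. 0) = 0"
  using ell2_finite_support[of "{}" "\<lambda>_. 0"] by auto

lemma ell2_delta [simp]: "delta y \<in> ell2" and l2norm_delta [simp]: "l2norm (delta y) = 1"
  using ell2_finite_support[of "{y}" "delta y"] by (auto simp: delta_def)

lemma ell2_add:
  assumes "\<xi> \<in> ell2" "\<eta> \<in> ell2"
  shows "(\<lambda>x. \<xi> x + \<eta> x) \<in> ell2" "l2norm (\<lambda>x. \<xi> x + \<eta> x) \<le> l2norm \<xi> + l2norm \<eta>"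
proof -
  have "L2_set (\<lambda>x. cmod (\<xi> x + \<eta> x)) F \<le> l2norm \<xi> + l2norm \<eta>" if "finite F" for F
  proof -
    have "L2_set (\<lambda>x. cmod (\<xi> x + \<eta> x)) F \<le> L2_set (\<lambda>x. cmod (\<xi> x) + cmod (\<eta> x)) F"
      by (rule L2_set_mono) (auto intro: norm_triangle_ineq)
    also have "\<dots> \<le> L2_set (\<lambda>x. cmod (\<xi> x)) F + L2_set (\<lambda>x. cmod (\<eta> x)) F"
      by (rule L2_set_triangle_ineq)
    finally show ?thesis
      using L2_set_le_l2norm[OF assms(1) that] L2_set_le_l2norm[OF assms(2) that] by linarith
  qed
  from ell2_bounded[OF this] show "(\<lambda>x. \<xi> x + \<eta> x) \<in> ell2"
    "l2norm (\<lambda>x. \<xi> x + \<eta> x) \<le> l2norm \<xi> + l2norm \<eta>" by auto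
qed

lemma l2norm_scale: "l2norm (\<lambda>x. c * \<xi> x) = cmod c * l2norm \<xi>"
  unfolding l2norm_def
  by (simp add: norm_mult power_mult_distrib infsum_cmult_right' real_sqrt_mult)

lemma ell2_scale: "\<xi> \<in> ell2 \<Longrightarrow> (\<lambda>x. c * \<xi> x) \<in> ell2"
  unfolding ell2_def by (simp add: norm_mult power_mult_distrib summable_on_cmult_right)

lemma ell2_uminus: "\<xi> \<in> ell2 \<Longrightarrow> (\<lambda>x. - \<xi> x) \<in> ell2"
  unfolding ell2_def by simp

lemma l2norm_uminus: "l2norm (\<lambda>x. - \<xi> x) = l2norm \<xi>"
  unfolding l2norm_def by simp

lemma l2norm_minus_commute: "l2norm (\<lambda>x. \<xi> x - \<eta> x) = l2norm (\<lambda>x. \<eta> x - \<xi> x)"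
  unfolding l2norm_def by (simp add: norm_minus_commute)

lemma ell2_diff:
  assumes "\<xi> \<in> ell2" "\<eta> \<in> ell2"
  shows "(\<lambda>x. \<xi> x - \<eta> x) \<in> ell2" "l2norm (\<lambda>x. \<xi> x - \<eta> x) \<le> l2norm \<xi> + l2norm \<eta>"
  using ell2_add[OF assms(1) ell2_uminus[OF assms(2)]] by (simp_all add: l2norm_uminus)

lemma l2norm_triangle_sub:
  assumes "\<xi> \<in> ell2" "\<eta> \<in> ell2"
  shows "l2norm \<xi> \<le> l2norm \<eta> + l2norm (\<lambda>x. \<xi> x - \<eta> x)"
  using ell2_add(2)[OF assms(2) ell2_diff(1)[OF assms]] by simp

lemma ell2_sum:
  assumes "finite I" "\<And>i. i \<in> I \<Longrightarrow> f i \<in> ell2"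
  shows "(\<lambda>x. \<Sum>i\<in>I. f i x) \<in> ell2" "l2norm (\<lambda>x. \<Sum>i\<in>I. f i x) \<le> (\<Sum>i\<in>I. l2norm (f i))"
  using assms
proof (induction I rule: finite_induct)
  case (insert i I)
  { case 1 then show ?case using insert by (simp add: ell2_add) }
  { case 2 then show ?case
      using insert ell2_add(2)[of "f i" "\<lambda>x. \<Sum>i\<in>I. f i x"] by simp }
qed auto

lemma ell2_restr [simp]: "\<xi> \<in> ell2 \<Longrightarrow> restr D \<xi> \<in> ell2"
  by (rule ell2_mono) (auto simp: restr_def)

lemma l2norm_restr_le: "\<xi> \<in> ell2 \<Longrightarrow> l2norm (restr D \<xi>) \<le> l2norm \<xi>"
  by (rule ell2_mono) (auto simp: restr_def)

lemma restr_restr [simp]: "restr C (restr D \<xi>) = restr (C \<inter> D) \<xi>"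
  by (auto simp: restr_def)

lemma ell2_restr_finite: "finite F \<Longrightarrow> restr F \<xi> \<in> ell2"
  using ell2_finite_support[of F "restr F \<xi>"] by (auto simp: restr_def)

lemma l2norm_restr_finite: "finite F \<Longrightarrow> l2norm (restr F \<xi>) = L2_set (\<lambda>x. cmod (\<xi> x)) F"
  using ell2_finite_support(2)[of F "restr F \<xi>"]
  by (auto simp: restr_def L2_set_def intro!: sum.cong)

lemma restr_as_sum: "finite F \<Longrightarrow> restr F \<xi> = (\<lambda>x. \<Sum>y\<in>F. \<xi> y * delta y x)"
  by (auto simp: restr_def delta_def fun_eq_iff if_distrib[of "\<lambda>z. _ * z"] cong: if_cong)

lemma l2norm_pythagoras:
  assumes "\<xi> \<in> ell2"
  shows "(l2norm \<xi>)\<^sup>2 = (l2norm (restr D \<xi>))\<^sup>2 + (l2norm (restr (- D) \<xi>))\<^sup>2"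
proof -
  have s: "(\<lambda>x. (cmod (restr C \<xi> x))\<^sup>2) summable_on UNIV" for C
    using ell2_restr[OF assms, of C] by (simp add: ell2_def)
  have "(\<Sum>\<^sub>\<infinity>x. (cmod (\<xi> x))\<^sup>2) = (\<Sum>\<^sub>\<infinity>x. (cmod (restr D \<xi> x))\<^sup>2 + (cmod (restr (-D) \<xi> x))\<^sup>2)"
    by (rule infsum_cong) (auto simp: restr_def)
  also have "\<dots> = (\<Sum>\<^sub>\<infinity>x. (cmod (restr D \<xi> x))\<^sup>2) + (\<Sum>\<^sub>\<infinity>x. (cmod (restr (-D) \<xi> x))\<^sup>2)"
    by (rule infsum_add[OF s s])
  finally show ?thesis unfolding l2norm_def by (simp add: infsum_nonneg)
qed

lemma ell2_tail:
  assumes "\<xi> \<in> ell2" "e > 0"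
  obtains F where "finite F" "l2norm (restr (- F) \<xi>) \<le> e"
proof -
  let ?f = "\<lambda>x. (cmod (\<xi> x))\<^sup>2"
  have s: "?f summable_on UNIV" using assms by (simp add: ell2_def)
  have "e\<^sup>2 > 0" using assms(2) by simp
  from infsum_finite_approximation[OF s this]
  obtain F where F: "finite F" "dist (sum ?f F) (infsum ?f UNIV) \<le> e\<^sup>2" by blast
  have 1: "(l2norm (restr F \<xi>))\<^sup>2 = sum ?f F"
    unfolding l2norm_restr_finite[OF F(1)] L2_set_def by (rule real_sqrt_pow2) (simp add: sum_nonneg)
  have 2: "(l2norm \<xi>)\<^sup>2 = infsum ?f UNIV"
    unfolding l2norm_def by (rule real_sqrt_pow2) (simp add: infsum_nonneg)
  have "(l2norm \<xi>)\<^sup>2 \<le> e\<^sup>2 + (l2norm (restr F \<xi>))\<^sup>2"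
    unfolding 1 2 using F(2) unfolding dist_real_def by arith
  then have "(l2norm (restr (- F) \<xi>))\<^sup>2 \<le> e\<^sup>2"
    unfolding l2norm_pythagoras[OF assms(1), of F] by (simp only: add_le_cancel_left add.commute)
  then have "l2norm (restr (- F) \<xi>) \<le> e"
    by (rule power2_le_imp_le) (use assms(2) in simp)
  with F(1) show ?thesis by (rule that)
qed

lemma l2inner_abs_summable:
  assumes "\<xi> \<in> ell2" "\<eta> \<in> ell2"
  shows "(\<lambda>x. cmod (cnj (\<xi> x) * \<eta> x)) summable_on UNIV" "(\<Sum>\<^sub>\<infinity>x. cmod (cnj (\<xi> x) * \<eta> x)) \<le> l2norm \<xi> * l2norm \<eta>"
proof -
  have b: "(\<Sum>x\<in>F. cmod (cnj (\<xi> x) * \<eta> x)) \<le> l2norm \<xi> * l2norm \<eta>" if "finite F" for F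
  proof -
    have "(\<Sum>x\<in>F. cmod (cnj (\<xi> x) * \<eta> x)) = (\<Sum>x\<in>F. \<bar>cmod (\<xi> x)\<bar> * \<bar>cmod (\<eta> x)\<bar>)"
      by (simp add: norm_mult)
    also have "\<dots> \<le> L2_set (\<lambda>x. cmod (\<xi> x)) F * L2_set (\<lambda>x. cmod (\<eta> x)) F"
      by (rule L2_set_mult_ineq)
    also have "\<dots> \<le> l2norm \<xi> * l2norm \<eta>"
      by (intro mult_mono L2_set_le_l2norm assms that) auto
    finally show ?thesis .
  qed
  show s: "(\<lambda>x. cmod (cnj (\<xi> x) * \<eta> x)) summable_on UNIV"
    by (auto intro!: nonneg_bdd_above_summable_on bdd_aboveI[of _ "l2norm \<xi> * l2norm \<eta>"] b simp del: norm_mult complex_mod_cnj complex_mod_mult_cnj)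
  show "(\<Sum>\<^sub>\<infinity>x. cmod (cnj (\<xi> x) * \<eta> x)) \<le> l2norm \<xi> * l2norm \<eta>"
    by (intro infsum_le_finite_sums[OF s] b) auto
qed

lemma l2inner_summable:
  "\<xi> \<in> ell2 \<Longrightarrow> \<eta> \<in> ell2 \<Longrightarrow> (\<lambda>x. cnj (\<xi> x) * \<eta> x) summable_on UNIV"
  by (rule abs_summable_summable[OF l2inner_abs_summable(1)])

lemma Cauchy_Schwarz_l2:
  assumes "\<xi> \<in> ell2" "\<eta> \<in> ell2"
  shows "cmod (l2inner \<xi> \<eta>) \<le> l2norm \<xi> * l2norm \<eta>"
  using norm_infsum_bound[OF l2inner_abs_summable(1)[OF assms]] l2inner_abs_summable(2)[OF assms]
  unfolding l2inner_def by linarith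

lemma l2inner_self:
  assumes "\<xi> \<in> ell2"
  shows "l2inner \<xi> \<xi> = complex_of_real ((l2norm \<xi>)\<^sup>2)"
proof -
  have "l2inner \<xi> \<xi> = (\<Sum>\<^sub>\<infinity>x. complex_of_real ((cmod (\<xi> x))\<^sup>2))"
    unfolding l2inner_def by (simp add: complex_norm_square[symmetric] mult.commute)
  also have "\<dots> = complex_of_real (\<Sum>\<^sub>\<infinity>x. (cmod (\<xi> x))\<^sup>2)"
    using assms unfolding ell2_def by (intro infsumI has_sum_of_real has_sum_infsum) simp
  finally show ?thesis unfolding l2norm_def by (simp add: infsum_nonneg)
qed

lemma l2inner_add_right:
  assumes "\<xi> \<in> ell2" "\<eta> \<in> ell2" "\<zeta> \<in> ell2"
  shows "l2inner \<xi> (\<lambda>x. \<eta> x + \<zeta> x) = l2inner \<xi> \<eta> + l2inner \<xi> \<zeta>"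
  unfolding l2inner_def by (simp add: distrib_left infsum_add l2inner_summable assms)

lemma l2inner_scale_right: "l2inner \<xi> (\<lambda>x. c * \<eta> x) = c * l2inner \<xi> \<eta>"
proof -
  have "l2inner \<xi> (\<lambda>x. c * \<eta> x) = (\<Sum>\<^sub>\<infinity>x. c * (cnj (\<xi> x) * \<eta> x))"
    unfolding l2inner_def by (simp add: mult.left_commute)
  then show ?thesis unfolding l2inner_def by (simp add: infsum_cmult_right')
qed

lemma l2inner_commute: "l2inner \<eta> \<xi> = cnj (l2inner \<xi> \<eta>)"
proof -
  have "cnj (l2inner \<xi> \<eta>) = (\<Sum>\<^sub>\<infinity>x. cnj (cnj (\<xi> x) * \<eta> x))"
    unfolding l2inner_def by (rule infsum_cnj[symmetric])
  then show ?thesis unfolding l2inner_def by (simp add: mult.commute)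
qed

lemma l2inner_add_left:
  assumes "\<xi> \<in> ell2" "\<eta> \<in> ell2" "\<zeta> \<in> ell2"
  shows "l2inner (\<lambda>x. \<eta> x + \<zeta> x) \<xi> = l2inner \<eta> \<xi> + l2inner \<zeta> \<xi>"
  using l2inner_add_right[OF assms] by (metis complex_cnj_add l2inner_commute)

lemma l2inner_scale_left: "l2inner (\<lambda>x. c * \<eta> x) \<xi> = cnj c * l2inner \<eta> \<xi>"
  by (metis complex_cnj_mult l2inner_commute l2inner_scale_right)

lemma l2inner_delta_left [simp]: "l2inner (delta y) \<xi> = \<xi> y"
proof -
  have "l2inner (delta y) \<xi> = (\<Sum>\<^sub>\<infinity>x\<in>{y}. cnj (delta y x) * \<xi> x)"
    unfolding l2inner_def by (rule infsum_cong_neutral) (auto simp: delta_def)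
  then show ?thesis by (simp add: delta_def)
qed

lemma l2inner_restr: "l2inner (restr D \<xi>) \<eta> = l2inner \<xi> (restr D \<eta>)"
  unfolding l2inner_def by (rule infsum_cong) (auto simp: restr_def)

lemma l2inner_zero_left [simp]: "l2inner (\<lambda>_. 0) \<xi> = 0"
  unfolding l2inner_def by simp

text \<open>A norm bound by duality: the inner product of \<open>\<eta>\<close> with itself is the
  squared norm, so one factor cancels.\<close>

lemma l2norm_le_by_inner:
  assumes "\<eta> \<in> ell2" "0 \<le> K" "cmod (l2inner \<eta> \<eta>) \<le> K * l2norm \<eta>"
  shows "l2norm \<eta> \<le> K"
proof (cases "l2norm \<eta> = 0")
  case False
  then have "l2norm \<eta> > 0" by (simp add: less_le)
  moreover have "l2norm \<eta> * l2norm \<eta> \<le> K * l2norm \<eta>"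
    using assms by (simp add: l2inner_self power2_eq_square del: of_real_mult)
  ultimately show ?thesis by simp
qed (use assms in simp)

section \<open>Bounded operators\<close>

lemma bounded_op_ell2: "bounded_op T \<Longrightarrow> \<xi> \<in> ell2 \<Longrightarrow> T \<xi> \<in> ell2"
  by (simp add: bounded_op_def)

lemma bounded_op_outside: "bounded_op T \<Longrightarrow> \<xi> \<notin> ell2 \<Longrightarrow> T \<xi> = (\<lambda>_. 0)"
  by (simp add: bounded_op_def)

lemma bounded_op_in_ell2 [simp]: "bounded_op T \<Longrightarrow> T \<xi> \<in> ell2"
  by (cases "\<xi> \<in> ell2") (auto simp: bounded_op_ell2 bounded_op_outside)

lemma bounded_op_lin:
  "bounded_op T \<Longrightarrow> \<xi> \<in> ell2 \<Longrightarrow> \<eta> \<in> ell2 \<Longrightarrow> T (\<lambda>x. c * \<xi> x + \<eta> x) = (\<lambda>x. c * T \<xi> x + T \<eta> x)"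
  by (simp add: bounded_op_def)

lemma bounded_op_add:
  "bounded_op T \<Longrightarrow> \<xi> \<in> ell2 \<Longrightarrow> \<eta> \<in> ell2 \<Longrightarrow> T (\<lambda>x. \<xi> x + \<eta> x) = (\<lambda>x. T \<xi> x + T \<eta> x)"
  using bounded_op_lin[of T \<xi> \<eta> 1] by simp

lemma bounded_op_zero: "bounded_op T \<Longrightarrow> T (\<lambda>_. 0) = (\<lambda>_. 0)"
  using bounded_op_add[of T "\<lambda>_. 0" "\<lambda>_. 0"] by (auto simp: fun_eq_iff)

lemma bounded_op_scale: "bounded_op T \<Longrightarrow> \<xi> \<in> ell2 \<Longrightarrow> T (\<lambda>x. c * \<xi> x) = (\<lambda>x. c * T \<xi> x)"
  using bounded_op_lin[of T \<xi> "\<lambda>_. 0" c] by (simp add: bounded_op_zero)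

lemma bounded_op_sum:
  assumes "bounded_op T" "finite I" "\<And>i. i \<in> I \<Longrightarrow> f i \<in> ell2"
  shows "T (\<lambda>x. \<Sum>i\<in>I. f i x) = (\<lambda>x. \<Sum>i\<in>I. T (f i) x)"
  using assms(2,3)
proof (induction I rule: finite_induct)
  case (insert i I)
  then have "T (\<lambda>x. f i x + (\<Sum>i\<in>I. f i x)) = (\<lambda>x. T (f i) x + T (\<lambda>x. \<Sum>i\<in>I. f i x) x)"
    by (intro bounded_op_add[OF assms(1)] ell2_sum(1)[OF insert(1)]) auto
  with insert show ?case by simp
qed (simp add: bounded_op_zero assms(1))

lemma bounded_op_bound:
  assumes "bounded_op T"
  obtains C where "C > 0" "\<And>\<xi>. \<xi> \<in> ell2 \<Longrightarrow> l2norm (T \<xi>) \<le> C * l2norm \<xi>"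
proof -
  obtain C where C: "\<forall>\<xi>\<in>ell2. l2norm (T \<xi>) \<le> C * l2norm \<xi>"
    using assms by (auto simp: bounded_op_def)
  have "l2norm (T \<xi>) \<le> (\<bar>C\<bar> + 1) * l2norm \<xi>" if "\<xi> \<in> ell2" for \<xi>
    using C that mult_right_mono[of C "\<bar>C\<bar> + 1" "l2norm \<xi>"] by fastforce
  then show ?thesis by (intro that[of "\<bar>C\<bar> + 1"]) auto
qed

lemma bounded_opI:
  assumes "\<And>\<xi>. \<xi> \<in> ell2 \<Longrightarrow> T \<xi> \<in> ell2"
    and "\<And>\<xi> \<eta> c. \<xi> \<in> ell2 \<Longrightarrow> \<eta> \<in> ell2 \<Longrightarrow> T (\<lambda>x. c * \<xi> x + \<eta> x) = (\<lambda>x. c * T \<xi> x + T \<eta> x)"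
    and "\<And>\<xi>. \<xi> \<in> ell2 \<Longrightarrow> l2norm (T \<xi>) \<le> C * l2norm \<xi>"
    and "\<And>\<xi>. \<xi> \<notin> ell2 \<Longrightarrow> T \<xi> = (\<lambda>_. 0)"
  shows "bounded_op T"
  using assms unfolding bounded_op_def by blast

lemma restr_split: "\<xi> = (\<lambda>x. restr F \<xi> x + restr (- F) \<xi> x)"
  by (auto simp: restr_def)

lemma bounded_op_restr_split:
  assumes "bounded_op T" "\<xi> \<in> ell2"
  shows "T \<xi> = (\<lambda>x. T (restr F \<xi>) x + T (restr (- F) \<xi>) x)"
  by (subst restr_split[of _ F]) (rule bounded_op_add, use assms in auto)

lemma bounded_op_restr_finite:
  assumes "bounded_op T" "finite F"
  shows "T (restr F \<xi>) = (\<lambda>x. \<Sum>y\<in>F. \<xi> y * T (delta y) x)"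
  unfolding restr_as_sum[OF assms(2)]
  by (subst bounded_op_sum) (auto simp: assms ell2_scale bounded_op_scale)

text \<open>Density of finitely supported vectors: the a priori bound \<open>C\<close> of
  \<open>T\<close> only controls the tail, which is chosen of norm at most
  \<open>e / C\<close>.\<close>

lemma norm_bound_from_finite:
  assumes T: "bounded_op T" and K: "0 \<le> K"
    and b: "\<And>F \<xi>. finite F \<Longrightarrow> l2norm (T (restr F \<xi>)) \<le> K * l2norm (restr F \<xi>)"
    and \<xi>: "\<xi> \<in> ell2"
  shows "l2norm (T \<xi>) \<le> K * l2norm \<xi>"
proof (rule field_le_epsilon)
  fix e :: real assume e: "0 < e"
  obtain C where C: "C > 0" "\<And>\<xi>. \<xi> \<in> ell2 \<Longrightarrow> l2norm (T \<xi>) \<le> C * l2norm \<xi>"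
    using bounded_op_bound[OF T] by blast
  obtain F where F: "finite F" "l2norm (restr (- F) \<xi>) \<le> e / C"
    using ell2_tail[OF \<xi>, of "e / C"] e C(1) by auto
  have "l2norm (T \<xi>) \<le> l2norm (T (restr F \<xi>)) + l2norm (T (restr (- F) \<xi>))"
    unfolding bounded_op_restr_split[OF T \<xi>, of F]
    by (rule ell2_add) (use T \<xi> in auto)
  also have "\<dots> \<le> K * l2norm (restr F \<xi>) + C * l2norm (restr (- F) \<xi>)"
    using b[OF F(1)] C(2)[OF ell2_restr[OF \<xi>]] by (simp add: add_mono)
  also have "\<dots> \<le> K * l2norm \<xi> + C * (e / C)"
    using F(2) C(1) K l2norm_restr_le[OF \<xi>, of F] by (intro add_mono mult_left_mono) auto
  finally show "l2norm (T \<xi>) \<le> K * l2norm \<xi> + e" using C(1) by simp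
qed

lemma bounded_op_eqI:
  assumes "bounded_op T" "bounded_op U" "\<And>\<xi>. \<xi> \<in> ell2 \<Longrightarrow> T \<xi> = U \<xi>"
  shows "T = U"
  using assms by (metis bounded_op_outside ext)

lemma l2inner_sum_left:
  assumes "finite I" "\<And>i. i \<in> I \<Longrightarrow> f i \<in> ell2" "\<xi> \<in> ell2"
  shows "l2inner (\<lambda>x. \<Sum>i\<in>I. f i x) \<xi> = (\<Sum>i\<in>I. l2inner (f i) \<xi>)"
  using assms(1,2)
  by (induction I rule: finite_induct) (simp_all add: l2inner_add_left ell2_sum assms(3))

text \<open>The adjoint is written down by its coordinates
  \<open>l2inner (T (delta x)) \<eta>\<close>. The defining identity is clear on finitely supported
  vectors and passes to all of \<open>ell2\<close> by cutting off a small tail.\<close>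

lemma adjoint_exists:
  assumes T: "bounded_op T"
  shows "\<exists>S. bounded_op S \<and> (\<forall>\<xi>\<in>ell2. \<forall>\<eta>\<in>ell2. l2inner (T \<xi>) \<eta> = l2inner \<xi> (S \<eta>))"
proof -
  define S where "S = (\<lambda>\<eta>. if \<eta> \<in> ell2 then (\<lambda>x. l2inner (T (delta x)) \<eta>) else (\<lambda>_. 0))"
  obtain C where C: "C > 0" "\<And>\<xi>. \<xi> \<in> ell2 \<Longrightarrow> l2norm (T \<xi>) \<le> C * l2norm \<xi>"
    using bounded_op_bound[OF T] by blast
  have fin: "l2inner (T (restr F \<xi>)) \<eta> = l2inner (restr F \<xi>) (S \<eta>)"
    if "finite F" "\<eta> \<in> ell2" "S \<eta> \<in> ell2" for F \<xi> \<eta>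
    unfolding bounded_op_restr_finite[OF T that(1)]
    unfolding restr_as_sum[OF that(1)]
    by (subst (1 2) l2inner_sum_left)
      (use that T in \<open>auto simp: ell2_scale l2inner_scale_left, simp add: S_def\<close>)
  \<comment> \<open>Square summability comes from testing \<open>T\<close> on the truncation
    \<open>?z\<close> of the candidate itself, for which the inner product of \<open>T ?z\<close>
    with \<open>\<eta>\<close> is the squared norm of \<open>?z\<close>.\<close>
  have bd: "L2_set (\<lambda>x. cmod (S \<eta> x)) F \<le> C * l2norm \<eta>" if F: "finite F" and \<eta>: "\<eta> \<in> ell2" for F \<eta>
  proof -
    let ?z = "restr F (S \<eta>)"
    have z: "?z \<in> ell2" by (rule ell2_restr_finite[OF F])
    have "l2inner (T ?z) \<eta> = (\<Sum>y\<in>F. l2inner (\<lambda>x. S \<eta> y * T (delta y) x) \<eta>)"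
      unfolding bounded_op_restr_finite[OF T F]
      by (rule l2inner_sum_left) (use F T \<eta> in \<open>auto simp: ell2_scale\<close>)
    also have "\<dots> = (\<Sum>y\<in>F. cnj (S \<eta> y) * S \<eta> y)"
      using \<eta> by (simp add: l2inner_scale_left S_def)
    also have "\<dots> = (\<Sum>y\<in>F. l2inner (\<lambda>x. S \<eta> y * delta y x) ?z)"
      by (intro sum.cong) (auto simp: l2inner_scale_left, simp add: restr_def)
    also have "\<dots> = l2inner (\<lambda>x. \<Sum>y\<in>F. S \<eta> y * delta y x) ?z"
      by (rule l2inner_sum_left[symmetric]) (use F z in \<open>auto simp: ell2_scale\<close>)
    finally have "l2inner (T ?z) \<eta> = l2inner ?z ?z"
      using restr_as_sum[OF F, of "S \<eta>"] by simp
    then have "cmod (l2inner ?z ?z) \<le> l2norm (T ?z) * l2norm \<eta>"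
      using Cauchy_Schwarz_l2[OF bounded_op_in_ell2[OF T] \<eta>] by metis
    also have "\<dots> \<le> (C * l2norm ?z) * l2norm \<eta>"
      using C(2)[OF z] by (simp add: mult_right_mono)
    also have "\<dots> = (C * l2norm \<eta>) * l2norm ?z" by simp
    finally have "l2norm ?z \<le> C * l2norm \<eta>"
      by (rule l2norm_le_by_inner[OF z, rotated]) (use C(1) in simp)
    then show ?thesis by (simp add: l2norm_restr_finite[OF F])
  qed
  have Sb: "S \<eta> \<in> ell2" "l2norm (S \<eta>) \<le> C * l2norm \<eta>" if "\<eta> \<in> ell2" for \<eta>
    using ell2_bounded[OF bd[OF _ that]] by blast+
  have Sell: "S \<eta> \<in> ell2" for \<eta>
    by (cases "\<eta> \<in> ell2", erule Sb(1), simp add: S_def)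
  have "bounded_op S"
  proof (rule bounded_opI)
    fix \<xi> \<eta> :: "'a \<Rightarrow> complex" and c assume "\<xi> \<in> ell2" "\<eta> \<in> ell2"
    then show "S (\<lambda>x. c * \<xi> x + \<eta> x) = (\<lambda>x. c * S \<xi> x + S \<eta> x)"
      using T by (simp add: S_def ell2_scale ell2_add l2inner_add_right l2inner_scale_right)
  qed (auto intro: Sell Sb(2), simp add: S_def)
  moreover have "l2inner (T \<xi>) \<eta> = l2inner \<xi> (S \<eta>)" if \<xi>: "\<xi> \<in> ell2" and \<eta>: "\<eta> \<in> ell2" for \<xi> \<eta>
  proof -
    let ?D = "cmod (l2inner (T \<xi>) \<eta> - l2inner \<xi> (S \<eta>))"
    have "?D \<le> 0 + e" if e: "e > 0" for e
    proof -
      define k where "k = 2 * C * l2norm \<eta> + 1"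
      have k: "k > 0" using C(1) by (simp add: k_def add_nonneg_pos)
      obtain F where F: "finite F" "l2norm (restr (- F) \<xi>) \<le> e / k"
        using ell2_tail[OF \<xi>, of "e / k"] e k by auto
      let ?r = "restr (- F) \<xi>"
      have r: "?r \<in> ell2" using \<xi> by simp
      have "l2inner (T \<xi>) \<eta> = l2inner (T (restr F \<xi>)) \<eta> + l2inner (T ?r) \<eta>"
        unfolding bounded_op_restr_split[OF T \<xi>, of F] by (rule l2inner_add_left) (use T \<eta> in auto)
      moreover have "l2inner \<xi> (S \<eta>) = l2inner (restr F \<xi>) (S \<eta>) + l2inner ?r (S \<eta>)"
        by (subst restr_split[of \<xi> F]) (rule l2inner_add_left, use \<xi> Sell in auto)
      ultimately have "?D = cmod (l2inner (T ?r) \<eta> - l2inner ?r (S \<eta>))"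
        using fin[OF F(1) \<eta> Sell] by simp
      also have "\<dots> \<le> cmod (l2inner (T ?r) \<eta>) + cmod (l2inner ?r (S \<eta>))"
        by (rule norm_triangle_ineq4)
      also have "\<dots> \<le> l2norm (T ?r) * l2norm \<eta> + l2norm ?r * l2norm (S \<eta>)"
        by (intro add_mono Cauchy_Schwarz_l2) (use T \<eta> r Sell in auto)
      also have "\<dots> \<le> (C * l2norm ?r) * l2norm \<eta> + l2norm ?r * (C * l2norm \<eta>)"
        by (intro add_mono mult_right_mono mult_left_mono C Sb(2) \<eta> r) auto
      also have "\<dots> = (2 * C * l2norm \<eta>) * l2norm ?r" by (simp add: algebra_simps)
      also have "\<dots> \<le> k * (e / k)"
        by (intro mult_mono F(2)) (use k in \<open>auto simp: k_def\<close>)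
      also have "\<dots> = e" using k by simp
      finally show ?thesis by simp
    qed
    then have "?D \<le> 0" by (rule field_le_epsilon)
    then show ?thesis by simp
  qed
  ultimately show ?thesis by blast
qed

text \<open>Pairing with \<open>delta x\<close> reads off the coordinate at \<open>x\<close>.
  Together with existence this gives the definite description in \<open>op_adjoint\<close> its
  meaning.\<close>

lemma adjoint_unique:
  assumes "bounded_op S" "\<forall>\<xi>\<in>ell2. \<forall>\<eta>\<in>ell2. l2inner (T \<xi>) \<eta> = l2inner \<xi> (S \<eta>)"
    and "bounded_op S'" "\<forall>\<xi>\<in>ell2. \<forall>\<eta>\<in>ell2. l2inner (T \<xi>) \<eta> = l2inner \<xi> (S' \<eta>)"
  shows "S = S'"
proof (rule bounded_op_eqI[OF assms(1,3)])
  fix \<eta> :: "'a \<Rightarrow> complex" assume "\<eta> \<in> ell2"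
  then show "S \<eta> = S' \<eta>"
    using assms(2,4) by (metis ell2_delta ext l2inner_delta_left)
qed

lemma op_adjoint:
  assumes "bounded_op T"
  shows bounded_op_adjoint: "bounded_op (op_adjoint T)"
    and l2inner_adjoint: "\<xi> \<in> ell2 \<Longrightarrow> \<eta> \<in> ell2 \<Longrightarrow> l2inner (T \<xi>) \<eta> = l2inner \<xi> (op_adjoint T \<eta>)"
proof -
  let ?P = "\<lambda>S. bounded_op S \<and> (\<forall>\<xi>\<in>ell2. \<forall>\<eta>\<in>ell2. l2inner (T \<xi>) \<eta> = l2inner \<xi> (S \<eta>))"
  obtain S where S: "?P S" using adjoint_exists[OF assms] by blast
  have "?P (THE S. ?P S)"
  proof (rule theI[of ?P, OF S])
    fix S' assume "?P S'"
    then show "S' = S" using S adjoint_unique[of S' T S] by blast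
  qed
  then have "?P (op_adjoint T)" unfolding op_adjoint_def .
  then show "bounded_op (op_adjoint T)"
    "\<xi> \<in> ell2 \<Longrightarrow> \<eta> \<in> ell2 \<Longrightarrow> l2inner (T \<xi>) \<eta> = l2inner \<xi> (op_adjoint T \<eta>)" by auto
qed

lemma l2inner_adjoint':
  "bounded_op T \<Longrightarrow> \<xi> \<in> ell2 \<Longrightarrow> \<eta> \<in> ell2 \<Longrightarrow> l2inner (op_adjoint T \<xi>) \<eta> = l2inner \<xi> (T \<eta>)"
  by (metis l2inner_adjoint l2inner_commute)

lemma op_adjoint_eqI:
  assumes "bounded_op T" "bounded_op S"
    and "\<And>\<xi> \<eta>. \<xi> \<in> ell2 \<Longrightarrow> \<eta> \<in> ell2 \<Longrightarrow> l2inner (T \<xi>) \<eta> = l2inner \<xi> (S \<eta>)"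
  shows "op_adjoint T = S"
  by (rule adjoint_unique[of _ T]) (use assms in \<open>auto simp: bounded_op_adjoint l2inner_adjoint\<close>)

section \<open>Operator norm and algebraic operations\<close>

lemma opnorm_bound:
  assumes T: "bounded_op T" and \<xi>: "\<xi> \<in> ell2"
  shows "l2norm (T \<xi>) \<le> opnorm T * l2norm \<xi>"
proof (cases "l2norm \<xi> = 0")
  case True
  then show ?thesis using l2norm_eq_0[OF \<xi>] bounded_op_zero[OF T] by simp
next
  case False
  define n where "n = l2norm \<xi>"
  have n: "n > 0" using False by (simp add: n_def less_le)
  obtain C where C: "C > 0" "\<And>\<xi>. \<xi> \<in> ell2 \<Longrightarrow> l2norm (T \<xi>) \<le> C * l2norm \<xi>"
    using bounded_op_bound[OF T] by blast
  let ?u = "\<lambda>x. complex_of_real (1 / n) * \<xi> x"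
  have u: "?u \<in> ell2" "l2norm ?u = 1"
    using n by (auto intro: ell2_scale \<xi> simp: l2norm_scale norm_divide n_def[symmetric] simp del: of_real_divide)
  have "l2norm (T ?u) \<le> opnorm T" unfolding opnorm_def
  proof (rule cSup_upper)
    show "bdd_above {l2norm (T \<xi>) |\<xi>. \<xi> \<in> ell2 \<and> l2norm \<xi> \<le> 1}"
      by (rule bdd_aboveI[of _ C]) (use C in \<open>force intro: order_trans mult_left_le\<close>)
  qed (use u in auto)
  also have "l2norm (T ?u) = l2norm (T \<xi>) / n"
    using n by (simp add: bounded_op_scale[OF T \<xi>] l2norm_scale norm_divide del: of_real_divide)
  finally show ?thesis using n by (simp add: field_simps n_def)
qed

lemma opnorm_le:
  assumes "0 \<le> K" "\<And>\<xi>. \<xi> \<in> ell2 \<Longrightarrow> l2norm (T \<xi>) \<le> K * l2norm \<xi>"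
  shows "opnorm T \<le> K"
  unfolding opnorm_def
proof (rule cSup_least)
  show "{l2norm (T \<xi>) |\<xi>. \<xi> \<in> ell2 \<and> l2norm \<xi> \<le> 1} \<noteq> {}"
    by (auto intro: exI[of _ "\<lambda>_. 0"])
next
  fix r assume "r \<in> {l2norm (T \<xi>) |\<xi>. \<xi> \<in> ell2 \<and> l2norm \<xi> \<le> 1}"
  then obtain \<xi> where \<xi>: "r = l2norm (T \<xi>)" "\<xi> \<in> ell2" "l2norm \<xi> \<le> 1" by auto
  then show "r \<le> K" using assms(2)[of \<xi>] mult_left_le[of "l2norm \<xi>" K] assms(1) by linarith
qed

text \<open>Any unit vector will do; \<open>delta undefined\<close> is one because every type is
  inhabited.\<close>

lemma opnorm_nonneg: "bounded_op T \<Longrightarrow> 0 \<le> opnorm T"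
  using opnorm_bound[of T "delta undefined"] by (metis ell2_delta l2norm_delta l2norm_nonneg mult.right_neutral order_trans)

lemma bounded_op_plus:
  assumes T: "bounded_op T" and U: "bounded_op U"
  shows "bounded_op (op_plus T U)"
proof -
  obtain C where C: "C > 0" "\<And>\<xi>. \<xi> \<in> ell2 \<Longrightarrow> l2norm (T \<xi>) \<le> C * l2norm \<xi>"
    using bounded_op_bound[OF T] by blast
  obtain D where D: "D > 0" "\<And>\<xi>. \<xi> \<in> ell2 \<Longrightarrow> l2norm (U \<xi>) \<le> D * l2norm \<xi>"
    using bounded_op_bound[OF U] by blast
  show ?thesis
  proof (rule bounded_opI[where C = "C + D"])
    fix \<xi> :: "'a \<Rightarrow> complex" assume \<xi>: "\<xi> \<in> ell2"
    show "l2norm (op_plus T U \<xi>) \<le> (C + D) * l2norm \<xi>"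
      using ell2_add(2)[of "T \<xi>" "U \<xi>"] C(2)[OF \<xi>] D(2)[OF \<xi>] T U
      unfolding op_plus_def by (simp add: algebra_simps)
  qed (use T U in \<open>auto simp: op_plus_def ell2_add bounded_op_lin bounded_op_outside, simp add: algebra_simps\<close>)
qed

lemma bounded_op_scaled:
  assumes T: "bounded_op T"
  shows "bounded_op (op_scale c T)"
proof -
  obtain C where C: "C > 0" "\<And>\<xi>. \<xi> \<in> ell2 \<Longrightarrow> l2norm (T \<xi>) \<le> C * l2norm \<xi>"
    using bounded_op_bound[OF T] by blast
  show ?thesis
  proof (rule bounded_opI[where C = "cmod c * C"])
    fix \<xi> :: "'a \<Rightarrow> complex" assume \<xi>: "\<xi> \<in> ell2"
    show "l2norm (op_scale c T \<xi>) \<le> (cmod c * C) * l2norm \<xi>"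
      using mult_left_mono[OF C(2)[OF \<xi>], of "cmod c"]
      unfolding op_scale_def by (simp add: l2norm_scale algebra_simps)
  qed (use T in \<open>auto simp: op_scale_def ell2_scale bounded_op_lin bounded_op_outside, simp add: algebra_simps\<close>)
qed

lemma op_minus_as_plus: "op_minus T U = op_plus T (op_scale (-1) U)"
  by (simp add: op_minus_def op_plus_def op_scale_def)

lemma bounded_op_minus: "bounded_op T \<Longrightarrow> bounded_op U \<Longrightarrow> bounded_op (op_minus T U)"
  by (simp add: op_minus_as_plus bounded_op_plus bounded_op_scaled)

lemma bounded_op_comp:
  assumes T: "bounded_op T" and U: "bounded_op U"
  shows "bounded_op (T \<circ> U)"
proof -
  obtain C where C: "C > 0" "\<And>\<xi>. \<xi> \<in> ell2 \<Longrightarrow> l2norm (T \<xi>) \<le> C * l2norm \<xi>"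
    using bounded_op_bound[OF T] by blast
  obtain D where D: "D > 0" "\<And>\<xi>. \<xi> \<in> ell2 \<Longrightarrow> l2norm (U \<xi>) \<le> D * l2norm \<xi>"
    using bounded_op_bound[OF U] by blast
  show ?thesis
  proof (rule bounded_opI[where C = "C * D"])
    fix \<xi> :: "'a \<Rightarrow> complex" assume \<xi>: "\<xi> \<in> ell2"
    show "l2norm ((T \<circ> U) \<xi>) \<le> (C * D) * l2norm \<xi>"
      using order_trans[OF C(2)[OF bounded_op_in_ell2[OF U]] mult_left_mono[OF D(2)[OF \<xi>] less_imp_le[OF C(1)]]]
      by (simp add: mult.assoc)
  qed (use T U in \<open>auto simp: bounded_op_lin bounded_op_outside bounded_op_zero\<close>)
qed

section \<open>Partial translations and diagonal projections as operators\<close>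

lemma transl_op_apply:
  assumes "inj_on (\<lambda>x. the (f x)) (dom f)" "f x = Some y" "\<xi> \<in> ell2"
  shows "transl_op f \<xi> y = \<xi> x"
proof -
  have "(THE x. f x = Some y) = x"
    using assms by (intro the_equality) (auto simp: inj_on_def dom_def)
  then show ?thesis using assms unfolding transl_op_def by auto
qed

lemma transl_op_outside_ran: "y \<notin> ran f \<Longrightarrow> transl_op f \<xi> y = 0"
  by (auto simp: transl_op_def ran_def)

lemma bounded_op_transl:
  assumes inj: "inj_on (\<lambda>x. the (f x)) (dom f)"
  shows "bounded_op (transl_op f)"
proof -
  have bd: "L2_set (\<lambda>y. cmod (transl_op f \<xi> y)) F \<le> l2norm \<xi>" if \<xi>: "\<xi> \<in> ell2" and F: "finite F" for F \<xi>
  proof -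
    define g where "g = (\<lambda>y. SOME x. f x = Some y)"
    have g: "f (g y) = Some y" if "y \<in> ran f" for y
      using that unfolding g_def ran_def by (auto intro: someI)
    have "(\<Sum>y\<in>F. (cmod (transl_op f \<xi> y))\<^sup>2) = (\<Sum>y\<in>F \<inter> ran f. (cmod (transl_op f \<xi> y))\<^sup>2)"
      by (rule sum.mono_neutral_right) (use F in \<open>auto simp: transl_op_outside_ran\<close>)
    also have "\<dots> = (\<Sum>y\<in>F \<inter> ran f. (cmod (\<xi> (g y)))\<^sup>2)"
      by (rule sum.cong) (auto simp: transl_op_apply[OF inj g \<xi>])
    also have "\<dots> = (\<Sum>x\<in>g ` (F \<inter> ran f). (cmod (\<xi> x))\<^sup>2)"
      by (rule sum.reindex[symmetric, unfolded o_def]) (auto simp: inj_on_def, metis g option.inject)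
    finally have "L2_set (\<lambda>y. cmod (transl_op f \<xi> y)) F = L2_set (\<lambda>x. cmod (\<xi> x)) (g ` (F \<inter> ran f))"
      by (simp add: L2_set_def)
    then show ?thesis using L2_set_le_l2norm[OF \<xi>] F by simp
  qed
  have b: "transl_op f \<xi> \<in> ell2" "l2norm (transl_op f \<xi>) \<le> 1 * l2norm \<xi>" if "\<xi> \<in> ell2" for \<xi>
    using ell2_bounded[OF bd[OF that]] by simp_all
  have lin: "transl_op f (\<lambda>x. c * \<xi> x + \<eta> x) y = c * transl_op f \<xi> y + transl_op f \<eta> y"
    if "\<xi> \<in> ell2" "\<eta> \<in> ell2" for \<xi> \<eta> c y
  proof (cases "y \<in> ran f")
    case True
    then obtain x where "f x = Some y" by (auto simp: ran_def)
    with that show ?thesis by (simp add: transl_op_apply[OF inj] ell2_add ell2_scale)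
  qed (simp add: transl_op_outside_ran)
  show ?thesis
  proof (rule bounded_opI[where C = 1])
    fix \<xi> :: "'a \<Rightarrow> complex" assume "\<xi> \<notin> ell2"
    then show "transl_op f \<xi> = (\<lambda>_. 0)" by (simp add: transl_op_def)
  qed (auto simp: b(1) lin fun_eq_iff intro: b(2)[simplified])
qed

text \<open>Encoded as a partial identity, so that membership in the uniform Roe algebra is
  immediate. On \<open>ell2\<close> it acts as \<open>restr D\<close>.\<close>

definition chi :: "'a set \<Rightarrow> 'a op" where
  "chi D = transl_op (\<lambda>x. if x \<in> D then Some x else None)"

lemma chi_apply:
  assumes "\<xi> \<in> ell2"
  shows "chi D \<xi> = restr D \<xi>"
proof
  fix x
  let ?f = "\<lambda>x. if x \<in> D then Some x else None"
  have "inj_on (\<lambda>x. the (?f x)) (dom ?f)" by (auto simp: inj_on_def dom_def)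
  from transl_op_apply[OF this _ assms, of x x] show "chi D \<xi> x = restr D \<xi> x"
    by (auto simp: chi_def restr_def ran_def intro!: transl_op_outside_ran split: if_splits)
qed

lemma partial_translation_chi: "partial_translation (\<lambda>x::'a::metric_space. if x \<in> D then Some x else None)"
  by (auto simp: partial_translation_def inj_on_def dom_def intro!: exI[of _ 0])

lemma bounded_op_chi [simp]: "bounded_op (chi D)"
  unfolding chi_def by (rule bounded_op_transl) (auto simp: inj_on_def dom_def)

lemma op_adjoint_chi: "op_adjoint (chi D) = chi D"
  by (rule op_adjoint_eqI) (auto simp: chi_apply l2inner_restr)

section \<open>Quasi-local operators\<close>

text \<open>Strict, to match the non-strict \<open>nbhd\<close>: a set and the complement of its
  \<open>R\<close>-neighbourhood are separated at \<open>R\<close> without loss.\<close>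

definition sep :: "real \<Rightarrow> 'a::metric_space set \<Rightarrow> 'a set \<Rightarrow> bool" where
  "sep R C D \<longleftrightarrow> (\<forall>x\<in>C. \<forall>y\<in>D. R < dist x y)"

definition nbhd :: "real \<Rightarrow> 'a::metric_space set \<Rightarrow> 'a set" where
  "nbhd R D = {x. \<exists>y\<in>D. dist x y \<le> R}"

text \<open>Precision and scale stay explicit arguments, so that one scale can be asserted for a
  whole family of operators.\<close>

definition ql :: "real \<Rightarrow> real \<Rightarrow> 'a::metric_space op \<Rightarrow> bool" where
  "ql e R T \<longleftrightarrow> (\<forall>C D \<xi>. sep R C D \<longrightarrow> \<xi> \<in> ell2 \<longrightarrow>
     l2norm (restr C (T (restr D \<xi>))) \<le> e * l2norm \<xi>)"

definition quasi_local :: "'a::metric_space op \<Rightarrow> bool" where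
  "quasi_local T \<longleftrightarrow> bounded_op T \<and> (\<forall>e>0. \<exists>R. ql e R T)"

lemma sep_compl_nbhd: "sep R (- nbhd R D) D"
  by (auto simp: sep_def nbhd_def not_le)

lemma sep_nbhd: "sep (R + R') C D \<Longrightarrow> sep R C (nbhd R' D)"
  unfolding sep_def nbhd_def
proof (intro ballI)
  fix x z assume a: "\<forall>x\<in>C. \<forall>y\<in>D. R + R' < dist x y" "x \<in> C" "z \<in> {x. \<exists>y\<in>D. dist x y \<le> R'}"
  then obtain y where y: "y \<in> D" "dist z y \<le> R'" by blast
  with a have "R + R' < dist x y" by blast
  then show "R < dist x z" using y(2) dist_triangle[of x y z] by linarith
qed

lemma sep_sym: "sep R C D \<Longrightarrow> sep R D C"
  unfolding sep_def by (metis dist_commute)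

lemma qlI:
  assumes "\<And>C D \<xi>. sep R C D \<Longrightarrow> \<xi> \<in> ell2 \<Longrightarrow> l2norm (restr C (T (restr D \<xi>))) \<le> e * l2norm \<xi>"
  shows "ql e R T"
  using assms unfolding ql_def by blast

lemma qlD:
  "ql e R T \<Longrightarrow> sep R C D \<Longrightarrow> \<xi> \<in> ell2 \<Longrightarrow> l2norm (restr C (T (restr D \<xi>))) \<le> e * l2norm \<xi>"
  unfolding ql_def by blast

lemma ql_mono:
  assumes "ql e R T" "e \<le> e'" "R \<le> R'"
  shows "ql e' R' T"
proof (rule qlI)
  fix C D :: "'a set" and \<xi> :: "'a \<Rightarrow> complex"
  assume "sep R' C D" "\<xi> \<in> ell2"
  moreover from this(1) have "sep R C D" using assms(3) by (force simp: sep_def)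
  ultimately have "l2norm (restr C (T (restr D \<xi>))) \<le> e * l2norm \<xi>" using assms(1) qlD by blast
  also have "\<dots> \<le> e' * l2norm \<xi>" using assms(2) by (simp add: mult_right_mono)
  finally show "l2norm (restr C (T (restr D \<xi>))) \<le> e' * l2norm \<xi>" .
qed

lemma restr_add: "restr C (\<lambda>x. \<xi> x + \<eta> x) = (\<lambda>x. restr C \<xi> x + restr C \<eta> x)"
  by (auto simp: restr_def)

lemma restr_diff: "restr C (\<lambda>x. \<xi> x - \<eta> x) = (\<lambda>x. restr C \<xi> x - restr C \<eta> x)"
  by (auto simp: restr_def)

lemma restr_scale: "restr C (\<lambda>x. c * \<xi> x) = (\<lambda>x. c * restr C \<xi> x)"
  by (auto simp: restr_def)

lemma ql_plus:
  assumes "bounded_op T" "bounded_op U" "ql e R T" "ql e' R U"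
  shows "ql (e + e') R (op_plus T U)"
proof (rule qlI)
  fix C D :: "'a set" and \<xi> :: "'a \<Rightarrow> complex"
  assume a: "sep R C D" "\<xi> \<in> ell2"
  have "l2norm (restr C (op_plus T U (restr D \<xi>)))
      \<le> l2norm (restr C (T (restr D \<xi>))) + l2norm (restr C (U (restr D \<xi>)))"
    unfolding op_plus_def restr_add by (rule ell2_add) (use assms in auto)
  also have "\<dots> \<le> e * l2norm \<xi> + e' * l2norm \<xi>"
    by (intro add_mono qlD[OF assms(3) a] qlD[OF assms(4) a])
  finally show "l2norm (restr C (op_plus T U (restr D \<xi>))) \<le> (e + e') * l2norm \<xi>"
    by (simp add: algebra_simps)
qed

lemma ql_scale:
  assumes "ql e R T"
  shows "ql (cmod c * e) R (op_scale c T)"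
proof (rule qlI)
  fix C D :: "'a set" and \<xi> :: "'a \<Rightarrow> complex"
  assume a: "sep R C D" "\<xi> \<in> ell2"
  show "l2norm (restr C (op_scale c T (restr D \<xi>))) \<le> cmod c * e * l2norm \<xi>"
    using mult_left_mono[OF qlD[OF assms a], of "cmod c"]
    by (simp add: op_scale_def restr_scale l2norm_scale mult.assoc)
qed

lemma ql_minus:
  assumes "bounded_op T" "bounded_op U" "ql e R T" "ql e' R U"
  shows "ql (e + e') R (op_minus T U)"
  unfolding op_minus_as_plus
  using ql_plus[OF assms(1) bounded_op_scaled[OF assms(2)] assms(3) ql_scale[OF assms(4), of "-1"]] by simp

text \<open>Split the intermediate vector at the \<open>R'\<close>-neighbourhood of
  \<open>D\<close>. The inner part is still \<open>R\<close> away from \<open>C\<close>, so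
  \<open>T\<close> makes it small; the outer part is already small by the quasi-locality of
  \<open>U\<close>.\<close>

lemma ql_comp:
  assumes T: "bounded_op T" and U: "bounded_op U" and "ql e R T" "ql e' R' U" "0 \<le> e"
    and K: "0 \<le> K" "\<And>\<xi>. \<xi> \<in> ell2 \<Longrightarrow> l2norm (T \<xi>) \<le> K * l2norm \<xi>"
    and L: "0 \<le> L" "\<And>\<xi>. \<xi> \<in> ell2 \<Longrightarrow> l2norm (U \<xi>) \<le> L * l2norm \<xi>"
  shows "ql (e * L + K * e') (R + R') (T \<circ> U)"
proof (rule qlI)
  fix C D :: "'a set" and \<xi> :: "'a \<Rightarrow> complex"
  assume s: "sep (R + R') C D" and \<xi>: "\<xi> \<in> ell2"
  let ?N = "nbhd R' D" and ?\<eta> = "U (restr D \<xi>)"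
  have \<eta>: "?\<eta> \<in> ell2" using U by simp
  have "l2norm ?\<eta> \<le> L * l2norm \<xi>"
    using L(2)[OF ell2_restr[OF \<xi>]] mult_left_mono[OF l2norm_restr_le[OF \<xi>] L(1)] order_trans by blast
  then have 1: "l2norm (restr C (T (restr ?N ?\<eta>))) \<le> e * (L * l2norm \<xi>)"
    using qlD[OF assms(3) sep_nbhd[OF s] \<eta>] assms(5) by (meson mult_left_mono order_trans)
  have "l2norm (restr C (T (restr (- ?N) ?\<eta>))) \<le> K * l2norm (restr (- ?N) ?\<eta>)"
    using K(2)[OF ell2_restr[OF \<eta>]] l2norm_restr_le[OF bounded_op_in_ell2[OF T]] order_trans by blast
  then have 2: "l2norm (restr C (T (restr (- ?N) ?\<eta>))) \<le> K * (e' * l2norm \<xi>)"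
    using qlD[OF assms(4) sep_compl_nbhd \<xi>] K(1) by (meson mult_left_mono order_trans)
  have "l2norm (restr C (T ?\<eta>)) \<le> l2norm (restr C (T (restr ?N ?\<eta>))) + l2norm (restr C (T (restr (- ?N) ?\<eta>)))"
    unfolding bounded_op_restr_split[OF T \<eta>, of ?N] restr_add by (rule ell2_add) (use T in auto)
  with 1 2 show "l2norm (restr C ((T \<circ> U) (restr D \<xi>))) \<le> (e * L + K * e') * l2norm \<xi>"
    by (simp add: algebra_simps)
qed

text \<open>Moving \<open>T\<close> across the inner product exchanges the roles of \<open>C\<close>
  and \<open>D\<close>, and separation is symmetric.\<close>

lemma ql_adjoint:
  assumes T: "bounded_op T" and q: "ql e R T" "0 \<le> e"
  shows "ql e R (op_adjoint T)"
proof (rule qlI)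
  fix C D :: "'a set" and \<xi> :: "'a \<Rightarrow> complex"
  assume s: "sep R C D" and \<xi>: "\<xi> \<in> ell2"
  let ?T = "op_adjoint T"
  let ?\<eta> = "restr C (?T (restr D \<xi>))"
  have \<eta>: "?\<eta> \<in> ell2" using bounded_op_adjoint[OF T] by simp
  have "l2inner ?\<eta> ?\<eta> = l2inner (?T (restr D \<xi>)) (restr C ?\<eta>)"
    by (rule l2inner_restr)
  also have "\<dots> = l2inner (restr D \<xi>) (T (restr C ?\<eta>))"
    by (rule l2inner_adjoint'[OF T]) (use \<xi> \<eta> in auto)
  also have "\<dots> = l2inner \<xi> (restr D (T (restr C ?\<eta>)))" by (rule l2inner_restr)
  finally have "cmod (l2inner ?\<eta> ?\<eta>) \<le> l2norm \<xi> * l2norm (restr D (T (restr C ?\<eta>)))"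
    using Cauchy_Schwarz_l2[OF \<xi>, of "restr D (T (restr C ?\<eta>))"] T by simp
  also have "\<dots> \<le> l2norm \<xi> * (e * l2norm ?\<eta>)"
    by (intro mult_left_mono qlD[OF q(1) sep_sym[OF s] \<eta>]) simp
  also have "\<dots> = (e * l2norm \<xi>) * l2norm ?\<eta>" by simp
  finally show "l2norm ?\<eta> \<le> e * l2norm \<xi>"
    by (rule l2norm_le_by_inner[OF \<eta>, rotated]) (use q(2) in simp)
qed

lemma ql_close:
  assumes "bounded_op T" "bounded_op U" "ql e R U"
    and "\<And>\<xi>. \<xi> \<in> ell2 \<Longrightarrow> l2norm (op_minus T U \<xi>) \<le> e' * l2norm \<xi>" "0 \<le> e'"
  shows "ql (e + e') R T"
proof (rule qlI)
  fix C D :: "'a set" and \<xi> :: "'a \<Rightarrow> complex"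
  assume a: "sep R C D" "\<xi> \<in> ell2"
  let ?d = "op_minus T U (restr D \<xi>)"
  have d: "?d \<in> ell2" using bounded_op_minus[OF assms(1,2)] by simp
  have "l2norm (restr C ?d) \<le> l2norm ?d" by (rule l2norm_restr_le[OF d])
  also have "\<dots> \<le> e' * l2norm (restr D \<xi>)" using a by (intro assms) auto
  also have "\<dots> \<le> e' * l2norm \<xi>" by (intro mult_left_mono l2norm_restr_le a assms)
  finally have "l2norm (restr C ?d) \<le> e' * l2norm \<xi>" .
  moreover have "l2norm (restr C (T (restr D \<xi>))) \<le> l2norm (restr C (U (restr D \<xi>))) + l2norm (restr C ?d)"
    unfolding op_minus_def restr_diff by (rule l2norm_triangle_sub) (use assms in auto)
  ultimately show "l2norm (restr C (T (restr D \<xi>))) \<le> (e + e') * l2norm \<xi>"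
    using qlD[OF assms(3) a] by (simp add: algebra_simps)
qed

lemma quasi_local_transl:
  assumes "partial_translation f"
  shows "quasi_local (transl_op f)"
proof -
  have inj: "inj_on (\<lambda>x. the (f x)) (dom f)" using assms by (simp add: partial_translation_def)
  obtain B where B: "\<forall>x\<in>dom f. dist x (the (f x)) \<le> B"
    using assms by (auto simp: partial_translation_def)
  have "ql e B (transl_op f)" if e: "e > 0" for e
  proof (rule qlI)
    fix C D :: "'a set" and \<xi> :: "'a \<Rightarrow> complex"
    assume s: "sep B C D" and \<xi>: "\<xi> \<in> ell2"
    have "restr C (transl_op f (restr D \<xi>)) y = 0" for y
    proof (cases "y \<in> ran f \<and> y \<in> C")
      case True
      then obtain x where x: "f x = Some y" by (auto simp: ran_def)
      then have "x \<notin> D" using s B True by (force simp: sep_def dist_commute)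
      with transl_op_apply[OF inj x ell2_restr[OF \<xi>, of D]] show ?thesis by (simp add: restr_def)
    qed (auto simp: transl_op_outside_ran restr_def)
    then have "restr C (transl_op f (restr D \<xi>)) = (\<lambda>_. 0)" by auto
    with e show "l2norm (restr C (transl_op f (restr D \<xi>))) \<le> e * l2norm \<xi>" by simp
  qed
  then show ?thesis using bounded_op_transl[OF inj] unfolding quasi_local_def by blast
qed

text \<open>With \<open>quasi_local_transl\<close> this places the generated algebra inside the
  quasi-local operators. The converse inclusion is where property A enters.\<close>

lemma cstar_closed_quasi_local: "cstar_closed {T::'a::metric_space op. quasi_local T}"
  unfolding cstar_closed_def
proof (intro conjI ballI allI impI)
  fix T U :: "'a op" assume "T \<in> {T. quasi_local T}" "U \<in> {T. quasi_local T}"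
  then have T: "bounded_op T" "\<And>e. e > 0 \<Longrightarrow> \<exists>R. ql e R T" and U: "bounded_op U" "\<And>e. e > 0 \<Longrightarrow> \<exists>R. ql e R U"
    by (auto simp: quasi_local_def)
  have "\<exists>R. ql e R (op_plus T U)" if "e > 0" for e
  proof -
    have "e/2 > 0" using that by simp
    then obtain R R' where "ql (e/2) R T" "ql (e/2) R' U" using T(2) U(2) by blast
    then have "ql (e/2) (max R R') T" "ql (e/2) (max R R') U" by (auto intro: ql_mono)
    from ql_plus[OF T(1) U(1) this] show ?thesis by auto
  qed
  then show "op_plus T U \<in> {T. quasi_local T}" by (simp add: quasi_local_def bounded_op_plus T U)
  obtain K where K: "K > 0" "\<And>\<xi>. \<xi> \<in> ell2 \<Longrightarrow> l2norm (T \<xi>) \<le> K * l2norm \<xi>"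
    using bounded_op_bound[OF T(1)] by blast
  obtain L where L: "L > 0" "\<And>\<xi>. \<xi> \<in> ell2 \<Longrightarrow> l2norm (U \<xi>) \<le> L * l2norm \<xi>"
    using bounded_op_bound[OF U(1)] by blast
  have "\<exists>R. ql e R (T \<circ> U)" if e: "e > 0" for e
  proof -
    have "e/2/L > 0" "e/2/K > 0" using e K(1) L(1) by auto
    then obtain R R' where "ql (e/2/L) R T" "ql (e/2/K) R' U"
      using T(2) U(2) by blast
    from ql_comp[OF T(1) U(1) this _ less_imp_le[OF K(1)] K(2) less_imp_le[OF L(1)] L(2)]
    have "ql (e/2/L * L + K * (e/2/K)) (R + R') (T \<circ> U)" using e L(1) by simp
    then show ?thesis using K(1) L(1) by auto
  qed
  then show "T \<circ> U \<in> {T. quasi_local T}" by (simp add: quasi_local_def bounded_op_comp T U)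
next
  fix c and T :: "'a op" assume "T \<in> {T. quasi_local T}"
  then have T: "bounded_op T" "\<And>e. e > 0 \<Longrightarrow> \<exists>R. ql e R T" by (auto simp: quasi_local_def)
  have "\<exists>R. ql e R (op_scale c T)" if e: "e > 0" for e
  proof -
    have c: "cmod c + 1 > 0" by (simp add: add_nonneg_pos)
    then have "e/(cmod c + 1) > 0" using e by auto
    then obtain R where "ql (e/(cmod c + 1)) R T" using T(2) by blast
    from ql_scale[OF this] have "ql (cmod c * (e/(cmod c + 1))) R (op_scale c T)" .
    moreover have "cmod c * (e/(cmod c + 1)) \<le> e" using c e by (simp add: field_simps)
    ultimately show ?thesis using ql_mono by blast
  qed
  then show "op_scale c T \<in> {T. quasi_local T}" by (simp add: quasi_local_def bounded_op_scaled T)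
next
  fix T :: "'a op" assume "T \<in> {T. quasi_local T}"
  then show "op_adjoint T \<in> {T. quasi_local T}"
    unfolding quasi_local_def mem_Collect_eq by (meson bounded_op_adjoint ql_adjoint less_imp_le)
next
  fix T :: "'a op" and A
  assume a: "bounded_op T \<and> (\<forall>n. A n \<in> {T. quasi_local T}) \<and> (\<lambda>n. opnorm (op_minus (A n) T)) \<longlonglongrightarrow> 0"
  then have T: "bounded_op T" and A: "\<And>n. bounded_op (A n)" "\<And>e n. e > 0 \<Longrightarrow> \<exists>R. ql e R (A n)"
    by (auto simp: quasi_local_def)
  have "\<exists>R. ql e R T" if e: "e > 0" for e
  proof -
    have "\<forall>\<^sub>F n in sequentially. opnorm (op_minus (A n) T) < e/2"
      by (rule order_tendstoD(2)) (use a e in auto)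
    then obtain n where n: "opnorm (op_minus (A n) T) < e/2"
      by (auto dest: eventually_happens)
    obtain R where R: "ql (e/2) R (A n)" using A(2)[of "e/2"] e by auto
    have "l2norm (op_minus T (A n) \<xi>) \<le> e/2 * l2norm \<xi>" if \<xi>: "\<xi> \<in> ell2" for \<xi>
    proof -
      have "l2norm (op_minus T (A n) \<xi>) = l2norm (op_minus (A n) T \<xi>)"
        unfolding op_minus_def by (rule l2norm_minus_commute)
      also have "\<dots> \<le> opnorm (op_minus (A n) T) * l2norm \<xi>"
        by (intro opnorm_bound bounded_op_minus A T \<xi>)
      also have "\<dots> \<le> e/2 * l2norm \<xi>" using n by (intro mult_right_mono) auto
      finally show ?thesis .
    qed
    from ql_close[OF T A(1) R this] e show ?thesis by auto
  qed
  then show "T \<in> {T. quasi_local T}" using T by (simp add: quasi_local_def)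
qed (auto simp: quasi_local_def)

section \<open>The uniform Roe algebra as a C*-algebra of quasi-local operators\<close>

lemma roe_alg_quasi_local: "(T :: 'a::metric_space op) \<in> uniform_roe_alg \<Longrightarrow> quasi_local T"
proof -
  assume T: "T \<in> uniform_roe_alg"
  have "{transl_op f | f. partial_translation f} \<subseteq> {T::'a op. quasi_local T}"
    using quasi_local_transl by blast
  with cstar_closed_quasi_local T have "T \<in> {T. quasi_local T}"
    unfolding uniform_roe_alg_def by blast
  then show ?thesis by simp
qed

lemma roe_alg_bounded: "T \<in> uniform_roe_alg \<Longrightarrow> bounded_op T"
  using roe_alg_quasi_local by (auto simp: quasi_local_def)

text \<open>Nonemptiness is what makes members of the intersection bounded: an empty intersection
  would be the set of all functions.\<close>

lemma cstar_closed_Inter: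
  assumes "F \<noteq> {}" "\<And>S. S \<in> F \<Longrightarrow> cstar_closed S"
  shows "cstar_closed (\<Inter> F)"
proof -
  obtain S0 where S0: "S0 \<in> F" using assms(1) by blast
  note D = assms(2)[unfolded cstar_closed_def]
  show ?thesis
    unfolding cstar_closed_def
  proof (intro conjI ballI allI impI InterI subsetI)
    fix T assume "T \<in> \<Inter> F"
    then have "T \<in> S0" using S0 by (rule InterD)
    then show "T \<in> {T. bounded_op T}" using D[OF S0] by (meson subsetD)
  next
    fix T U S assume "T \<in> \<Inter> F" "U \<in> \<Inter> F" "S \<in> F"
    then show "op_plus T U \<in> S" "T \<circ> U \<in> S" using D[OF \<open>S \<in> F\<close>] by (meson InterD)+
  next
    fix T c S assume "T \<in> \<Inter> F" "S \<in> F"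
    then show "op_scale c T \<in> S" using D[OF \<open>S \<in> F\<close>] by (meson InterD)
  next
    fix T S assume "T \<in> \<Inter> F" "S \<in> F"
    then show "op_adjoint T \<in> S" using D[OF \<open>S \<in> F\<close>] by (meson InterD)
  next
    fix T A S
    assume "bounded_op T \<and> (\<forall>n. A n \<in> \<Inter> F) \<and> (\<lambda>n. opnorm (op_minus (A n) T)) \<longlonglongrightarrow> 0" "S \<in> F"
    then show "T \<in> S" using D[OF \<open>S \<in> F\<close>] by (meson InterD)
  qed
qed

text \<open>The quasi-local operators witness that the family being intersected is nonempty.\<close>

lemma cstar_closed_uniform_roe_alg: "cstar_closed (uniform_roe_alg :: 'a::metric_space op set)"
  unfolding uniform_roe_alg_def
proof (rule cstar_closed_Inter)
  have "{transl_op f | f. partial_translation f} \<subseteq> {T::'a op. quasi_local T}"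
    using quasi_local_transl by blast
  with cstar_closed_quasi_local
  show "{S :: 'a op set. cstar_closed S \<and> {transl_op f | f. partial_translation f} \<subseteq> S} \<noteq> {}"
    by blast
qed simp

lemma roe_alg_transl: "partial_translation f \<Longrightarrow> transl_op f \<in> uniform_roe_alg"
  unfolding uniform_roe_alg_def by auto

lemma roe_alg_chi: "chi D \<in> uniform_roe_alg"
  unfolding chi_def by (rule roe_alg_transl[OF partial_translation_chi])

lemma roe_alg_plus: "T \<in> uniform_roe_alg \<Longrightarrow> U \<in> uniform_roe_alg \<Longrightarrow> op_plus T U \<in> uniform_roe_alg"
  and roe_alg_comp: "T \<in> uniform_roe_alg \<Longrightarrow> U \<in> uniform_roe_alg \<Longrightarrow> T \<circ> U \<in> uniform_roe_alg"
  and roe_alg_scale: "T \<in> uniform_roe_alg \<Longrightarrow> op_scale c T \<in> uniform_roe_alg"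
  and roe_alg_adjoint: "T \<in> uniform_roe_alg \<Longrightarrow> op_adjoint T \<in> uniform_roe_alg"
  using cstar_closed_uniform_roe_alg[unfolded cstar_closed_def] by meson+

lemma roe_alg_minus: "T \<in> uniform_roe_alg \<Longrightarrow> U \<in> uniform_roe_alg \<Longrightarrow> op_minus T U \<in> uniform_roe_alg"
  unfolding op_minus_as_plus by (intro roe_alg_plus roe_alg_scale)

lemma roe_alg_limit:
  fixes T :: "'a::metric_space op"
  assumes T: "bounded_op T"
    and "\<And>e. e > 0 \<Longrightarrow> \<exists>U\<in>uniform_roe_alg. \<forall>\<xi>\<in>ell2. l2norm (op_minus U T \<xi>) \<le> e * l2norm \<xi>"
  shows "T \<in> uniform_roe_alg"
proof -
  have "\<exists>U. \<forall>n. U n \<in> uniform_roe_alg \<and> (\<forall>\<xi>\<in>ell2. l2norm (op_minus (U n) T \<xi>) \<le> inverse (real (Suc n)) * l2norm \<xi>)"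
  proof (rule choice, rule allI)
    fix n
    have "inverse (real (Suc n)) > 0" by simp
    from assms(2)[OF this] show "\<exists>U. U \<in> uniform_roe_alg \<and>
        (\<forall>\<xi>\<in>ell2. l2norm (op_minus U T \<xi>) \<le> inverse (real (Suc n)) * l2norm \<xi>)" by blast
  qed
  then obtain U where "\<forall>n. U n \<in> uniform_roe_alg \<and> (\<forall>\<xi>\<in>ell2. l2norm (op_minus (U n) T \<xi>) \<le> inverse (real (Suc n)) * l2norm \<xi>)" ..
  then have U: "U n \<in> uniform_roe_alg"
    "\<xi> \<in> ell2 \<Longrightarrow> l2norm (op_minus (U n) T \<xi>) \<le> inverse (real (Suc n)) * l2norm \<xi>" for n \<xi>
    by simp_all
  have "(\<lambda>n. opnorm (op_minus (U n) T)) \<longlonglongrightarrow> 0"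
  proof (rule tendsto_sandwich[OF _ _ tendsto_const LIMSEQ_inverse_real_of_nat])
    show "\<forall>\<^sub>F n in sequentially. 0 \<le> opnorm (op_minus (U n) T)"
      by (simp add: opnorm_nonneg bounded_op_minus T roe_alg_bounded[OF U(1)])
    show "\<forall>\<^sub>F n in sequentially. opnorm (op_minus (U n) T) \<le> inverse (real (Suc n))"
      by (intro always_eventually allI, rule opnorm_le[OF _ U(2)]) auto
  qed
  moreover have "\<forall>T A. bounded_op T \<and> (\<forall>n. A n \<in> uniform_roe_alg) \<and>
      (\<lambda>n. opnorm (op_minus (A n) T)) \<longlonglongrightarrow> 0 \<longrightarrow> T \<in> (uniform_roe_alg :: 'a op set)"
    using cstar_closed_uniform_roe_alg unfolding cstar_closed_def by (elim conjE)
  ultimately show ?thesis using T U(1) by (elim allE[of _ T] allE[of _ U]) simp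
qed

section \<open>Uniformity over subsets by a Baire argument\<close>

text \<open>The Baire category theorem for the product topology on subsets of \<open>'a\<close>,
  whose basic open sets are the cylinders \<open>B \<inter> S = B0\<close> with \<open>S\<close>
  finite. If no cylinder lies in any \<open>F n\<close>, growing finite conditions define a set that
  escapes every \<open>F n\<close>.\<close>

lemma Baire_power_set:
  fixes F :: "nat \<Rightarrow> 'a set \<Rightarrow> bool"
  assumes cover: "\<And>B. \<exists>n. F n B"
    and closed: "\<And>n B. (\<And>S. finite S \<Longrightarrow> \<exists>B'. B' \<inter> S = B \<inter> S \<and> F n B') \<Longrightarrow> F n B"
  shows "\<exists>n S B0. finite S \<and> B0 \<subseteq> S \<and> (\<forall>B. B \<inter> S = B0 \<longrightarrow> F n B)"
proof (rule ccontr)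
  assume "\<not> ?thesis"
  then have neg: "\<exists>B. B \<inter> S = B0 \<and> \<not> F n B" if "finite S" "B0 \<subseteq> S" for n S B0
    using that by blast
  define P :: "nat \<Rightarrow> 'a set \<times> 'a set \<Rightarrow> bool" where "P = (\<lambda>_ (S, B). finite S \<and> B \<subseteq> S)"
  \<comment> \<open>A pair is a finite condition: a window and the trace on it. Step
    \<open>n\<close> refines the condition so that every set obeying it lies outside
    \<open>F n\<close>.\<close>
  define Q :: "nat \<Rightarrow> 'a set \<times> 'a set \<Rightarrow> 'a set \<times> 'a set \<Rightarrow> bool" where
    "Q = (\<lambda>n (S, B) (S', B'). S \<subseteq> S' \<and> B' \<inter> S = B \<and> (\<forall>C. C \<inter> S' = B' \<longrightarrow> \<not> F n C))"
  have "\<exists>f. \<forall>n. P n (f n) \<and> Q n (f n) (f (Suc n))"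
  proof (rule dependent_nat_choice)
    show "\<exists>x. P 0 x" by (rule exI[of _ "({}, {})"]) (simp add: P_def)
  next
    fix x n assume "P n x"
    obtain S B0 where x: "x = (S, B0)" by (cases x)
    with \<open>P n x\<close> have S: "finite S" "B0 \<subseteq> S" by (auto simp: P_def)
    obtain B where B: "B \<inter> S = B0" "\<not> F n B" using neg[OF S] by blast
    \<comment> \<open>Closedness in contrapositive form: failure of \<open>F n\<close> at
      \<open>B\<close> is already forced by the trace of \<open>B\<close> on a finite
      window.\<close>
    have "\<exists>S'. finite S' \<and> (\<forall>B'. B' \<inter> S' = B \<inter> S' \<longrightarrow> \<not> F n B')"
    proof (rule ccontr)
      assume "\<not> ?thesis"
      then have "\<exists>B'. B' \<inter> S' = B \<inter> S' \<and> F n B'" if "finite S'" for S' using that by blast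
      from closed[OF this] B(2) show False by blast
    qed
    then obtain S' where S': "finite S'" "\<And>B'. B' \<inter> S' = B \<inter> S' \<Longrightarrow> \<not> F n B'" by blast
    have "Q n x (S \<union> S', B \<inter> (S \<union> S'))"
      unfolding x Q_def using B(1) S'(2) by auto
    moreover have "P (Suc n) (S \<union> S', B \<inter> (S \<union> S'))"
      using S S' by (auto simp: P_def)
    ultimately show "\<exists>y. P (Suc n) y \<and> Q n x y" by blast
  qed
  then obtain f where f: "\<And>n. P n (f n)" "\<And>n. Q n (f n) (f (Suc n))" by blast
  define S where "S = (\<lambda>n. fst (f n))"
  define B where "B = (\<lambda>n. snd (f n))"
  have sub: "B n \<subseteq> S n" for n using f(1)[of n] by (auto simp: P_def S_def B_def split: prod.splits)
  have step: "S n \<subseteq> S (Suc n)" "B (Suc n) \<inter> S n = B n"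
    "C \<inter> S (Suc n) = B (Suc n) \<Longrightarrow> \<not> F n C" for n C
    using f(2)[of n] by (auto simp: Q_def S_def B_def split: prod.splits)
  have mono: "S n \<subseteq> S m \<and> B m \<inter> S n = B n" if "n \<le> m" for n m
    using that
  proof (induction m rule: dec_induct)
    case base
    then show ?case using sub by blast
  next
    case (step m)
    then show ?case using \<open>\<And>n. S n \<subseteq> S (Suc n)\<close>[of m] \<open>\<And>n. B (Suc n) \<inter> S n = B n\<close>[of m] by blast
  qed
  \<comment> \<open>The union of the traces obeys all the conditions at once and so lies in no
    \<open>F n\<close>.\<close>
  have "(\<Union>m. B m) \<inter> S n = B n" for n
  proof -
    have "B m \<inter> S n \<subseteq> B n" for m
    proof (cases "n \<le> m")
      case True
      then show ?thesis using mono by blast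
    next
      case False
      then have "B n \<inter> S m = B m" using mono[of m n] by simp
      then show ?thesis by blast
    qed
    then show ?thesis using sub[of n] by blast
  qed
  then have "\<not> F n (\<Union>m. B m)" for n using step(3) by blast
  then show False using cover by blast
qed

text \<open>Uniform continuity from the product topology on the power set to the strong operator
  topology, tested on basis vectors only.\<close>

definition set_cont :: "('a set \<Rightarrow> 'a op) \<Rightarrow> bool" where
  "set_cont \<Phi> \<longleftrightarrow> (\<forall>y. \<forall>e>0. \<exists>S. finite S \<and> (\<forall>B B'. B \<inter> S = B' \<inter> S \<longrightarrow>
     l2norm (\<lambda>x. \<Phi> B (delta y) x - \<Phi> B' (delta y) x) \<le> e))"

lemma set_contD:
  assumes "set_cont \<Phi>" "e > 0"
  obtains S where "finite S"
    "\<And>B B'. B \<inter> S = B' \<inter> S \<Longrightarrow> l2norm (\<lambda>x. \<Phi> B (delta y) x - \<Phi> B' (delta y) x) \<le> e"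
  using assms unfolding set_cont_def by meson

text \<open>Lower semicontinuity of the norm under strong limits, which provides the closed sets for
  the category argument. A finitely supported vector involves finitely many basis vectors, hence one
  finite window on which \<open>B\<close> can be replaced by \<open>B'\<close>.\<close>

lemma set_cont_closed_bound:
  assumes c: "set_cont \<Phi>" and bo: "\<And>B. bounded_op (\<Phi> B)" and K: "0 \<le> K"
    and cl: "\<And>S. finite S \<Longrightarrow> \<exists>B'. B' \<inter> S = B \<inter> S \<and> (\<forall>\<xi>\<in>ell2. l2norm (\<Phi> B' \<xi>) \<le> K * l2norm \<xi>)"
    and \<xi>: "\<xi> \<in> ell2"
  shows "l2norm (\<Phi> B \<xi>) \<le> K * l2norm \<xi>"
proof (rule norm_bound_from_finite[OF bo K _ \<xi>])
  fix F :: "'a set" and \<xi> :: "'a \<Rightarrow> complex" assume F: "finite F"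
  show "l2norm (\<Phi> B (restr F \<xi>)) \<le> K * l2norm (restr F \<xi>)"
  proof (rule field_le_epsilon)
    fix e :: real assume e: "0 < e"
    \<comment> \<open>Basis vector errors enter weighted by the coefficients of
      \<open>\<xi>\<close>; \<open>k\<close> exceeds their total and is positive even if all
      vanish.\<close>
    define k where "k = (\<Sum>y\<in>F. cmod (\<xi> y)) + 1"
    have k: "k > 0" by (simp add: k_def add_nonneg_pos sum_nonneg)
    with e have ek: "e / k > 0" by simp
    have "\<forall>y. \<exists>S. finite S \<and> (\<forall>B B'. B \<inter> S = B' \<inter> S \<longrightarrow>
       l2norm (\<lambda>x. \<Phi> B (delta y) x - \<Phi> B' (delta y) x) \<le> e / k)"
      using c[unfolded set_cont_def] ek by simp
    from choice[OF this] obtain S where "\<forall>y. finite (S y) \<and> (\<forall>B B'. B \<inter> S y = B' \<inter> S y \<longrightarrow>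
       l2norm (\<lambda>x. \<Phi> B (delta y) x - \<Phi> B' (delta y) x) \<le> e / k)" ..
    then have S: "finite (S y)" "B \<inter> S y = B' \<inter> S y \<Longrightarrow>
       l2norm (\<lambda>x. \<Phi> B (delta y) x - \<Phi> B' (delta y) x) \<le> e / k" for y B B' by simp_all
    have "finite (\<Union>y\<in>F. S y)" using F S(1) by simp
    from cl[OF this] obtain B' where "B' \<inter> (\<Union>y\<in>F. S y) = B \<inter> (\<Union>y\<in>F. S y) \<and>
      (\<forall>\<xi>\<in>ell2. l2norm (\<Phi> B' \<xi>) \<le> K * l2norm \<xi>)" ..
    then have B': "B' \<inter> (\<Union>y\<in>F. S y) = B \<inter> (\<Union>y\<in>F. S y)"
      and b: "\<xi> \<in> ell2 \<Longrightarrow> l2norm (\<Phi> B' \<xi>) \<le> K * l2norm \<xi>" for \<xi> by simp_all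
    have d: "l2norm (\<lambda>x. \<Phi> B (delta y) x - \<Phi> B' (delta y) x) \<le> e / k" if "y \<in> F" for y
      by (rule S(2)) (use B' that in blast)
    let ?r = "restr F \<xi>"
    have r: "?r \<in> ell2" by (rule ell2_restr_finite[OF F])
    have "(\<lambda>x. \<Phi> B ?r x - \<Phi> B' ?r x) = (\<lambda>x. \<Sum>y\<in>F. \<xi> y * (\<Phi> B (delta y) x - \<Phi> B' (delta y) x))"
      by (simp add: bounded_op_restr_finite[OF bo F] sum_subtractf right_diff_distrib)
    then have "l2norm (\<lambda>x. \<Phi> B ?r x - \<Phi> B' ?r x)
        \<le> (\<Sum>y\<in>F. l2norm (\<lambda>x. \<xi> y * (\<Phi> B (delta y) x - \<Phi> B' (delta y) x)))"
      using bo by (simp only:) (intro ell2_sum(2) F ell2_scale ell2_diff(1) bounded_op_in_ell2)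
    also have "\<dots> = (\<Sum>y\<in>F. cmod (\<xi> y) * l2norm (\<lambda>x. \<Phi> B (delta y) x - \<Phi> B' (delta y) x))"
      by (simp only: l2norm_scale)
    also have "\<dots> \<le> (\<Sum>y\<in>F. cmod (\<xi> y) * (e / k))"
      by (intro sum_mono mult_left_mono d) auto
    also have "\<dots> = (\<Sum>y\<in>F. cmod (\<xi> y)) * (e / k)" by (rule sum_distrib_right[symmetric])
    also have "\<dots> \<le> k * (e / k)" by (intro mult_right_mono) (use ek in \<open>auto simp: k_def\<close>)
    also have "\<dots> = e" using k by simp
    finally have "l2norm (\<lambda>x. \<Phi> B ?r x - \<Phi> B' ?r x) \<le> e" .
    moreover have "l2norm (\<Phi> B ?r) \<le> l2norm (\<Phi> B' ?r) + l2norm (\<lambda>x. \<Phi> B ?r x - \<Phi> B' ?r x)"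
      by (rule l2norm_triangle_sub) (use bo in auto)
    ultimately show "l2norm (\<Phi> B ?r) \<le> K * l2norm ?r + e" using b[OF r] by linarith
  qed
qed

text \<open>Exchanges "for each \<open>B\<close> some \<open>n\<close>" with "some \<open>n\<close>
  for all \<open>B\<close>". It serves twice: with pairs of sets separated at scale
  \<open>n\<close>, and with the times within \<open>inverse (real (Suc n))\<close> of a given
  time.\<close>

lemma uniform_bound_on_sets:
  fixes \<Phi> :: "'i \<Rightarrow> 'a set \<Rightarrow> 'a op" and I :: "nat \<Rightarrow> 'i set"
  assumes bo: "\<And>i B. bounded_op (\<Phi> i B)" and c: "\<And>i. set_cont (\<Phi> i)"
    and add: "\<And>i B B'. B \<inter> B' = {} \<Longrightarrow> \<Phi> i (B \<union> B') = op_plus (\<Phi> i B) (\<Phi> i B')"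
    and I: "\<And>m n. m \<le> n \<Longrightarrow> I n \<subseteq> I m"
    and pw: "\<And>e B. e > 0 \<Longrightarrow> \<exists>n. \<forall>i\<in>I n. \<forall>\<xi>\<in>ell2. l2norm (\<Phi> i B \<xi>) \<le> e * l2norm \<xi>"
    and e: "e > 0"
  shows "\<exists>n. \<forall>B. \<forall>i\<in>I n. \<forall>\<xi>\<in>ell2. l2norm (\<Phi> i B \<xi>) \<le> e * l2norm \<xi>"
proof -
  define F where "F = (\<lambda>n B. \<forall>i\<in>I n. \<forall>\<xi>\<in>ell2. l2norm (\<Phi> i B \<xi>) \<le> e/3 * l2norm \<xi>)"
  have e3: "e / 3 > 0" using e by simp
  have mono: "F m B \<Longrightarrow> m \<le> n \<Longrightarrow> F n B" for m n B using I unfolding F_def by blast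
  have cover: "\<exists>n. F n B" for B unfolding F_def by (rule pw[OF e3])
  have closed: "F n B" if h: "\<And>S. finite S \<Longrightarrow> \<exists>B'. B' \<inter> S = B \<inter> S \<and> F n B'" for n B
    unfolding F_def
  proof (intro ballI)
    fix i and \<xi> :: "'a \<Rightarrow> complex" assume i: "i \<in> I n" and \<xi>: "\<xi> \<in> ell2"
    show "l2norm (\<Phi> i B \<xi>) \<le> e / 3 * l2norm \<xi>"
    proof (rule set_cont_closed_bound[OF c bo _ _ \<xi>])
      fix S :: "'a set" assume "finite S"
      from h[OF this] show "\<exists>B'. B' \<inter> S = B \<inter> S \<and> (\<forall>\<xi>\<in>ell2. l2norm (\<Phi> i B' \<xi>) \<le> e / 3 * l2norm \<xi>)"
        using i unfolding F_def by blast
    qed (use e in simp)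
  qed
  obtain n0 S B0 where S: "finite S" "B0 \<subseteq> S" "\<And>B. B \<inter> S = B0 \<Longrightarrow> F n0 B"
    using Baire_power_set[of F, OF cover closed] by blast
  have "\<forall>C. \<exists>n. F n C" using cover ..
  from choice[OF this] obtain g where g: "\<And>C. F (g C) C" by blast
  \<comment> \<open>\<open>S\<close> has finitely many subsets, so one index covers all of them
    together with the cylinder.\<close>
  define n where "n = Max (insert n0 (g ` Pow S))"
  have fin: "finite (insert n0 (g ` Pow S))" using S(1) by simp
  have n0: "n0 \<le> n" unfolding n_def by (rule Max_ge[OF fin]) simp
  have gC: "F n C" if "C \<subseteq> S" for C
    by (rule mono[OF g]) (use that fin in \<open>auto simp: n_def intro!: Max_ge\<close>)
  have "l2norm (\<Phi> i B \<xi>) \<le> e * l2norm \<xi>" if i: "i \<in> I n" and \<xi>: "\<xi> \<in> ell2" for B i \<xi>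
  proof -
    have 1: "l2norm (\<Phi> i (B \<inter> S) \<xi>) \<le> e / 3 * l2norm \<xi>"
      using gC[of "B \<inter> S"] i \<xi> unfolding F_def by blast
    have 2: "l2norm (\<Phi> i B0 \<xi>) \<le> e / 3 * l2norm \<xi>"
      using gC[OF S(2)] i \<xi> unfolding F_def by blast
    have "F n ((B - S) \<union> B0)" by (rule mono[OF S(3) n0]) (use S(2) in blast)
    then have 3: "l2norm (\<Phi> i ((B - S) \<union> B0) \<xi>) \<le> e / 3 * l2norm \<xi>"
      using i \<xi> unfolding F_def by blast
    \<comment> \<open>Outside \<open>S\<close>, \<open>B\<close> is completed to the member
      \<open>(B - S) \<union> B0\<close> of the cylinder; the correction terms
      \<open>B \<inter> S\<close> and \<open>B0\<close> are subsets of \<open>S\<close>. The three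
      terms account for \<open>e/3\<close>.\<close>
    have "\<Phi> i ((B \<inter> S) \<union> (B - S)) = op_plus (\<Phi> i (B \<inter> S)) (\<Phi> i (B - S))"
      by (rule add) blast
    moreover have "(B \<inter> S) \<union> (B - S) = B" by blast
    moreover have "\<Phi> i ((B - S) \<union> B0) = op_plus (\<Phi> i (B - S)) (\<Phi> i B0)"
      by (rule add) (use S(2) in blast)
    ultimately have eq: "\<Phi> i B \<xi> = (\<lambda>x. (\<Phi> i (B \<inter> S) \<xi> x + \<Phi> i ((B - S) \<union> B0) \<xi> x) - \<Phi> i B0 \<xi> x)"
      by (simp add: op_plus_def fun_eq_iff)
    have "l2norm (\<lambda>x. (\<Phi> i (B \<inter> S) \<xi> x + \<Phi> i ((B - S) \<union> B0) \<xi> x) - \<Phi> i B0 \<xi> x)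
       \<le> l2norm (\<lambda>x. \<Phi> i (B \<inter> S) \<xi> x + \<Phi> i ((B - S) \<union> B0) \<xi> x) + l2norm (\<Phi> i B0 \<xi>)"
      by (intro ell2_diff(2) ell2_add(1) bounded_op_in_ell2 bo)
    moreover have "l2norm (\<lambda>x. \<Phi> i (B \<inter> S) \<xi> x + \<Phi> i ((B - S) \<union> B0) \<xi> x)
       \<le> l2norm (\<Phi> i (B \<inter> S) \<xi>) + l2norm (\<Phi> i ((B - S) \<union> B0) \<xi>)"
      by (intro ell2_add(2) bounded_op_in_ell2 bo)
    ultimately have "l2norm (\<Phi> i B \<xi>) \<le> 3 * (e / 3 * l2norm \<xi>)"
      unfolding eq using 1 2 3 by linarith
    then show ?thesis by simp
  qed
  then show ?thesis by blast
qed

section \<open>Automorphisms and diagonal projections\<close>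

lemma op_minus_comp_left: "op_minus T U \<circ> V = op_minus (T \<circ> V) (U \<circ> V)"
  by (auto simp: op_minus_def)

lemma chi_Un: "B \<inter> B' = {} \<Longrightarrow> chi (B \<union> B') = op_plus (chi B) (chi B')"
  by (rule bounded_op_eqI) (auto simp: bounded_op_plus chi_apply, auto simp: op_plus_def chi_apply restr_def fun_eq_iff)

lemma chi_idem: "chi B \<circ> chi B = chi B"
  by (rule bounded_op_eqI) (auto simp: bounded_op_comp chi_apply)

text \<open>The squared norm of \<open>p \<xi>\<close> equals the inner product of
  \<open>\<xi>\<close> with \<open>p \<xi>\<close>; Cauchy-Schwarz cancels one factor.\<close>

lemma projection_contractive:
  assumes p: "bounded_op p" "op_adjoint p = p" "p \<circ> p = p" and \<xi>: "\<xi> \<in> ell2"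
  shows "l2norm (p \<xi>) \<le> l2norm \<xi>"
proof (rule l2norm_le_by_inner)
  have "l2inner (p \<xi>) (p \<xi>) = l2inner \<xi> (op_adjoint p (p \<xi>))"
    by (rule l2inner_adjoint) (use p \<xi> in auto)
  also have "\<dots> = l2inner \<xi> (p \<xi>)" using p(2,3) by (metis comp_apply)
  finally show "cmod (l2inner (p \<xi>) (p \<xi>)) \<le> l2norm \<xi> * l2norm (p \<xi>)"
    using Cauchy_Schwarz_l2[OF \<xi> bounded_op_in_ell2[OF p(1)]] by simp
qed (use p in auto)

context
  fixes \<tau> :: "'a::metric_space op \<Rightarrow> 'a op"
  assumes aut: "is_cstar_aut uniform_roe_alg \<tau>"
begin

lemma aut_in: "a \<in> uniform_roe_alg \<Longrightarrow> \<tau> a \<in> uniform_roe_alg"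
  using aut unfolding is_cstar_aut_def by (auto dest: bij_betw_apply)

lemma aut_surj: "b \<in> uniform_roe_alg \<Longrightarrow> \<exists>a\<in>uniform_roe_alg. \<tau> a = b"
  using aut unfolding is_cstar_aut_def bij_betw_def by (metis imageE)

lemma aut_inj: "a \<in> uniform_roe_alg \<Longrightarrow> b \<in> uniform_roe_alg \<Longrightarrow> \<tau> a = \<tau> b \<Longrightarrow> a = b"
  using aut unfolding is_cstar_aut_def bij_betw_def by (meson inj_onD)

lemma aut_plus: "a \<in> uniform_roe_alg \<Longrightarrow> b \<in> uniform_roe_alg \<Longrightarrow> \<tau> (op_plus a b) = op_plus (\<tau> a) (\<tau> b)"
  and aut_comp: "a \<in> uniform_roe_alg \<Longrightarrow> b \<in> uniform_roe_alg \<Longrightarrow> \<tau> (a \<circ> b) = \<tau> a \<circ> \<tau> b"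
  and aut_scale: "a \<in> uniform_roe_alg \<Longrightarrow> \<tau> (op_scale c a) = op_scale c (\<tau> a)"
  and aut_adjoint: "a \<in> uniform_roe_alg \<Longrightarrow> \<tau> (op_adjoint a) = op_adjoint (\<tau> a)"
  using aut unfolding is_cstar_aut_def by simp_all

lemma aut_minus: "a \<in> uniform_roe_alg \<Longrightarrow> b \<in> uniform_roe_alg \<Longrightarrow> \<tau> (op_minus a b) = op_minus (\<tau> a) (\<tau> b)"
  unfolding op_minus_as_plus by (simp add: aut_plus aut_scale roe_alg_scale)

lemma bounded_aut_chi: "bounded_op (\<tau> (chi B))"
  by (intro roe_alg_bounded aut_in roe_alg_chi)

lemma aut_chi_adjoint: "op_adjoint (\<tau> (chi B)) = \<tau> (chi B)"
  by (metis aut_adjoint op_adjoint_chi roe_alg_chi)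

lemma aut_chi_idem: "\<tau> (chi B) \<circ> \<tau> (chi B) = \<tau> (chi B)"
  by (metis aut_comp chi_idem roe_alg_chi)

lemma aut_chi_contractive: "\<xi> \<in> ell2 \<Longrightarrow> l2norm (\<tau> (chi B) \<xi>) \<le> l2norm \<xi>"
  by (rule projection_contractive[OF bounded_aut_chi aut_chi_adjoint aut_chi_idem])

lemma aut_chi_Un: "B \<inter> B' = {} \<Longrightarrow> \<tau> (chi (B \<union> B')) = op_plus (\<tau> (chi B)) (\<tau> (chi B'))"
  by (simp add: chi_Un aut_plus roe_alg_chi)

lemma chi_singleton_apply: "\<xi> \<in> ell2 \<Longrightarrow> chi {y} \<xi> = (\<lambda>x. \<xi> y * delta y x)"
  by (auto simp: chi_apply restr_def delta_def)

text \<open>Continuity of \<open>B \<mapsto> \<tau> (chi B) (delta y)\<close> on the power set is obtained without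
  implementing \<open>\<tau>\<close> spatially: \<open>delta y\<close> is written as \<open>\<tau> (a \<circ> chi {y}) \<zeta>\<close>, and on
  operators \<open>d\<close> with \<open>d = d \<circ> chi {y}\<close> the product \<open>op_adjoint d \<circ> d\<close> is a multiple of \<open>chi {y}\<close>.\<close>

lemma aut_rank_one_norm:
  assumes d: "d \<in> uniform_roe_alg" "d \<circ> chi {y} = d" and \<zeta>: "\<zeta> \<in> ell2"
  shows "l2norm (\<tau> d \<zeta>) \<le> l2norm (d (delta y)) * l2norm \<zeta>"
proof -
  have db: "bounded_op d" and tb: "bounded_op (\<tau> d)" using d(1) aut_in roe_alg_bounded by blast+
  let ?c = "complex_of_real ((l2norm (d (delta y)))\<^sup>2)"
  \<comment> \<open>\<open>d\<close> sees only the coordinate at \<open>y\<close>, so it is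
    determined by the single column \<open>d (delta y)\<close>.\<close>
  have dx: "d \<xi> = (\<lambda>x. \<xi> y * d (delta y) x)" if "\<xi> \<in> ell2" for \<xi>
  proof -
    have "d \<xi> = d (chi {y} \<xi>)" using d(2) by (metis comp_apply)
    then show ?thesis by (simp add: chi_singleton_apply[OF that] bounded_op_scale[OF db])
  qed
  have "op_adjoint d \<circ> d = op_scale ?c (chi {y})"
  proof (rule bounded_op_eqI)
    fix \<xi> :: "'a \<Rightarrow> complex" assume \<xi>: "\<xi> \<in> ell2"
    have "op_adjoint d (d \<xi>) x = ?c * chi {y} \<xi> x" for x
    proof -
      have "op_adjoint d (d \<xi>) x = l2inner (delta x) (op_adjoint d (d \<xi>))" by simp
      also have "\<dots> = l2inner (d (delta x)) (d \<xi>)"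
        by (rule l2inner_adjoint[symmetric]) (use db in auto)
      also have "\<dots> = l2inner (\<lambda>z. delta x y * d (delta y) z) (\<lambda>z. \<xi> y * d (delta y) z)"
        by (rule arg_cong2[OF dx[OF ell2_delta] dx[OF \<xi>]])
      also have "\<dots> = cnj (delta x y) * (\<xi> y * ?c)"
        using l2inner_self[OF bounded_op_in_ell2[OF db, of "delta y"]]
        by (simp only: l2inner_scale_left l2inner_scale_right)
      finally show ?thesis by (simp add: chi_singleton_apply[OF \<xi>] delta_def)
    qed
    then show "(op_adjoint d \<circ> d) \<xi> = op_scale ?c (chi {y}) \<xi>" by (auto simp: op_scale_def)
  qed (auto simp: bounded_op_comp bounded_op_adjoint db bounded_op_scaled)
  \<comment> \<open>The identity is algebraic and survives \<open>\<tau>\<close>; the projection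
    \<open>\<tau> (chi {y})\<close> on its right is a contraction.\<close>
  then have t: "op_adjoint (\<tau> d) \<circ> \<tau> d = op_scale ?c (\<tau> (chi {y}))"
    using d(1) by (metis aut_adjoint aut_comp aut_scale roe_alg_adjoint roe_alg_chi)
  have "l2inner (\<tau> d \<zeta>) (\<tau> d \<zeta>) = l2inner \<zeta> (op_adjoint (\<tau> d) (\<tau> d \<zeta>))"
    by (rule l2inner_adjoint[OF tb \<zeta>]) (use tb in auto)
  also have "op_adjoint (\<tau> d) (\<tau> d \<zeta>) = (\<lambda>x. ?c * \<tau> (chi {y}) \<zeta> x)"
    using fun_cong[OF t, of \<zeta>] by (simp add: op_scale_def)
  also have "l2inner \<zeta> (\<lambda>x. ?c * \<tau> (chi {y}) \<zeta> x) = ?c * l2inner \<zeta> (\<tau> (chi {y}) \<zeta>)"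
    by (rule l2inner_scale_right)
  finally have "(l2norm (\<tau> d \<zeta>))\<^sup>2 = cmod (?c * l2inner \<zeta> (\<tau> (chi {y}) \<zeta>))"
    using l2inner_self[OF bounded_op_in_ell2[OF tb, of \<zeta>]] by (metis abs_of_nonneg norm_of_real zero_le_power2)
  also have "\<dots> \<le> (l2norm (d (delta y)))\<^sup>2 * (l2norm \<zeta> * l2norm \<zeta>)"
    unfolding norm_mult norm_of_real
    using Cauchy_Schwarz_l2[OF \<zeta> bounded_op_in_ell2[OF bounded_aut_chi, of "{y}" \<zeta>]]
      mult_left_mono[OF aut_chi_contractive[OF \<zeta>, of "{y}"] l2norm_nonneg[of \<zeta>]]
    by (intro mult_mono) auto
  also have "\<dots> = (l2norm (d (delta y)) * l2norm \<zeta>)\<^sup>2" by (simp add: power2_eq_square)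
  finally show ?thesis by (rule power2_le_imp_le) simp
qed

lemma set_cont_aut_chi: "set_cont (\<lambda>B. \<tau> (chi B))"
  unfolding set_cont_def
proof (intro allI impI)
  fix y :: 'a and e :: real assume e: "e > 0"
  let ?p = "chi {y} :: 'a op"
  \<comment> \<open>Injectivity of \<open>\<tau>\<close> makes the image of \<open>chi {y}\<close>
    nonzero, which supplies a vector \<open>\<zeta>\<close> whose image has a nonzero coordinate
    \<open>z\<close>.\<close>
  have "\<tau> ?p \<noteq> \<tau> (chi {})"
  proof
    assume "\<tau> ?p = \<tau> (chi {})"
    then have "?p = chi {}" by (rule aut_inj[OF roe_alg_chi roe_alg_chi])
    then have "?p (delta y) y = chi {} (delta y) y" by simp
    then show False unfolding chi_apply[OF ell2_delta] by (simp add: restr_def delta_def)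
  qed
  moreover have "\<tau> (chi {}) = (\<lambda>\<xi> x. 0)"
  proof -
    have "chi {} = op_scale 0 ?p" by (rule bounded_op_eqI) (auto simp: bounded_op_scaled, auto simp: op_scale_def chi_apply restr_def)
    then have "\<tau> (chi {}) = op_scale 0 (\<tau> ?p)" using aut_scale[OF roe_alg_chi] by simp
    then show ?thesis by (simp add: op_scale_def)
  qed
  ultimately obtain \<zeta> z where z: "\<tau> ?p \<zeta> z \<noteq> 0" by (auto simp: fun_eq_iff)
  then have \<zeta>: "\<zeta> \<in> ell2" using bounded_op_outside[OF bounded_aut_chi] by fastforce
  \<comment> \<open>A rescaled matrix unit carries that coordinate to \<open>delta y\<close>. It
    lies in the algebra, and surjectivity of \<open>\<tau>\<close> pulls it back to
    \<open>a\<close>.\<close>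
  let ?f = "\<lambda>x. if x = z then Some y else None"
  have f: "partial_translation ?f"
    by (auto simp: partial_translation_def inj_on_def dom_def)
  then have finj: "inj_on (\<lambda>x. the (?f x)) (dom ?f)" by (simp add: partial_translation_def)
  define b where "b = op_scale (1 / \<tau> ?p \<zeta> z) (transl_op ?f)"
  have "b \<in> uniform_roe_alg" unfolding b_def by (intro roe_alg_scale roe_alg_transl f)
  then obtain a where a: "a \<in> uniform_roe_alg" "\<tau> a = b" using aut_surj by blast
  have tp: "\<tau> ?p \<zeta> \<in> ell2" using bounded_aut_chi by simp
  have "b (\<tau> ?p \<zeta>) x = delta y x" for x
  proof (cases "x = y")
    case True
    have "transl_op ?f (\<tau> ?p \<zeta>) y = \<tau> ?p \<zeta> z" by (rule transl_op_apply[OF finj _ tp]) simp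
    then show ?thesis using z True by (simp add: b_def op_scale_def delta_def)
  next
    case False
    then have "transl_op ?f (\<tau> ?p \<zeta>) x = 0" by (intro transl_op_outside_ran) (auto simp: ran_def)
    then show ?thesis using False by (simp add: b_def op_scale_def delta_def)
  qed
  then have dy: "\<tau> a (\<tau> ?p \<zeta>) = delta y" using a(2) by auto
  have ab: "bounded_op a" using a(1) roe_alg_bounded by blast
  have ay: "a (delta y) \<in> ell2" using ab by simp
  define k where "k = l2norm \<zeta> + 1"
  have k: "k > 0" by (simp add: k_def add_nonneg_pos)
  obtain S where S: "finite S" "l2norm (restr (- S) (a (delta y))) \<le> e / k"
    using ell2_tail[OF ay, of "e / k"] e k by auto
  have "l2norm (\<lambda>x. \<tau> (chi B) (delta y) x - \<tau> (chi B') (delta y) x) \<le> e" if BB: "B \<inter> S = B' \<inter> S" for B B'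
  proof -
    define d where "d = op_minus (chi B \<circ> a \<circ> ?p) (chi B' \<circ> a \<circ> ?p)"
    have in1: "chi C \<circ> a \<in> uniform_roe_alg" "chi C \<circ> a \<circ> ?p \<in> uniform_roe_alg" for C
      by (intro roe_alg_comp roe_alg_chi a(1))+
    have d: "d \<in> uniform_roe_alg" unfolding d_def by (intro roe_alg_minus in1)
    have dp: "d \<circ> ?p = d" unfolding d_def op_minus_comp_left comp_assoc chi_idem ..
    have tc: "\<tau> (chi C \<circ> a \<circ> ?p) \<zeta> = \<tau> (chi C) (delta y)" for C
      using dy by (simp add: aut_comp in1 roe_alg_chi a(1))
    have "\<tau> d \<zeta> = (\<lambda>x. \<tau> (chi B) (delta y) x - \<tau> (chi B') (delta y) x)"
      unfolding d_def by (simp only: aut_minus in1) (simp add: op_minus_def tc)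
    then have 1: "l2norm (\<lambda>x. \<tau> (chi B) (delta y) x - \<tau> (chi B') (delta y) x) \<le> l2norm (d (delta y)) * l2norm \<zeta>"
      using aut_rank_one_norm[OF d dp \<zeta>] by simp
    have "?p (delta y) = delta y"
      unfolding chi_apply[OF ell2_delta] by (auto simp: restr_def delta_def)
    then have "d (delta y) = (\<lambda>x. restr B (a (delta y)) x - restr B' (a (delta y)) x)"
      by (simp add: d_def op_minus_def chi_apply ay)
    \<comment> \<open>\<open>B\<close> and \<open>B'\<close> can differ only off \<open>S\<close>,
      where the column \<open>a (delta y)\<close> has a small tail.\<close>
    moreover have "cmod (restr B (a (delta y)) x - restr B' (a (delta y)) x) \<le> cmod (restr (- S) (a (delta y)) x)" for x
      using BB by (auto simp: restr_def)
    ultimately have "l2norm (d (delta y)) \<le> l2norm (restr (- S) (a (delta y)))"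
      using ell2_mono(2)[OF ell2_restr[OF ay, of "- S"], of "d (delta y)"] by simp
    with S(2) have "l2norm (d (delta y)) \<le> e / k" by linarith
    then have "l2norm (d (delta y)) * l2norm \<zeta> \<le> (e / k) * k"
      using e k by (intro mult_mono) (auto simp: k_def)
    with 1 k show ?thesis by simp
  qed
  with S(1) show "\<exists>S. finite S \<and> (\<forall>B B'. B \<inter> S = B' \<inter> S \<longrightarrow>
      l2norm (\<lambda>x. \<tau> (chi B) (delta y) x - \<tau> (chi B') (delta y) x) \<le> e)" by auto
qed

text \<open>For a single \<open>B\<close> this is the quasi-locality of elements of the algebra.
  Indexing by pairs \<open>(C, D)\<close>, with \<open>I n\<close> the pairs separated at
  \<open>n\<close>, turns it into a pointwise smallness statement to which
  \<open>uniform_bound_on_sets\<close> applies.\<close>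

lemma aut_chi_uniformly_quasi_local:
  assumes e: "e > 0"
  shows "\<exists>R. \<forall>B. ql e R (\<tau> (chi B))"
proof -
  define I where "I = (\<lambda>n::nat. {(C, D). sep (real n) C (D::'a set)})"
  define \<Phi> where "\<Phi> = (\<lambda>(C, D) B. chi C \<circ> \<tau> (chi B) \<circ> chi (D::'a set))"
  have \<Phi>: "\<Phi> i B \<xi> = restr (fst i) (\<tau> (chi B) (restr (snd i) \<xi>))" if "\<xi> \<in> ell2" for i B \<xi>
    using that bounded_aut_chi by (simp add: \<Phi>_def chi_apply split: prod.splits)
  have bo: "bounded_op (\<Phi> i B)" for i B
    by (auto simp: \<Phi>_def intro!: bounded_op_comp bounded_aut_chi split: prod.splits)
  have "\<exists>n. \<forall>B. \<forall>i\<in>I n. \<forall>\<xi>\<in>ell2. l2norm (\<Phi> i B \<xi>) \<le> e * l2norm \<xi>"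
  proof (rule uniform_bound_on_sets[OF bo])
    fix i
    show "set_cont (\<Phi> i)"
      unfolding set_cont_def
    proof (intro allI impI)
      fix y :: 'a and e :: real assume e: "e > 0"
      obtain S where S: "finite S" "\<And>B B'. B \<inter> S = B' \<inter> S \<Longrightarrow>
          l2norm (\<lambda>x. \<tau> (chi B) (delta y) x - \<tau> (chi B') (delta y) x) \<le> e"
        using set_contD[OF set_cont_aut_chi e, of y] by metis
      have "l2norm (\<lambda>x. \<Phi> i B (delta y) x - \<Phi> i B' (delta y) x) \<le> e" if BB: "B \<inter> S = B' \<inter> S" for B B'
      proof (cases "y \<in> snd i")
        case True
        then have "restr (snd i) (delta y) = delta y" by (auto simp: restr_def delta_def)
        then have eq: "(\<lambda>x. \<Phi> i B (delta y) x - \<Phi> i B' (delta y) x)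
          = restr (fst i) (\<lambda>x. \<tau> (chi B) (delta y) x - \<tau> (chi B') (delta y) x)"
          by (simp add: \<Phi> restr_diff)
        have "l2norm (\<lambda>x. \<Phi> i B (delta y) x - \<Phi> i B' (delta y) x) \<le> l2norm (\<lambda>x. \<tau> (chi B) (delta y) x - \<tau> (chi B') (delta y) x)"
          unfolding eq by (intro l2norm_restr_le ell2_diff bounded_op_in_ell2 bounded_aut_chi)
        also have "\<dots> \<le> e" by (rule S(2)[OF BB])
        finally show ?thesis .
      next
        case False
        then have "restr (snd i) (delta y) = (\<lambda>_. 0)" by (auto simp: restr_def delta_def)
        then have "\<Phi> i B (delta y) = \<Phi> i B' (delta y)"
          by (simp add: \<Phi> bounded_op_zero[OF bounded_aut_chi])
        then show ?thesis using e by simp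
      qed
      with S(1) show "\<exists>S. finite S \<and> (\<forall>B B'. B \<inter> S = B' \<inter> S \<longrightarrow>
        l2norm (\<lambda>x. \<Phi> i B (delta y) x - \<Phi> i B' (delta y) x) \<le> e)" by auto
    qed
  next
    fix i and B B' :: "'a set" assume "B \<inter> B' = {}"
    then show "\<Phi> i (B \<union> B') = op_plus (\<Phi> i B) (\<Phi> i B')"
      by (intro bounded_op_eqI bo bounded_op_plus)
        (simp add: op_plus_def[of "\<Phi> i B"] \<Phi> aut_chi_Un op_plus_def restr_add)
  next
    fix m n :: nat assume "m \<le> n"
    then show "I n \<subseteq> I m" by (force simp: I_def sep_def)
  next
    fix e :: real and B :: "'a set" assume "e > 0"
    moreover have "quasi_local (\<tau> (chi B))" by (intro roe_alg_quasi_local aut_in roe_alg_chi)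
    ultimately obtain R where R: "ql e R (\<tau> (chi B))" by (auto simp: quasi_local_def)
    obtain n :: nat where "R \<le> real n" using real_arch_simple by blast
    then have "ql e (real n) (\<tau> (chi B))" by (intro ql_mono[OF R]) auto
    then show "\<exists>n. \<forall>i\<in>I n. \<forall>\<xi>\<in>ell2. l2norm (\<Phi> i B \<xi>) \<le> e * l2norm \<xi>"
      by (intro exI[of _ n]) (auto simp: I_def \<Phi> intro: qlD)
  qed (rule e)
  then obtain n where n: "\<forall>B. \<forall>i\<in>I n. \<forall>\<xi>\<in>ell2. l2norm (\<Phi> i B \<xi>) \<le> e * l2norm \<xi>" ..
  have "ql e (real n) (\<tau> (chi B))" for B
  proof (rule qlI)
    fix C D :: "'a set" and \<xi> :: "'a \<Rightarrow> complex" assume "sep (real n) C D" "\<xi> \<in> ell2"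
    then show "l2norm (restr C (\<tau> (chi B) (restr D \<xi>))) \<le> e * l2norm \<xi>"
      using n[rule_format, of "(C, D)" \<xi> B] by (simp add: I_def \<Phi>)
  qed
  then show ?thesis by blast
qed

end

section \<open>Paths of automorphisms\<close>

definition loc_aut :: "('a::metric_space op \<Rightarrow> 'a op) \<Rightarrow> bool" where
  "loc_aut \<tau> \<longleftrightarrow> (\<forall>e>0. \<exists>R. \<forall>B. \<forall>\<xi>\<in>ell2.
     l2norm (restr (- nbhd R B) (\<tau> (chi B) \<xi>)) \<le> e * l2norm \<xi>)"

text \<open>With \<open>p = \<tau> (chi B)\<close>, \<open>q = \<tau>' (chi B)\<close> and \<open>c\<close> the projection off a neighbourhood of \<open>B\<close>,
  the identity \<open>c q = c q p + c q (q - p)\<close> and \<open>opnorm (q - p) \<le> 1/2\<close> bound the norm of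
  \<open>c q\<close> by twice that of \<open>c q p\<close>, which is small by uniform quasi-locality of \<open>q\<close>.\<close>

lemma loc_aut_near:
  fixes \<tau> \<tau>' :: "'a::metric_space op \<Rightarrow> 'a op"
  assumes aut: "is_cstar_aut uniform_roe_alg \<tau>" "is_cstar_aut uniform_roe_alg \<tau>'"
    and near: "\<And>B \<xi>. \<xi> \<in> ell2 \<Longrightarrow> l2norm (op_minus (\<tau>' (chi B)) (\<tau> (chi B)) \<xi>) \<le> 1/2 * l2norm \<xi>"
    and l: "loc_aut \<tau>"
  shows "loc_aut \<tau>'"
  unfolding loc_aut_def
proof (intro allI impI)
  fix e :: real assume e: "e > 0"
  \<comment> \<open>The product with \<open>p\<close> costs \<open>2 * d\<close>, and absorbing half
    of the norm doubles this to \<open>4 * d\<close>.\<close>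
  define d where "d = e / 4"
  have d: "d > 0" using e by (simp add: d_def)
  obtain R where "\<forall>B. \<forall>\<xi>\<in>ell2. l2norm (restr (- nbhd R B) (\<tau> (chi B) \<xi>)) \<le> d * l2norm \<xi>"
    using l[unfolded loc_aut_def, rule_format, OF d] ..
  then have R: "\<xi> \<in> ell2 \<Longrightarrow> l2norm (restr (- nbhd R B) (\<tau> (chi B) \<xi>)) \<le> d * l2norm \<xi>" for B \<xi> by simp
  obtain R' where "\<forall>B. ql d R' (\<tau>' (chi B))"
    using aut_chi_uniformly_quasi_local[OF aut(2) d] ..
  then have R': "ql d R' (\<tau>' (chi B))" for B by simp
  have "l2norm (restr (- nbhd (R' + R) B) (\<tau>' (chi B) \<xi>)) \<le> e * l2norm \<xi>" if \<xi>: "\<xi> \<in> ell2" for B \<xi>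
  proof -
    define q where "q = \<tau>' (chi B)"
    define p where "p = \<tau> (chi B)"
    define N where "N = nbhd R B"
    define C where "C = - nbhd (R' + R) B"
    define T where "T = chi C \<circ> q"
    have q: "bounded_op q" and p: "bounded_op p"
      unfolding p_def q_def by (rule bounded_aut_chi[OF aut(1)] bounded_aut_chi[OF aut(2)])+
    have T: "bounded_op T" unfolding T_def by (intro bounded_op_comp bounded_op_chi q)
    have Tx: "T \<xi> = restr C (q \<xi>)" for \<xi> using q by (simp add: T_def chi_apply)
    \<comment> \<open>The scales add: \<open>C\<close> avoids the
      \<open>(R' + R)\<close>-neighbourhood of \<open>B\<close>, hence stays \<open>R'\<close> away
      from its \<open>R\<close>-neighbourhood.\<close>
    have sCN: "sep R' C N" unfolding C_def N_def by (intro sep_nbhd sep_compl_nbhd)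
    have qp: "l2norm (T (p \<xi>)) \<le> 2 * d * l2norm \<xi>" if \<xi>: "\<xi> \<in> ell2" for \<xi>
    proof -
      have pl: "p \<xi> \<in> ell2" "l2norm (p \<xi>) \<le> l2norm \<xi>"
        using p aut_chi_contractive[OF aut(1) \<xi>] by (auto simp: p_def)
      have "l2norm (restr C (q (restr N (p \<xi>)))) \<le> d * l2norm (p \<xi>)"
        using R' sCN pl(1) unfolding q_def by (rule qlD)
      also have "\<dots> \<le> d * l2norm \<xi>" using pl(2) d by simp
      finally have 1: "l2norm (T (restr N (p \<xi>))) \<le> d * l2norm \<xi>" by (simp add: Tx)
      have "l2norm (T (restr (- N) (p \<xi>))) \<le> l2norm (q (restr (- N) (p \<xi>)))"
        unfolding Tx by (rule l2norm_restr_le) (use q in simp)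
      also have "\<dots> \<le> l2norm (restr (- N) (p \<xi>))"
        unfolding q_def by (rule aut_chi_contractive[OF aut(2)]) (use pl in simp)
      also have "\<dots> \<le> d * l2norm \<xi>" unfolding N_def p_def by (rule R[OF \<xi>])
      finally have 2: "l2norm (T (restr (- N) (p \<xi>))) \<le> d * l2norm \<xi>" .
      have "l2norm (T (p \<xi>)) \<le> l2norm (T (restr N (p \<xi>))) + l2norm (T (restr (- N) (p \<xi>)))"
        unfolding bounded_op_restr_split[OF T pl(1), of N] by (rule ell2_add) (use T in auto)
      with 1 2 show ?thesis by simp
    qed
    \<comment> \<open>A self-improving inequality: the norm of \<open>T\<close> is finite, so its
      half on the right can be moved to the left.\<close>
    have "opnorm T \<le> 2 * d + opnorm T * (1/2)"
    proof (rule opnorm_le)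
      show "0 \<le> 2 * d + opnorm T * (1/2)" using d opnorm_nonneg[OF T] by simp
      fix \<xi> :: "'a \<Rightarrow> complex" assume \<xi>: "\<xi> \<in> ell2"
      have "q (q \<xi>) = q \<xi>" using aut_chi_idem[OF aut(2), of B] unfolding q_def by (metis comp_apply)
      then have "T \<xi> = T (q \<xi>)" by (simp add: Tx)
      also have "q \<xi> = (\<lambda>x. p \<xi> x + op_minus q p \<xi> x)" by (simp add: op_minus_def)
      also have "T \<dots> = (\<lambda>x. T (p \<xi>) x + T (op_minus q p \<xi>) x)"
        by (rule bounded_op_add[OF T]) (use p bounded_op_minus[OF q p] in auto)
      finally have "l2norm (T \<xi>) \<le> l2norm (T (p \<xi>)) + l2norm (T (op_minus q p \<xi>))"
        using ell2_add(2)[OF bounded_op_in_ell2[OF T] bounded_op_in_ell2[OF T]] by simp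
      moreover have "l2norm (T (op_minus q p \<xi>)) \<le> opnorm T * (1/2 * l2norm \<xi>)"
        using opnorm_bound[OF T bounded_op_in_ell2[OF bounded_op_minus[OF q p]]]
          mult_left_mono[OF near[OF \<xi>, of B] opnorm_nonneg[OF T]]
        unfolding p_def q_def by (rule order_trans)
      ultimately show "l2norm (T \<xi>) \<le> (2 * d + opnorm T * (1/2)) * l2norm \<xi>"
        using qp[OF \<xi>] by (simp add: algebra_simps)
    qed
    then have "opnorm T \<le> e" by (simp add: d_def)
    then have "opnorm T * l2norm \<xi> \<le> e * l2norm \<xi>" by (simp add: mult_right_mono)
    with opnorm_bound[OF T \<xi>] show ?thesis unfolding Tx C_def q_def by linarith
  qed
  then show "\<exists>R. \<forall>B. \<forall>\<xi>\<in>ell2. l2norm (restr (- nbhd R B) (\<tau>' (chi B) \<xi>)) \<le> e * l2norm \<xi>" by auto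
qed

lemma set_cont_op_minus:
  assumes "set_cont \<Phi>" "set_cont \<Psi>" "\<And>B. bounded_op (\<Phi> B)" "\<And>B. bounded_op (\<Psi> B)"
  shows "set_cont (\<lambda>B. op_minus (\<Phi> B) (\<Psi> B))"
  unfolding set_cont_def
proof (intro allI impI)
  fix y :: 'a and e :: real assume "e > 0"
  then have e: "e/2 > 0" by simp
  obtain S where S: "finite S" "\<And>B B'. B \<inter> S = B' \<inter> S \<Longrightarrow> l2norm (\<lambda>x. \<Phi> B (delta y) x - \<Phi> B' (delta y) x) \<le> e/2"
    using set_contD[OF assms(1) e, of y] by metis
  obtain S' where S': "finite S'" "\<And>B B'. B \<inter> S' = B' \<inter> S' \<Longrightarrow> l2norm (\<lambda>x. \<Psi> B (delta y) x - \<Psi> B' (delta y) x) \<le> e/2"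
    using set_contD[OF assms(2) e, of y] by metis
  have "l2norm (\<lambda>x. op_minus (\<Phi> B) (\<Psi> B) (delta y) x - op_minus (\<Phi> B') (\<Psi> B') (delta y) x) \<le> e"
    if "B \<inter> (S \<union> S') = B' \<inter> (S \<union> S')" for B B'
  proof -
    have 1: "l2norm (\<lambda>x. \<Phi> B (delta y) x - \<Phi> B' (delta y) x) \<le> e/2" by (rule S(2)) (use that in blast)
    have 2: "l2norm (\<lambda>x. \<Psi> B (delta y) x - \<Psi> B' (delta y) x) \<le> e/2" by (rule S'(2)) (use that in blast)
    have "(\<lambda>x. op_minus (\<Phi> B) (\<Psi> B) (delta y) x - op_minus (\<Phi> B') (\<Psi> B') (delta y) x)
      = (\<lambda>x. (\<Phi> B (delta y) x - \<Phi> B' (delta y) x) - (\<Psi> B (delta y) x - \<Psi> B' (delta y) x))"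
      by (simp add: op_minus_def algebra_simps)
    moreover have "l2norm (\<lambda>x. (\<Phi> B (delta y) x - \<Phi> B' (delta y) x) - (\<Psi> B (delta y) x - \<Psi> B' (delta y) x))
      \<le> l2norm (\<lambda>x. \<Phi> B (delta y) x - \<Phi> B' (delta y) x) + l2norm (\<lambda>x. \<Psi> B (delta y) x - \<Psi> B' (delta y) x)"
      by (intro ell2_diff bounded_op_in_ell2 assms)
    ultimately show ?thesis using 1 2 by simp
  qed
  with S(1) S'(1) show "\<exists>S. finite S \<and> (\<forall>B B'. B \<inter> S = B' \<inter> S \<longrightarrow>
     l2norm (\<lambda>x. op_minus (\<Phi> B) (\<Psi> B) (delta y) x - op_minus (\<Phi> B') (\<Psi> B') (delta y) x) \<le> e)"
    by (intro exI[of _ "S \<union> S'"]) auto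
qed

text \<open>The indices are times, and \<open>I n\<close> is a shrinking neighbourhood of
  \<open>t0\<close>; continuity at the single operator \<open>chi B\<close> is the pointwise
  hypothesis of \<open>uniform_bound_on_sets\<close>.\<close>

lemma path_uniformly_continuous_on_projections:
  fixes \<sigma>t :: "real \<Rightarrow> 'a::metric_space op \<Rightarrow> 'a op"
  assumes aut: "\<And>t. t \<in> {0..1} \<Longrightarrow> is_cstar_aut uniform_roe_alg (\<sigma>t t)"
    and cont: "\<And>a t0 \<epsilon>. a \<in> uniform_roe_alg \<Longrightarrow> t0 \<in> {0..1} \<Longrightarrow> \<epsilon> > 0 \<Longrightarrow> \<exists>\<delta>>0. \<forall>t\<in>{0..1}.
            \<bar>t - t0\<bar> < \<delta> \<longrightarrow> opnorm (op_minus (\<sigma>t t a) (\<sigma>t t0 a)) < \<epsilon>"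
    and t0: "t0 \<in> {0..1}" and e: "e > 0"
  shows "\<exists>\<delta>>0. \<forall>t\<in>{0..1}. \<bar>t - t0\<bar> < \<delta> \<longrightarrow>
    (\<forall>B. \<forall>\<xi>\<in>ell2. l2norm (op_minus (\<sigma>t t (chi B)) (\<sigma>t t0 (chi B)) \<xi>) \<le> e * l2norm \<xi>)"
proof -
  define I where "I = (\<lambda>n. {t\<in>{0..1}. \<bar>t - t0\<bar> < inverse (real (Suc n))})"
  \<comment> \<open>Every index must give a strongly continuous additive family, also times outside
    the unit interval; these are sent to \<open>t0\<close>, where the difference is zero.\<close>
  define c where "c = (\<lambda>t. if t \<in> {0..1} then t else t0)"
  have c: "c t \<in> {0..1}" for t using t0 by (simp add: c_def)
  define \<Phi> where "\<Phi> = (\<lambda>t B. op_minus (\<sigma>t (c t) (chi B)) (\<sigma>t t0 (chi B)))"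
  note b = bounded_aut_chi[OF aut[OF c]] bounded_aut_chi[OF aut[OF t0]]
  have bo: "bounded_op (\<Phi> t B)" for t B
    unfolding \<Phi>_def by (intro bounded_op_minus b)
  have "\<exists>n. \<forall>B. \<forall>t\<in>I n. \<forall>\<xi>\<in>ell2. l2norm (\<Phi> t B \<xi>) \<le> e * l2norm \<xi>"
  proof (rule uniform_bound_on_sets[OF bo])
    fix t
    show "set_cont (\<Phi> t)" unfolding \<Phi>_def
      by (rule set_cont_op_minus) (rule set_cont_aut_chi[OF aut[OF c]] set_cont_aut_chi[OF aut[OF t0]] b)+
  next
    fix t and B B' :: "'a set" assume "B \<inter> B' = {}"
    then show "\<Phi> t (B \<union> B') = op_plus (\<Phi> t B) (\<Phi> t B')"
      unfolding \<Phi>_def by (simp add: aut_chi_Un[OF aut[OF c]] aut_chi_Un[OF aut[OF t0]])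
        (simp add: op_minus_def op_plus_def algebra_simps)
  next
    fix m n :: nat assume "m \<le> n"
    then have "inverse (real (Suc n)) \<le> inverse (real (Suc m))" by (intro le_imp_inverse_le) auto
    then show "I n \<subseteq> I m" unfolding I_def by (fast intro: less_le_trans)
  next
    fix e :: real and B :: "'a set" assume e: "e > 0"
    obtain \<delta> where \<delta>: "\<delta> > 0" "\<And>t. t \<in> {0..1} \<Longrightarrow> \<bar>t - t0\<bar> < \<delta> \<Longrightarrow>
        opnorm (op_minus (\<sigma>t t (chi B)) (\<sigma>t t0 (chi B))) < e"
      using cont[OF roe_alg_chi t0 e, of B] by auto
    obtain n where n: "inverse (real (Suc n)) < \<delta>" using reals_Archimedean[OF \<delta>(1)] ..
    have "l2norm (\<Phi> t B \<xi>) \<le> e * l2norm \<xi>" if t: "t \<in> I n" and \<xi>: "\<xi> \<in> ell2" for t \<xi>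
    proof -
      have "c t = t" "\<bar>t - t0\<bar> < \<delta>" "t \<in> {0..1}" using t n by (auto simp: I_def c_def)
      then have "opnorm (\<Phi> t B) \<le> e" using \<delta>(2)[of t] unfolding \<Phi>_def by simp
      then have "opnorm (\<Phi> t B) * l2norm \<xi> \<le> e * l2norm \<xi>" by (simp add: mult_right_mono)
      with opnorm_bound[OF bo \<xi>, of t B] show ?thesis by linarith
    qed
    then show "\<exists>n. \<forall>t\<in>I n. \<forall>\<xi>\<in>ell2. l2norm (\<Phi> t B \<xi>) \<le> e * l2norm \<xi>" by auto
  qed (rule e)
  then obtain n where n: "\<forall>B. \<forall>t\<in>I n. \<forall>\<xi>\<in>ell2. l2norm (\<Phi> t B \<xi>) \<le> e * l2norm \<xi>" ..
  show ?thesis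
  proof (intro exI[of _ "inverse (real (Suc n))"] conjI ballI impI allI)
    fix t B and \<xi> :: "'a \<Rightarrow> complex"
    assume t: "t \<in> {0..1}" "\<bar>t - t0\<bar> < inverse (real (Suc n))" "\<xi> \<in> ell2"
    then have "t \<in> I n" "c t = t" by (auto simp: I_def c_def)
    with n t(3) show "l2norm (op_minus (\<sigma>t t (chi B)) (\<sigma>t t0 (chi B)) \<xi>) \<le> e * l2norm \<xi>"
      unfolding \<Phi>_def by fastforce
  qed simp
qed

lemma loc_aut_identity_component:
  fixes \<sigma> :: "'a::metric_space op \<Rightarrow> 'a op"
  assumes "in_identity_component uniform_roe_alg \<sigma>"
  shows "loc_aut \<sigma>"
proof -
  from assms obtain \<sigma>t :: "real \<Rightarrow> 'a op \<Rightarrow> 'a op" where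
    st: "(\<forall>t\<in>{0..1}. is_cstar_aut uniform_roe_alg (\<sigma>t t)) \<and>
        (\<forall>a\<in>uniform_roe_alg. \<forall>t0\<in>{0..1}. \<forall>\<epsilon>>0. \<exists>\<delta>>0. \<forall>t\<in>{0..1}.
            \<bar>t - t0\<bar> < \<delta> \<longrightarrow> opnorm (op_minus (\<sigma>t t a) (\<sigma>t t0 a)) < \<epsilon>) \<and>
        (\<forall>a\<in>uniform_roe_alg. \<sigma>t 0 a = a) \<and>
        (\<forall>a\<in>uniform_roe_alg. \<sigma>t 1 a = \<sigma> a)"
    unfolding in_identity_component_def ..
  have aut: "\<And>t. t \<in> {0..1} \<Longrightarrow> is_cstar_aut uniform_roe_alg (\<sigma>t t)"
    and cont: "\<And>a t0 \<epsilon>. a \<in> uniform_roe_alg \<Longrightarrow> t0 \<in> {0..1} \<Longrightarrow> \<epsilon> > 0 \<Longrightarrow> \<exists>\<delta>>0. \<forall>t\<in>{0..1}.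
            \<bar>t - t0\<bar> < \<delta> \<longrightarrow> opnorm (op_minus (\<sigma>t t a) (\<sigma>t t0 a)) < \<epsilon>"
    and s0: "\<And>a. a \<in> uniform_roe_alg \<Longrightarrow> \<sigma>t 0 a = a"
    and s1: "\<And>a. a \<in> uniform_roe_alg \<Longrightarrow> \<sigma>t 1 a = \<sigma> a"
    using st by simp_all
  \<comment> \<open>The path starts at the identity, which moves nothing: radius 0 serves for every
    precision.\<close>
  have "loc_aut (\<sigma>t 0)"
    unfolding loc_aut_def s0[OF roe_alg_chi]
  proof (intro allI impI exI[of _ 0] ballI)
    fix e :: real and B :: "'a set" and \<xi> :: "'a \<Rightarrow> complex" assume "e > 0" "\<xi> \<in> ell2"
    moreover have "- nbhd 0 B \<inter> B = {}" by (auto simp: nbhd_def)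
    ultimately show "l2norm (restr (- nbhd 0 B) (chi B \<xi>)) \<le> e * l2norm \<xi>"
      by (simp add: chi_apply) (simp add: restr_def)
  qed
  \<comment> \<open>Closeness is symmetric in the two times, so locality passes both ways and is
    locally constant along the path.\<close>
  moreover have "loc_aut (\<sigma>t t) = loc_aut (\<sigma>t t0)"
    if t: "t \<in> {0..1}" and t0: "t0 \<in> {0..1}"
      and n: "\<And>B \<xi>. \<xi> \<in> ell2 \<Longrightarrow> l2norm (op_minus (\<sigma>t t (chi B)) (\<sigma>t t0 (chi B)) \<xi>) \<le> 1/2 * l2norm \<xi>" for t t0
  proof
    have n': "l2norm (op_minus (\<sigma>t t0 (chi B)) (\<sigma>t t (chi B)) \<xi>) \<le> 1/2 * l2norm \<xi>" if "\<xi> \<in> ell2" for B \<xi>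
      using n[OF that, of B] unfolding op_minus_def by (subst l2norm_minus_commute)
    show "loc_aut (\<sigma>t t0)" if "loc_aut (\<sigma>t t)"
      by (rule loc_aut_near[OF aut[OF t] aut[OF t0] n' that])
    show "loc_aut (\<sigma>t t)" if "loc_aut (\<sigma>t t0)"
      by (rule loc_aut_near[OF aut[OF t0] aut[OF t] n that])
  qed
  note near = this
  have "loc_aut (\<sigma>t 1)"
  proof (rule connected_induction_simple[of "{0..1::real}" 0 1 "\<lambda>t. loc_aut (\<sigma>t t)"])
    fix t0 :: real assume t0: "t0 \<in> {0..1}"
    obtain \<delta> where \<delta>: "\<delta> > 0" "\<forall>t\<in>{0..1}. \<bar>t - t0\<bar> < \<delta> \<longrightarrow>
       (\<forall>B. \<forall>\<xi>\<in>ell2. l2norm (op_minus (\<sigma>t t (chi B)) (\<sigma>t t0 (chi B)) \<xi>) \<le> 1/2 * l2norm \<xi>)"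
      using path_uniformly_continuous_on_projections[OF aut cont t0, of "1/2"] by auto
    let ?T = "{0..1} \<inter> ball t0 \<delta>"
    have eq: "loc_aut (\<sigma>t t) = loc_aut (\<sigma>t t0)" if "t \<in> ?T" for t
      by (rule near) (use \<delta>(2) t0 that in \<open>auto simp: dist_real_def abs_minus_commute\<close>)
    have "openin (top_of_set {0..1}) ?T" by (simp add: openin_open_Int)
    moreover have "t0 \<in> ?T" using t0 \<delta>(1) by simp
    ultimately show "\<exists>T. openin (top_of_set {0..1}) T \<and> t0 \<in> T \<and>
        (\<forall>x\<in>T. \<forall>y\<in>T. loc_aut (\<sigma>t x) \<longrightarrow> loc_aut (\<sigma>t y))"
      using eq by blast
  qed (use \<open>loc_aut (\<sigma>t 0)\<close> in auto)
  then show ?thesis unfolding loc_aut_def s1[OF roe_alg_chi] .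
qed

section \<open>Unitaries implementing a local automorphism\<close>

lemma unitary_op_norm:
  assumes "unitary_op w" "\<xi> \<in> ell2"
  shows "l2norm (w \<xi>) = l2norm \<xi>"
proof -
  have w: "bounded_op w" "op_adjoint w \<circ> w = idop" using assms(1) by (auto simp: unitary_op_def)
  have "op_adjoint w (w \<xi>) = \<xi>" using fun_cong[OF w(2), of \<xi>] assms(2) by (simp add: idop_def)
  then have "l2inner (w \<xi>) (w \<xi>) = l2inner \<xi> \<xi>"
    using l2inner_adjoint[OF w(1) assms(2) bounded_op_in_ell2[OF w(1)], of \<xi>] by simp
  then have "(l2norm (w \<xi>))\<^sup>2 = (l2norm \<xi>)\<^sup>2"
    unfolding l2inner_self[OF assms(2)] l2inner_self[OF bounded_op_in_ell2[OF w(1)]]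
    by (simp only: of_real_eq_iff)
  then show ?thesis by simp
qed

lemma implementing_unitary_quasi_local:
  fixes \<sigma> :: "'a::metric_space op \<Rightarrow> 'a op" and w :: "'a op"
  assumes l: "loc_aut \<sigma>" and w: "unitary_op w"
    and \<sigma>: "\<And>B. \<sigma> (chi B) = w \<circ> chi B \<circ> op_adjoint w"
  shows "quasi_local w"
proof -
  have wb: "bounded_op w" "op_adjoint w \<circ> w = idop" using w by (auto simp: unitary_op_def)
  have "\<exists>R. ql e R w" if e: "e > 0" for e
  proof -
    obtain R where R: "\<forall>B. \<forall>\<xi>\<in>ell2. l2norm (restr (- nbhd R B) (\<sigma> (chi B) \<xi>)) \<le> e * l2norm \<xi>"
      using l[unfolded loc_aut_def, rule_format, OF e] ..
    have "ql e R w"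
    proof (rule qlI)
      fix C D :: "'a set" and \<xi> :: "'a \<Rightarrow> complex" assume s: "sep R C D" and \<xi>: "\<xi> \<in> ell2"
      have ww: "op_adjoint w (w \<xi>) = \<xi>" using fun_cong[OF wb(2), of \<xi>] \<xi> by (simp add: idop_def)
      have wx: "w \<xi> \<in> ell2" using wb by simp
      have eq: "w (restr D \<xi>) = \<sigma> (chi D) (w \<xi>)" by (simp add: \<sigma> ww chi_apply[OF \<xi>])
      have "C = C \<inter> - nbhd R D" using s by (force simp: sep_def nbhd_def)
      then have "restr C (w (restr D \<xi>)) = restr C (restr (- nbhd R D) (w (restr D \<xi>)))" by simp
      then have "l2norm (restr C (w (restr D \<xi>))) \<le> l2norm (restr (- nbhd R D) (w (restr D \<xi>)))"
        using l2norm_restr_le[OF ell2_restr[OF bounded_op_in_ell2[OF wb(1)]]] by metis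
      also have "\<dots> \<le> e * l2norm (w \<xi>)" unfolding eq using R wx by simp
      also have "\<dots> = e * l2norm \<xi>" by (simp add: unitary_op_norm[OF w \<xi>])
      finally show "l2norm (restr C (w (restr D \<xi>))) \<le> e * l2norm \<xi>" .
    qed
    then show ?thesis ..
  qed
  then show ?thesis using wb by (simp add: quasi_local_def)
qed

section \<open>Metric sparsification\<close>

text \<open>Property A for nonnegative functions, phrased through finite sums so that sums over
  \<open>x\<close> and \<open>z\<close> can be exchanged freely. Total square mass 1 is reached as
  soon as \<open>Z\<close> contains the ball carrying \<open>\<phi> x\<close>.\<close>

definition weight_family :: "real \<Rightarrow> real \<Rightarrow> real \<Rightarrow> ('a::metric_space \<Rightarrow> 'a \<Rightarrow> real) \<Rightarrow> bool" where
  "weight_family e R S \<phi> \<longleftrightarrow> (\<forall>x z. 0 \<le> \<phi> x z) \<and> (\<forall>x z. \<phi> x z \<noteq> 0 \<longrightarrow> dist x z \<le> S) \<and>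
    (\<forall>x Z. finite Z \<longrightarrow> cball x S \<subseteq> Z \<longrightarrow> (\<Sum>z\<in>Z. (\<phi> x z)\<^sup>2) = 1) \<and>
    (\<forall>x Z. finite Z \<longrightarrow> (\<Sum>z\<in>Z. (\<phi> x z)\<^sup>2) \<le> 1) \<and>
    (\<forall>x y Z. finite Z \<longrightarrow> dist x y \<le> R \<longrightarrow> (\<Sum>z\<in>Z. (\<phi> x z - \<phi> y z)\<^sup>2) \<le> e\<^sup>2)"

lemma weight_familyD:
  assumes "weight_family e R S \<phi>"
  shows "0 \<le> \<phi> x z" "\<phi> x z \<noteq> 0 \<Longrightarrow> dist x z \<le> S"
    "finite Z \<Longrightarrow> cball x S \<subseteq> Z \<Longrightarrow> (\<Sum>z\<in>Z. (\<phi> x z)\<^sup>2) = 1"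
    "finite Z \<Longrightarrow> (\<Sum>z\<in>Z. (\<phi> x z)\<^sup>2) \<le> 1"
    "finite Z \<Longrightarrow> dist x y \<le> R \<Longrightarrow> (\<Sum>z\<in>Z. (\<phi> x z - \<phi> y z)\<^sup>2) \<le> e\<^sup>2"
  using assms unfolding weight_family_def by simp_all

text \<open>Take absolute values: norms and supports are kept, and the reverse triangle inequality
  keeps the variation bound.\<close>

lemma property_A_weights:
  assumes A: "property_A TYPE('a::metric_space)" and "e > 0" "R > 0"
  shows "\<exists>S (\<phi> :: 'a \<Rightarrow> 'a \<Rightarrow> real). weight_family e R S \<phi>"
proof -
  obtain \<xi> :: "'a \<Rightarrow> 'a \<Rightarrow> complex" where h:
    "(\<forall>x. \<xi> x \<in> ell2 \<and> l2norm (\<xi> x) = 1) \<and>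
     (\<forall>x y. dist x y \<le> R \<longrightarrow> l2norm (\<lambda>z. \<xi> x z - \<xi> y z) \<le> e) \<and> (\<exists>S. \<forall>x y. \<xi> x y \<noteq> 0 \<longrightarrow> dist x y \<le> S)"
    using A[unfolded property_A_def, rule_format, OF assms(2,3)] ..
  then obtain S where "\<forall>x y. \<xi> x y \<noteq> 0 \<longrightarrow> dist x y \<le> S" by (elim conjE exE)
  with h have \<xi>: "\<xi> x \<in> ell2" "l2norm (\<xi> x) = 1"
    "dist x y \<le> R \<Longrightarrow> l2norm (\<lambda>z. \<xi> x z - \<xi> y z) \<le> e" "\<xi> x y \<noteq> 0 \<Longrightarrow> dist x y \<le> S" for x y :: "'a" by simp_all
  define \<phi> where "\<phi> = (\<lambda>x z. cmod (\<xi> x z))"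
  have "weight_family e R S \<phi>"
    unfolding weight_family_def
  proof (intro conjI allI impI)
    fix x :: 'a and Z assume Z: "finite Z" "cball x S \<subseteq> Z"
    have "\<xi> x z = 0" if "z \<notin> Z" for z using that Z(2) \<xi>(4)[of x z] by fastforce
    from ell2_finite_support(2)[OF Z(1) this] have "L2_set (\<phi> x) Z = 1"
      using \<xi>(2)[of x] unfolding \<phi>_def by simp
    then show "(\<Sum>z\<in>Z. (\<phi> x z)\<^sup>2) = 1" by (simp add: L2_set_def)
  next
    fix x :: 'a and Z assume Z: "finite (Z::'a set)"
    have "L2_set (\<phi> x) Z \<le> 1" using L2_set_le_l2norm[OF \<xi>(1) Z, of x] \<xi>(2)[of x] unfolding \<phi>_def by simp
    then show "(\<Sum>z\<in>Z. (\<phi> x z)\<^sup>2) \<le> 1" by (simp add: L2_set_def)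
  next
    fix x y :: 'a and Z assume Z: "finite (Z::'a set)" and xy: "dist x y \<le> R"
    have "(\<Sum>z\<in>Z. (\<phi> x z - \<phi> y z)\<^sup>2) \<le> (\<Sum>z\<in>Z. (cmod (\<xi> x z - \<xi> y z))\<^sup>2)"
      unfolding \<phi>_def by (intro sum_mono abs_le_square_iff[THEN iffD1]) (simp add: norm_triangle_ineq3)
    also have "\<dots> = (L2_set (\<lambda>z. cmod (\<xi> x z - \<xi> y z)) Z)\<^sup>2" by (simp add: L2_set_def sum_nonneg)
    also have "\<dots> \<le> e\<^sup>2"
      using L2_set_le_l2norm[OF ell2_diff(1)[OF \<xi>(1,1)] Z, of x y] \<xi>(3)[OF xy]
      by (intro power_mono) auto
    finally show "(\<Sum>z\<in>Z. (\<phi> x z - \<phi> y z)\<^sup>2) \<le> e\<^sup>2" .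
  qed (auto simp: \<phi>_def \<xi>(4))
  then show ?thesis by blast
qed

text \<open>The layer-cake formula for one pair of values: the measure of the levels
  \<open>t\<close> that separate \<open>a\<close> from \<open>b\<close>.\<close>

lemma has_integral_step:
  fixes a b :: real
  assumes "0 \<le> a" "a \<le> 1" "0 \<le> b" "b \<le> 1"
  shows "((\<lambda>t. if a \<le> t \<and> t < b then 1 else 0) has_integral max 0 (b - a)) {0..1::real}"
proof (cases "a \<le> b")
  case True
  have "((\<lambda>t::real. 1::real) has_integral (b - a)) {a..b}"
    using has_integral_const_real[of "1::real" a b] True by simp
  then have "((\<lambda>t. if t \<in> {a..b} then 1 else 0) has_integral (b - a)) {0..1::real}"
    by (subst has_integral_restrict) (use assms in auto)
  then have "((\<lambda>t. if a \<le> t \<and> t < b then 1 else 0) has_integral (b - a)) {0..1::real}"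
    by (rule has_integral_spike_finite[of "{b}", rotated 2]) auto
  with True show ?thesis by simp
next
  case False
  then have "(\<lambda>t. if a \<le> t \<and> t < b then 1 else 0::real) = (\<lambda>_. 0)" by auto
  with False show ?thesis by simp
qed

text \<open>Uniform local amenability with respect to weights: the sets \<open>E\<close> are superlevel sets
  of \<open>x \<mapsto> (\<phi> x z)\<^sup>2\<close>, and averaging over the level and over \<open>z\<close> shows that one of them works.\<close>

lemma uniform_local_amenability:
  assumes A: "property_A TYPE('a::metric_space)" and ulf: "unif_locally_finite TYPE('a)"
    and R: "R > 0" and c: "c > 0"
  shows "\<exists>S. \<forall>F \<mu>. finite F \<longrightarrow> (\<forall>x. 0 \<le> \<mu> x) \<longrightarrow> sum \<mu> F > 0 \<longrightarrow>
    (\<exists>E (z::'a). E \<subseteq> F \<and> E \<subseteq> cball z S \<and> sum \<mu> E > (0::real) \<and>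
      sum \<mu> {x\<in>F - E. \<exists>y\<in>E. dist x y \<le> R} \<le> c * sum \<mu> E)"
proof -
  obtain N where N: "\<And>x::'a. finite (cball x R)" "\<And>x::'a. card (cball x R) \<le> N"
    using ulf R unfolding unif_locally_finite_def by meson
  \<comment> \<open>The variation bound is \<open>2 * e\<close> for each pair, with at most
    \<open>N\<close> neighbours per point; \<open>N + 1\<close> makes the final comparison with
    \<open>c\<close> strict.\<close>
  define e where "e = c / (2 * (real N + 1))"
  have e: "e > 0" using c by (simp add: e_def)
  obtain S0 and \<phi> :: "'a \<Rightarrow> 'a \<Rightarrow> real" where wf: "weight_family e R S0 \<phi>"
    using property_A_weights[OF A e R] by blast
  note \<phi> = weight_familyD[OF wf]
  \<comment> \<open>For each \<open>x\<close> the squares form a probability distribution in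
    \<open>z\<close> with values in the unit interval, as the integration over levels
    requires.\<close>
  define a where "a = (\<lambda>x z. (\<phi> x z)\<^sup>2)"
  have a0: "0 \<le> a x z" for x z by (simp add: a_def)
  have a1: "a x z \<le> 1" for x z using \<phi>(4)[of "{z}" x] by (simp add: a_def)
  have finS: "finite (cball x S0)" for x :: 'a
  proof (cases "S0 > 0")
    case True
    then show ?thesis using ulf unfolding unif_locally_finite_def by blast
  next
    case False
    then have "cball x S0 \<subseteq> {x}" by (auto simp: not_less) (smt (verit) zero_le_dist dist_eq_0_iff)
    then show ?thesis using finite_subset by blast
  qed
  \<comment> \<open>A difference of squares factors; Cauchy-Schwarz pairs the small l2 norm of the
    difference with the norm at most 2 of the sum.\<close>
  have var: "(\<Sum>z\<in>Z. \<bar>a y z - a x z\<bar>) \<le> 2 * e" if Z: "finite Z" and xy: "dist x y \<le> R" for x y Z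
  proof -
    have "(\<Sum>z\<in>Z. \<bar>a y z - a x z\<bar>) = (\<Sum>z\<in>Z. \<bar>\<phi> x z - \<phi> y z\<bar> * \<bar>\<phi> x z + \<phi> y z\<bar>)"
      by (intro sum.cong) (auto simp: a_def power2_eq_square abs_mult[symmetric] algebra_simps abs_minus_commute)
    also have "\<dots> \<le> L2_set (\<lambda>z. \<phi> x z - \<phi> y z) Z * L2_set (\<lambda>z. \<phi> x z + \<phi> y z) Z"
      by (rule L2_set_mult_ineq)
    also have "\<dots> \<le> e * 2"
    proof (rule mult_mono)
      show "L2_set (\<lambda>z. \<phi> x z - \<phi> y z) Z \<le> e"
        unfolding L2_set_def using \<phi>(5)[OF Z xy] e by (intro real_le_lsqrt) auto
      have "L2_set (\<lambda>z. \<phi> x z + \<phi> y z) Z \<le> L2_set (\<phi> x) Z + L2_set (\<phi> y) Z"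
        by (rule L2_set_triangle_ineq)
      also have "\<dots> \<le> 1 + 1" unfolding L2_set_def using \<phi>(4)[OF Z]
        by (intro add_mono real_le_lsqrt) auto
      finally show "L2_set (\<lambda>z. \<phi> x z + \<phi> y z) Z \<le> 2" by simp
    qed (use e in auto)
    finally show ?thesis by simp
  qed
  show ?thesis
  proof (intro exI[of _ S0] allI impI)
    fix F :: "'a set" and \<mu> :: "'a \<Rightarrow> real"
    assume F: "finite F" and \<mu>: "\<forall>x. 0 \<le> \<mu> x" and pos: "sum \<mu> F > 0"
    define E where "E = (\<lambda>z t. {x\<in>F. t < a x z})"
    define D where "D = (\<lambda>z t. {x\<in>F - E z t. \<exists>y\<in>E z t. dist x y \<le> R})"
    show "\<exists>E z. E \<subseteq> F \<and> E \<subseteq> cball z S0 \<and> sum \<mu> E > 0 \<and>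
      sum \<mu> {x\<in>F - E. \<exists>y\<in>E. dist x y \<le> R} \<le> c * sum \<mu> E"
    proof (rule ccontr)
      assume neg: "\<not> ?thesis"
      \<comment> \<open>If no set works, every superlevel set has boundary mass at least
        \<open>c\<close> times its own mass. Nonnegativity of \<open>t\<close> confines the
        superlevel set to the support of \<open>\<phi>\<close> near \<open>z\<close>.\<close>
      have le: "c * sum \<mu> (E z t) \<le> sum \<mu> (D z t)" if t: "0 \<le> t" for z t
      proof (rule ccontr)
        assume h: "\<not> ?thesis"
        have EF: "E z t \<subseteq> F" by (auto simp: E_def)
        have "0 \<le> sum \<mu> (D z t)" using \<mu> by (simp add: sum_nonneg)
        then have "c * sum \<mu> (E z t) > 0" using h by linarith
        then have "sum \<mu> (E z t) > 0" using c by (simp add: zero_less_mult_iff)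
        moreover have "E z t \<subseteq> cball z S0"
          using t \<phi>(2)[of _ z] by (force simp: E_def a_def dist_commute)
        moreover have "sum \<mu> {x\<in>F - E z t. \<exists>y\<in>E z t. dist x y \<le> R} \<le> c * sum \<mu> (E z t)"
          using h unfolding D_def by linarith
        ultimately show False using neg EF by blast
      qed
      define Z where "Z = (\<Union>x\<in>F. cball x S0)"
      have Z: "finite Z" using F finS by (simp add: Z_def)
      let ?B = "\<lambda>x. F \<inter> cball x R"
      \<comment> \<open>Integrate over \<open>t\<close>: the left integrand is the mass of the
        superlevel set, while a boundary point is charged to a neighbour \<open>y\<close> with
        \<open>a x z \<le> t < a y z\<close>.\<close>
      have "c * (\<Sum>x\<in>F. \<mu> x * a x z) \<le> (\<Sum>x\<in>F. \<Sum>y\<in>?B x. \<mu> x * \<bar>a y z - a x z\<bar>)" for z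
      proof -
        let ?f = "\<lambda>t::real. c * (\<Sum>x\<in>F. \<mu> x * (if 0 \<le> t \<and> t < a x z then 1 else 0))"
        let ?g = "\<lambda>t::real. (\<Sum>x\<in>F. \<Sum>y\<in>?B x. \<mu> x * (if a x z \<le> t \<and> t < a y z then 1 else 0))"
        have f: "(?f has_integral c * (\<Sum>x\<in>F. \<mu> x * max 0 (a x z - 0))) {0..1}"
          by (intro has_integral_mult_right has_integral_sum F has_integral_step) (use a0 a1 in auto)
        have g: "(?g has_integral (\<Sum>x\<in>F. \<Sum>y\<in>?B x. \<mu> x * max 0 (a y z - a x z))) {0..1}"
          by (intro has_integral_mult_right has_integral_sum F has_integral_step finite_Int disjI1 a0 a1)
        have fg: "?f t \<le> ?g t" if t: "t \<in> {0..1}" for t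
        proof -
          have "?f t = c * sum \<mu> (E z t)"
            unfolding E_def using t F by (simp add: sum.inter_filter if_distrib[of "\<lambda>u. _ * u"] cong: if_cong)
          also have "\<dots> \<le> sum \<mu> (D z t)" using t by (intro le) simp
          also have "\<dots> = (\<Sum>x\<in>F. if x \<in> D z t then \<mu> x else 0)"
            by (subst sum.inter_restrict[OF F, symmetric]) (auto intro!: sum.cong simp: D_def)
          also have "\<dots> \<le> ?g t"
          proof (rule sum_mono)
            fix x assume x: "x \<in> F"
            have nn: "0 \<le> \<mu> x * (if a x z \<le> t \<and> t < a y z then 1 else 0)" for y using \<mu> by simp
            show "(if x \<in> D z t then \<mu> x else 0) \<le> (\<Sum>y\<in>?B x. \<mu> x * (if a x z \<le> t \<and> t < a y z then 1 else 0))"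
            proof (cases "x \<in> D z t")
              case True
              then obtain y where y: "y \<in> E z t" "dist x y \<le> R" "x \<notin> E z t" by (auto simp: D_def)
              then have yB: "y \<in> ?B x" "a x z \<le> t" "t < a y z" using x by (auto simp: E_def)
              have "\<mu> x * (if a x z \<le> t \<and> t < a y z then 1 else 0)
                  \<le> (\<Sum>y\<in>?B x. \<mu> x * (if a x z \<le> t \<and> t < a y z then 1 else 0))"
                by (rule member_le_sum[OF yB(1)]) (use nn F in auto)
              with True yB show ?thesis by simp
            qed (simp add: sum_nonneg nn)
          qed
          finally show ?thesis .
        qed
        have "c * (\<Sum>x\<in>F. \<mu> x * max 0 (a x z - 0)) \<le> (\<Sum>x\<in>F. \<Sum>y\<in>?B x. \<mu> x * max 0 (a y z - a x z))"
          by (rule has_integral_le[OF f g fg])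
        also have "\<dots> \<le> (\<Sum>x\<in>F. \<Sum>y\<in>?B x. \<mu> x * \<bar>a y z - a x z\<bar>)"
          by (intro sum_mono mult_left_mono) (use \<mu> in auto)
        finally show ?thesis using a0 by simp
      qed
      then have "(\<Sum>z\<in>Z. c * (\<Sum>x\<in>F. \<mu> x * a x z)) \<le> (\<Sum>z\<in>Z. \<Sum>x\<in>F. \<Sum>y\<in>?B x. \<mu> x * \<bar>a y z - a x z\<bar>)"
        by (rule sum_mono)
      also have "\<dots> = (\<Sum>x\<in>F. \<Sum>z\<in>Z. \<Sum>y\<in>?B x. \<mu> x * \<bar>a y z - a x z\<bar>)" by (rule sum.swap)
      also have "\<dots> = (\<Sum>x\<in>F. \<Sum>y\<in>?B x. \<mu> x * (\<Sum>z\<in>Z. \<bar>a y z - a x z\<bar>))"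
        unfolding sum_distrib_left by (rule sum.cong[OF refl], rule sum.swap)
      also have "\<dots> \<le> (\<Sum>x\<in>F. \<Sum>y\<in>?B x. \<mu> x * (2 * e))"
        by (intro sum_mono mult_left_mono var Z) (use \<mu> in auto)
      also have "\<dots> = (\<Sum>x\<in>F. \<mu> x * (real (card (?B x)) * (2 * e)))" by (simp add: algebra_simps)
      also have "\<dots> \<le> (\<Sum>x\<in>F. \<mu> x * (real N * (2 * e)))"
      proof (intro sum_mono mult_left_mono mult_right_mono)
        fix x
        have "card (?B x) \<le> card (cball x R)" by (intro card_mono N) auto
        then show "real (card (?B x)) \<le> real N" using N(2)[of x] by linarith
      qed (use \<mu> e in auto)
      also have "\<dots> = real N * (2 * e) * sum \<mu> F" unfolding sum_distrib_right[symmetric] by (rule mult.commute)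
      finally have 1: "(\<Sum>z\<in>Z. c * (\<Sum>x\<in>F. \<mu> x * a x z)) \<le> real N * (2 * e) * sum \<mu> F" .
      \<comment> \<open>Summed over \<open>z\<close>, the distributions have total mass 1, so the
        left side recovers all the mass of \<open>F\<close>.\<close>
      have "(\<Sum>z\<in>Z. c * (\<Sum>x\<in>F. \<mu> x * a x z)) = c * (\<Sum>x\<in>F. \<mu> x * (\<Sum>z\<in>Z. a x z))"
        unfolding sum_distrib_left by (subst sum.swap) (simp add: algebra_simps)
      also have "\<dots> = c * sum \<mu> F"
      proof -
        have "(\<Sum>z\<in>Z. a x z) = 1" if "x \<in> F" for x
          unfolding a_def by (rule \<phi>(3)[OF Z]) (use that in \<open>auto simp: Z_def\<close>)
        then show ?thesis by simp
      qed
      finally have "c * sum \<mu> F \<le> real N * (2 * e) * sum \<mu> F" using 1 by simp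
      then have "c \<le> real N * (2 * e)" using pos by simp
      also have "\<dots> < (real N + 1) * (2 * e)" using e by simp
      also have "\<dots> = c" by (simp add: e_def field_simps)
      finally show False by simp
    qed
  qed
qed

text \<open>Greedy selection: take a set with small boundary, remove its
  \<open>R\<close>-neighbourhood, and continue on the rest. Each boundary thrown away is charged to
  the piece just taken.\<close>

lemma metric_sparsification:
  assumes A: "property_A TYPE('a::metric_space)" and ulf: "unif_locally_finite TYPE('a)"
    and R: "R > 0" and c: "c > 0"
  shows "\<exists>S. \<forall>F \<mu>. finite F \<longrightarrow> (\<forall>x. 0 \<le> \<mu> x) \<longrightarrow>
    (\<exists>\<O>::'a set set. finite \<O> \<and> \<Union>\<O> \<subseteq> F \<and> (\<forall>E\<in>\<O>. \<exists>z. E \<subseteq> cball z S) \<and>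
      (\<forall>E\<in>\<O>. \<forall>E'\<in>\<O>. E \<noteq> E' \<longrightarrow> sep R E E') \<and> sum \<mu> (F - \<Union>\<O>) \<le> c * (sum \<mu> F :: real))"
proof -
  obtain S where "\<forall>F \<mu>. finite F \<longrightarrow> (\<forall>x. 0 \<le> \<mu> x) \<longrightarrow> sum \<mu> F > 0 \<longrightarrow>
    (\<exists>E (z::'a). E \<subseteq> F \<and> E \<subseteq> cball z S \<and> sum \<mu> E > (0::real) \<and>
      sum \<mu> {x\<in>F - E. \<exists>y\<in>E. dist x y \<le> R} \<le> c * sum \<mu> E)"
    using uniform_local_amenability[OF A ulf R c] ..
  note S = this[rule_format]
  \<comment> \<open>The loss is measured against the mass of the chosen pieces, a stronger bound
    than the one wanted: the pieces are disjoint, so the charges add up in the induction.\<close>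
  have "\<exists>\<O>::'a set set. finite \<O> \<and> \<Union>\<O> \<subseteq> F \<and> (\<forall>E\<in>\<O>. \<exists>z. E \<subseteq> cball z S) \<and>
      (\<forall>E\<in>\<O>. \<forall>E'\<in>\<O>. E \<noteq> E' \<longrightarrow> sep R E E') \<and> sum \<mu> (F - \<Union>\<O>) \<le> c * sum \<mu> (\<Union>\<O>)"
    if F: "finite F" and \<mu>: "\<forall>x. 0 \<le> \<mu> x" for F and \<mu> :: "'a \<Rightarrow> real"
    using F
  proof (induction "card F" arbitrary: F rule: less_induct)
    case less
    note F = \<open>finite F\<close>
    show ?case
    proof (cases "sum \<mu> F > 0")
      case False
      then show ?thesis by (intro exI[of _ "{}"]) auto
    next
      case True
      then obtain E z where E: "E \<subseteq> F" "E \<subseteq> cball z S" "sum \<mu> E > 0"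
        "sum \<mu> {x\<in>F - E. \<exists>y\<in>E. dist x y \<le> R} \<le> c * sum \<mu> E"
        using S[OF F, of \<mu>] \<mu> by auto
      define F' where "F' = F - nbhd R E"
      have En: "E \<subseteq> nbhd R E" using R by (force simp: nbhd_def)
      have "E \<noteq> {}" using E(3) by auto
      then have "F' \<subset> F" using E(1) En by (auto simp: F'_def)
      then have "card F' < card F" "finite F'" using F by (auto intro: psubset_card_mono finite_subset)
      from less(1)[OF this] obtain \<O> :: "'a set set" where
        "finite \<O> \<and> \<Union>\<O> \<subseteq> F' \<and> (\<forall>E\<in>\<O>. \<exists>z. E \<subseteq> cball z S) \<and>
        (\<forall>E\<in>\<O>. \<forall>E'\<in>\<O>. E \<noteq> E' \<longrightarrow> sep R E E') \<and> sum \<mu> (F' - \<Union>\<O>) \<le> c * sum \<mu> (\<Union>\<O>)" ..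
      then have O: "finite \<O>" "\<Union>\<O> \<subseteq> F'" "\<forall>E\<in>\<O>. \<exists>z. E \<subseteq> cball z S"
        "\<forall>E\<in>\<O>. \<forall>E'\<in>\<O>. E \<noteq> E' \<longrightarrow> sep R E E'" "sum \<mu> (F' - \<Union>\<O>) \<le> c * sum \<mu> (\<Union>\<O>)" by simp_all
      have fin: "finite (\<Union>\<O>)" "finite E" by (rule finite_subset[OF O(2) \<open>finite F'\<close>], rule finite_subset[OF E(1) F])
      have sE: "sep R E' E" if "E' \<in> \<O>" for E'
        using that O(2) by (force simp: sep_def F'_def nbhd_def not_le)
      have dj: "E \<inter> \<Union>\<O> = {}" using O(2) En by (auto simp: F'_def)
      have "F - \<Union>(insert E \<O>) \<subseteq> {x\<in>F - E. \<exists>y\<in>E. dist x y \<le> R} \<union> (F' - \<Union>\<O>)"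
        by (auto simp: F'_def nbhd_def)
      then have "sum \<mu> (F - \<Union>(insert E \<O>)) \<le> sum \<mu> ({x\<in>F - E. \<exists>y\<in>E. dist x y \<le> R} \<union> (F' - \<Union>\<O>))"
        using F \<mu> \<open>finite F'\<close> by (intro sum_mono2) auto
      also have "\<dots> \<le> sum \<mu> {x\<in>F - E. \<exists>y\<in>E. dist x y \<le> R} + sum \<mu> (F' - \<Union>\<O>)"
        using F \<mu> \<open>finite F'\<close> by (subst sum_Un) (auto simp: sum_nonneg)
      also have "\<dots> \<le> c * sum \<mu> E + c * sum \<mu> (\<Union>\<O>)" by (intro add_mono E(4) O(5))
      also have "\<dots> = c * sum \<mu> (\<Union>(insert E \<O>))"
        by (simp add: sum.union_disjoint[OF fin(2,1) dj] algebra_simps)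
      finally have m: "sum \<mu> (F - \<Union>(insert E \<O>)) \<le> c * sum \<mu> (\<Union>(insert E \<O>))" .
      show ?thesis
      proof (intro exI[of _ "insert E \<O>"] conjI m)
        show "\<Union>(insert E \<O>) \<subseteq> F" using E(1) O(2) by (auto simp: F'_def)
        show "\<forall>Ea\<in>insert E \<O>. \<forall>E'\<in>insert E \<O>. Ea \<noteq> E' \<longrightarrow> sep R Ea E'"
          using O(4) sE sep_sym[OF sE] by simp
      qed (use O E in auto)
    qed
  qed
  note main = this
  show ?thesis
  proof (intro exI[of _ S] allI impI)
    fix F :: "'a set" and \<mu> :: "'a \<Rightarrow> real" assume F: "finite F" and \<mu>: "\<forall>x. 0 \<le> \<mu> x"
    from main[OF F \<mu>] obtain \<O> :: "'a set set" where
      O: "finite \<O> \<and> \<Union>\<O> \<subseteq> F \<and> (\<forall>E\<in>\<O>. \<exists>z. E \<subseteq> cball z S) \<and>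
      (\<forall>E\<in>\<O>. \<forall>E'\<in>\<O>. E \<noteq> E' \<longrightarrow> sep R E E') \<and> sum \<mu> (F - \<Union>\<O>) \<le> c * sum \<mu> (\<Union>\<O>)" ..
    have "sum \<mu> (\<Union>\<O>) \<le> sum \<mu> F" by (rule sum_mono2[OF F]) (use O \<mu> in simp_all)
    then have "c * sum \<mu> (\<Union>\<O>) \<le> c * sum \<mu> F" using c by simp
    moreover have "sum \<mu> (F - \<Union>\<O>) \<le> c * sum \<mu> (\<Union>\<O>)" using O by simp
    ultimately have "sum \<mu> (F - \<Union>\<O>) \<le> c * sum \<mu> F" by linarith
    with O show "\<exists>\<O>::'a set set. finite \<O> \<and> \<Union>\<O> \<subseteq> F \<and> (\<forall>E\<in>\<O>. \<exists>z. E \<subseteq> cball z S) \<and>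
      (\<forall>E\<in>\<O>. \<forall>E'\<in>\<O>. E \<noteq> E' \<longrightarrow> sep R E E') \<and> sum \<mu> (F - \<Union>\<O>) \<le> c * sum \<mu> F"
      by (intro exI[of _ \<O>]) simp
  qed
qed

section \<open>Localization of operator norms\<close>

text \<open>A uniformly random subset contains \<open>i\<close> and omits \<open>j\<close> with
  probability 1/4.\<close>

lemma card_subsets_separating:
  assumes "finite I" "i \<in> I" "j \<in> I" "i \<noteq> j"
  shows "4 * card {J \<in> Pow I. i \<in> J \<and> j \<notin> J} = 2 ^ card I"
proof -
  have "{J \<in> Pow I. i \<in> J \<and> j \<notin> J} = insert i ` Pow (I - {i, j})"
  proof (intro equalityI subsetI)
    fix J assume "J \<in> {J \<in> Pow I. i \<in> J \<and> j \<notin> J}"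
    then have "J = insert i (J - {i})" "J - {i} \<in> Pow (I - {i, j})" by auto
    then show "J \<in> insert i ` Pow (I - {i, j})" by (rule image_eqI)
  qed (use assms in auto)
  moreover have "inj_on (insert i) (Pow (I - {i, j}))" by (auto simp: inj_on_def)
  ultimately have "card {J \<in> Pow I. i \<in> J \<and> j \<notin> J} = 2 ^ card (I - {i, j})"
    by (simp add: card_image card_Pow assms(1))
  moreover have "card I = card (I - {i, j}) + 2"
    using assms card_Diff_subset[of "{i, j}" I] card_mono[of I "{i, j}"] by simp
  ultimately show ?thesis by (simp add: power_add)
qed

lemma sum_over_separating_subsets:
  fixes x :: "'i \<Rightarrow> 'i \<Rightarrow> complex"
  assumes I: "finite I"
  shows "4 * (\<Sum>J\<in>Pow I. \<Sum>i\<in>J. \<Sum>j\<in>I - J. x i j) = 2 ^ card I * (\<Sum>i\<in>I. \<Sum>j\<in>I - {i}. x i j)"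
proof -
  have "(\<Sum>J\<in>Pow I. \<Sum>i\<in>J. \<Sum>j\<in>I - J. x i j)
      = (\<Sum>J\<in>Pow I. \<Sum>i\<in>I. \<Sum>j\<in>I. if i \<in> J \<and> j \<notin> J then x i j else 0)"
  proof (rule sum.cong[OF refl])
    fix J assume J: "J \<in> Pow I"
    have "(\<Sum>i\<in>J. \<Sum>j\<in>I - J. x i j) = (\<Sum>i\<in>I. if i \<in> J then \<Sum>j\<in>I - J. x i j else 0)"
      by (rule sum.mono_neutral_cong_left) (use I J in auto)
    also have "\<dots> = (\<Sum>i\<in>I. \<Sum>j\<in>I. if i \<in> J \<and> j \<notin> J then x i j else 0)"
    proof (rule sum.cong[OF refl])
      fix i
      have "(\<Sum>j\<in>I - J. x i j) = (\<Sum>j\<in>I. if j \<notin> J then x i j else 0)"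
        by (rule sum.mono_neutral_cong_left) (use I in auto)
      then show "(if i \<in> J then \<Sum>j\<in>I - J. x i j else 0) = (\<Sum>j\<in>I. if i \<in> J \<and> j \<notin> J then x i j else 0)"
        by simp
    qed
    finally show "(\<Sum>i\<in>J. \<Sum>j\<in>I - J. x i j) = (\<Sum>i\<in>I. \<Sum>j\<in>I. if i \<in> J \<and> j \<notin> J then x i j else 0)" .
  qed
  also have "\<dots> = (\<Sum>i\<in>I. \<Sum>J\<in>Pow I. \<Sum>j\<in>I. if i \<in> J \<and> j \<notin> J then x i j else 0)" by (rule sum.swap)
  also have "\<dots> = (\<Sum>i\<in>I. \<Sum>j\<in>I. \<Sum>J\<in>Pow I. if i \<in> J \<and> j \<notin> J then x i j else 0)"
    by (rule sum.cong[OF refl], rule sum.swap)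
  also have "\<dots> = (\<Sum>i\<in>I. \<Sum>j\<in>I. of_nat (card {J \<in> Pow I. i \<in> J \<and> j \<notin> J}) * x i j)"
    using I by (simp add: sum.inter_filter[symmetric])
  finally have "4 * (\<Sum>J\<in>Pow I. \<Sum>i\<in>J. \<Sum>j\<in>I - J. x i j)
      = (\<Sum>i\<in>I. \<Sum>j\<in>I. of_nat (4 * card {J \<in> Pow I. i \<in> J \<and> j \<notin> J}) * x i j)"
    by (simp add: sum_distrib_left mult.assoc)
  also have "\<dots> = (\<Sum>i\<in>I. \<Sum>j\<in>I - {i}. 2 ^ card I * x i j)"
  proof (rule sum.cong[OF refl])
    fix i assume i: "i \<in> I"
    show "(\<Sum>j\<in>I. of_nat (4 * card {J \<in> Pow I. i \<in> J \<and> j \<notin> J}) * x i j) = (\<Sum>j\<in>I - {i}. 2 ^ card I * x i j)"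
    proof (rule sum.mono_neutral_cong_right)
      fix j assume "j \<in> I - {i}"
      then have "4 * card {J \<in> Pow I. i \<in> J \<and> j \<notin> J} = 2 ^ card I"
        by (intro card_subsets_separating I i) auto
      then show "of_nat (4 * card {J \<in> Pow I. i \<in> J \<and> j \<notin> J}) * x i j = 2 ^ card I * x i j"
        by (simp only: of_nat_power of_nat_numeral)
    qed (use I in auto)
  qed
  finally show ?thesis by (simp add: sum_distrib_left)
qed

text \<open>The off-diagonal part is 4 times the average of the blocks between \<open>J\<close> and
  \<open>I - J\<close> over all subsets \<open>J\<close>; the factor 4 is the inverse of the
  separation probability and does not grow with \<open>card I\<close>.\<close>

lemma off_diagonal_norm_le:
  assumes I: "finite I" and x: "\<And>i j. x i j \<in> ell2" and K: "0 \<le> K"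
    and b: "\<And>J. J \<subseteq> I \<Longrightarrow> l2norm (\<lambda>a. \<Sum>i\<in>J. \<Sum>j\<in>I - J. x i j a) \<le> K"
  shows "l2norm (\<lambda>a. \<Sum>i\<in>I. \<Sum>j\<in>I - {i}. x i j a) \<le> 4 * K"
proof -
  let ?o = "\<lambda>a. \<Sum>i\<in>I. \<Sum>j\<in>I - {i}. x i j a"
  let ?s = "\<lambda>J a. \<Sum>i\<in>J. \<Sum>j\<in>I - J. x i j a"
  have s: "?s J \<in> ell2" if "J \<in> Pow I" for J
    using that I finite_subset[of J I] by (intro ell2_sum(1) x) auto
  have "2 ^ card I * l2norm ?o = l2norm (\<lambda>a. 2 ^ card I * ?o a)"
    by (simp add: l2norm_scale norm_power)
  also have "\<dots> = l2norm (\<lambda>a. 4 * (\<Sum>J\<in>Pow I. ?s J a))"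
    by (simp only: sum_over_separating_subsets[OF I])
  also have "\<dots> = 4 * l2norm (\<lambda>a. \<Sum>J\<in>Pow I. ?s J a)" by (simp add: l2norm_scale)
  also have "l2norm (\<lambda>a. \<Sum>J\<in>Pow I. ?s J a) \<le> (\<Sum>J\<in>Pow I. l2norm (?s J))"
    by (rule ell2_sum(2)) (use I s in auto)
  also have "\<dots> \<le> (\<Sum>J\<in>Pow I. K)" by (rule sum_mono) (use b in auto)
  also have "\<dots> = 2 ^ card I * K" by (simp add: card_Pow I)
  finally show ?thesis by simp
qed

lemma restr_UN_sum:
  assumes "finite I" "\<And>i j. i \<in> I \<Longrightarrow> j \<in> I \<Longrightarrow> i \<noteq> j \<Longrightarrow> N i \<inter> N j = {}"
  shows "restr (\<Union>i\<in>I. N i) f = (\<lambda>x. \<Sum>i\<in>I. restr (N i) f x)"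
proof
  fix x
  show "restr (\<Union>i\<in>I. N i) f x = (\<Sum>i\<in>I. restr (N i) f x)"
  proof (cases "x \<in> (\<Union>i\<in>I. N i)")
    case True
    then obtain i where i: "i \<in> I" "x \<in> N i" by blast
    then have "(\<Sum>j\<in>I. restr (N j) f x) = (\<Sum>j\<in>{i}. restr (N j) f x)"
      by (intro sum.mono_neutral_right) (use assms in \<open>auto simp: restr_def\<close>)
    with i show ?thesis by (auto simp: restr_def)
  qed (auto simp: restr_def)
qed

lemma l2norm_sum_disjoint:
  assumes "finite I" "\<And>i j. i \<in> I \<Longrightarrow> j \<in> I \<Longrightarrow> i \<noteq> j \<Longrightarrow> N i \<inter> N j = {}" "\<And>i. f i \<in> ell2"
  shows "(l2norm (\<lambda>x. \<Sum>i\<in>I. restr (N i) (f i) x))\<^sup>2 = (\<Sum>i\<in>I. (l2norm (restr (N i) (f i)))\<^sup>2)"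
  using assms(1,2)
proof (induction I rule: finite_induct)
  case (insert i I)
  let ?g = "\<lambda>x. \<Sum>j\<in>insert i I. restr (N j) (f j) x"
  have g: "?g \<in> ell2" by (intro ell2_sum(1)) (use insert assms(3) in auto)
  have "restr (N i) ?g = restr (N i) (f i)"
  proof
    fix x
    have "x \<in> N i \<Longrightarrow> (\<Sum>j\<in>I. restr (N j) (f j) x) = 0"
      by (rule sum.neutral) (use insert in \<open>auto simp: restr_def\<close>)
    then show "restr (N i) ?g x = restr (N i) (f i) x"
      using insert(1,2) by (auto simp: restr_def)
  qed
  moreover have "restr (- N i) ?g = (\<lambda>x. \<Sum>j\<in>I. restr (N j) (f j) x)"
  proof
    fix x
    have "x \<in> N i \<Longrightarrow> (\<Sum>j\<in>I. restr (N j) (f j) x) = 0"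
      by (rule sum.neutral) (use insert in \<open>auto simp: restr_def\<close>)
    then show "restr (- N i) ?g x = (\<Sum>j\<in>I. restr (N j) (f j) x)"
      using insert(1,2) by (auto simp: restr_def)
  qed
  ultimately show ?case
    using l2norm_pythagoras[OF g, of "N i"] insert by simp
qed simp

text \<open>The off-diagonal part of \<open>b\<close> between the pieces is an average over all ways of splitting
  the pieces into two groups, so quasi-locality bounds it independently of the number of pieces.\<close>

lemma quasi_local_norm_on_separated_pieces:
  fixes \<O> :: "'a::metric_space set set"
  assumes b: "bounded_op b" and q: "ql e R b" and e: "0 \<le> e" and R: "0 \<le> R" and h: "0 \<le> h"
    and O: "finite \<O>" and s: "\<And>E E'. E \<in> \<O> \<Longrightarrow> E' \<in> \<O> \<Longrightarrow> E \<noteq> E' \<Longrightarrow> sep (2 * R) E E'"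
    and loc: "\<And>E \<zeta>. E \<in> \<O> \<Longrightarrow> \<zeta> \<in> ell2 \<Longrightarrow> l2norm (b (restr E \<zeta>)) \<le> h * l2norm (restr E \<zeta>)"
    and \<xi>: "\<xi> \<in> ell2"
  shows "l2norm (b (restr (\<Union>\<O>) \<xi>)) \<le> (5 * e + h) * l2norm \<xi>"
proof -
  let ?N = "nbhd R"
  have dE: "E \<inter> E' = {}" if "E \<in> \<O>" "E' \<in> \<O>" "E \<noteq> E'" for E E'
    using s[OF that] R by (force simp: sep_def)
  \<comment> \<open>This is why the pieces are \<open>2 * R\<close> apart: neighbourhoods of radius
    \<open>R\<close> remain disjoint and each stays \<open>R\<close> away from the other
    pieces.\<close>
  have sN: "sep R (?N E) E'" if "E \<in> \<O>" "E' \<in> \<O>" "E \<noteq> E'" for E E'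
    using sep_sym[OF sep_nbhd[of R R E' E]] s[OF that(2,1)] that by simp
  have dN: "?N E \<inter> ?N E' = {}" if "E \<in> \<O>" "E' \<in> \<O>" "E \<noteq> E'" for E E'
    using sN[OF that] by (auto simp: sep_def nbhd_def[of _ E'] not_less[symmetric])
  have bsum: "b (restr (\<Union>\<P>) \<xi>) = (\<lambda>x. \<Sum>E\<in>\<P>. b (restr E \<xi>) x)" if P: "\<P> \<subseteq> \<O>" for \<P>
  proof -
    have fP: "finite \<P>" using P O by (rule finite_subset)
    have "restr (\<Union>E\<in>\<P>. E) \<xi> = (\<lambda>x. \<Sum>E\<in>\<P>. restr E \<xi> x)"
      by (rule restr_UN_sum[OF fP]) (use P dE in blast)
    then show ?thesis using bounded_op_sum[OF b fP, of "\<lambda>E. restr E \<xi>"] \<xi> by simp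
  qed
  define x where "x = (\<lambda>E' E. restr (?N E') (b (restr E \<xi>)))"
  have x: "x E' E \<in> ell2" for E' E using b by (simp add: x_def)
  have block: "restr (\<Union>E\<in>\<P>. ?N E) (b (restr (\<Union>\<Q>) \<xi>)) = (\<lambda>a. \<Sum>E'\<in>\<P>. \<Sum>E\<in>\<Q>. x E' E a)"
    if P: "\<P> \<subseteq> \<O>" and Q: "\<Q> \<subseteq> \<O>" for \<P> \<Q>
  proof -
    have fP: "finite \<P>" using P O by (rule finite_subset)
    have "restr (\<Union>E\<in>\<P>. ?N E) (b (restr (\<Union>\<Q>) \<xi>)) = (\<lambda>a. \<Sum>E'\<in>\<P>. restr (?N E') (b (restr (\<Union>\<Q>) \<xi>)) a)"
      by (rule restr_UN_sum[OF fP]) (use P dN in blast)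
    moreover have "restr D (b (restr (\<Union>\<Q>) \<xi>)) = (\<lambda>a. \<Sum>E\<in>\<Q>. restr D (b (restr E \<xi>)) a)" for D
      unfolding bsum[OF Q] by (auto simp: restr_def)
    ultimately show ?thesis by (simp only: x_def)
  qed
  have off: "l2norm (\<lambda>a. \<Sum>E'\<in>\<O>. \<Sum>E\<in>\<O> - {E'}. x E' E a) \<le> 4 * (e * l2norm \<xi>)"
  proof (rule off_diagonal_norm_le[OF O x])
    fix J assume J: "J \<subseteq> \<O>"
    have "sep R (\<Union>E\<in>J. ?N E) (\<Union>(\<O> - J))"
      unfolding sep_def
    proof (intro ballI)
      fix y z assume "y \<in> (\<Union>E\<in>J. ?N E)" "z \<in> \<Union>(\<O> - J)"
      then obtain E E' where E: "E \<in> J" "y \<in> ?N E" "E' \<in> \<O>" "E' \<notin> J" "z \<in> E'" by blast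
      then have "sep R (?N E) E'" using J by (intro sN) auto
      with E show "R < dist y z" by (auto simp: sep_def)
    qed
    from qlD[OF q this \<xi>]
    show "l2norm (\<lambda>a. \<Sum>E'\<in>J. \<Sum>E\<in>\<O> - J. x E' E a) \<le> e * l2norm \<xi>"
      unfolding block[OF J Diff_subset] .
  qed (use e in simp)
  \<comment> \<open>Both the pieces and their neighbourhoods are pairwise disjoint, so Pythagoras on
    each side gives \<open>h\<close> with no factor for the number of pieces.\<close>
  have diag: "l2norm (\<lambda>a. \<Sum>E\<in>\<O>. x E E a) \<le> h * l2norm \<xi>"
  proof -
    have "(l2norm (\<lambda>a. \<Sum>E\<in>\<O>. x E E a))\<^sup>2 = (\<Sum>E\<in>\<O>. (l2norm (x E E))\<^sup>2)"
      unfolding x_def by (rule l2norm_sum_disjoint[OF O dN]) (use b in auto)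
    also have "\<dots> \<le> (\<Sum>E\<in>\<O>. (h * l2norm (restr E \<xi>))\<^sup>2)"
    proof (intro sum_mono power_mono)
      fix E assume E: "E \<in> \<O>"
      show "l2norm (x E E) \<le> h * l2norm (restr E \<xi>)"
        unfolding x_def using l2norm_restr_le[OF bounded_op_in_ell2[OF b]] loc[OF E \<xi>] by (rule order_trans)
    qed simp
    also have "\<dots> = h\<^sup>2 * (\<Sum>E\<in>\<O>. (l2norm (restr E \<xi>))\<^sup>2)"
      by (simp add: power_mult_distrib sum_distrib_left)
    also have "(\<Sum>E\<in>\<O>. (l2norm (restr E \<xi>))\<^sup>2) = (l2norm (restr (\<Union>E\<in>\<O>. E) \<xi>))\<^sup>2"
      using l2norm_sum_disjoint[of \<O> "\<lambda>E. E" "\<lambda>_. \<xi>", OF O dE \<xi>] restr_UN_sum[of \<O> "\<lambda>E. E" \<xi>, OF O dE]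
      by simp
    also have "h\<^sup>2 * (l2norm (restr (\<Union>E\<in>\<O>. E) \<xi>))\<^sup>2 \<le> h\<^sup>2 * (l2norm \<xi>)\<^sup>2"
      by (intro mult_left_mono power_mono l2norm_restr_le \<xi>) auto
    also have "\<dots> = (h * l2norm \<xi>)\<^sup>2" by (simp add: power_mult_distrib)
    finally show ?thesis by (rule power2_le_imp_le) (use h in simp)
  qed
  let ?v = "b (restr (\<Union>\<O>) \<xi>)" and ?D = "\<Union>E\<in>\<O>. ?N E"
  have v: "?v \<in> ell2" using b by simp
  have "(\<Sum>E\<in>\<O>. x E' E a) = x E' E' a + (\<Sum>E\<in>\<O> - {E'}. x E' E a)" if "E' \<in> \<O>" for E' a
    using O that by (rule sum.remove)
  then have "restr ?D ?v = (\<lambda>a. (\<Sum>E\<in>\<O>. x E E a) + (\<Sum>E'\<in>\<O>. \<Sum>E\<in>\<O> - {E'}. x E' E a))"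
    unfolding block[OF order_refl order_refl] by (simp add: sum.distrib)
  then have "l2norm (restr ?D ?v) \<le> l2norm (\<lambda>a. \<Sum>E\<in>\<O>. x E E a) + l2norm (\<lambda>a. \<Sum>E'\<in>\<O>. \<Sum>E\<in>\<O> - {E'}. x E' E a)"
    by (simp only:) (intro ell2_add(2) ell2_sum(1) O finite_Diff x)
  with off diag have 1: "l2norm (restr ?D ?v) \<le> (4 * e + h) * l2norm \<xi>" by (simp add: algebra_simps)
  \<comment> \<open>What lands outside all neighbourhoods costs one more \<open>e\<close>, besides
    \<open>4 * e\<close> from the off-diagonal part.\<close>
  have "sep R (- ?D) (\<Union>\<O>)" by (force simp: sep_def nbhd_def not_le)
  from qlD[OF q this \<xi>] have 2: "l2norm (restr (- ?D) ?v) \<le> e * l2norm \<xi>" .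
  have "l2norm ?v \<le> l2norm (restr ?D ?v) + l2norm (restr (- ?D) ?v)"
    by (subst restr_split[of ?v ?D]) (rule ell2_add(2), use v in auto)
  with 1 2 show ?thesis by (simp add: algebra_simps)
qed

text \<open>Sparsify the mass given by the squared moduli of a finitely supported vector: the
  discarded part is negligible for an operator bounded by \<open>K\<close>, and the kept part splits
  into separated bounded pieces. The radius depends only on \<open>R\<close>, \<open>e\<close> and
  \<open>K\<close>, so it can be fixed before \<open>b\<close>.\<close>

lemma operator_norm_localization:
  assumes A: "property_A TYPE('a::metric_space)" and ulf: "unif_locally_finite TYPE('a)"
    and R: "R > 0" and e: "e > 0" and K: "K \<ge> 0"
  shows "\<exists>S. \<forall>(b::'a op) h. bounded_op b \<longrightarrow> (\<forall>\<xi>\<in>ell2. l2norm (b \<xi>) \<le> K * l2norm \<xi>) \<longrightarrow> ql e R b \<longrightarrow>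
     0 \<le> h \<longrightarrow> (\<forall>z. \<forall>\<zeta>\<in>ell2. l2norm (b (restr (cball z S) \<zeta>)) \<le> h * l2norm \<zeta>) \<longrightarrow>
     (\<forall>\<xi>\<in>ell2. l2norm (b \<xi>) \<le> (6 * e + h) * l2norm \<xi>)"
proof -
  \<comment> \<open>Squared because sparsification controls squared norms; \<open>K + 1\<close>
    keeps the quotient defined when \<open>K\<close> is zero.\<close>
  define c where "c = (e / (K + 1))\<^sup>2"
  have c: "c > 0" using e K by (simp add: c_def)
  have R2: "2 * R > 0" using R by simp
  obtain S where S: "\<forall>F \<mu>. finite F \<longrightarrow> (\<forall>x. 0 \<le> \<mu> x) \<longrightarrow>
    (\<exists>\<O>::'a set set. finite \<O> \<and> \<Union>\<O> \<subseteq> F \<and> (\<forall>E\<in>\<O>. \<exists>z. E \<subseteq> cball z S) \<and>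
      (\<forall>E\<in>\<O>. \<forall>E'\<in>\<O>. E \<noteq> E' \<longrightarrow> sep (2 * R) E E') \<and> sum \<mu> (F - \<Union>\<O>) \<le> c * (sum \<mu> F :: real))"
    using metric_sparsification[OF A ulf R2 c] ..
  show ?thesis
  proof (intro exI[of _ S] allI impI ballI)
    fix b :: "'a op" and h and \<xi> :: "'a \<Rightarrow> complex"
    assume b: "bounded_op b" and bK: "\<forall>\<xi>\<in>ell2. l2norm (b \<xi>) \<le> K * l2norm \<xi>" and q: "ql e R b"
      and h: "0 \<le> h" and loc: "\<forall>z. \<forall>\<zeta>\<in>ell2. l2norm (b (restr (cball z S) \<zeta>)) \<le> h * l2norm \<zeta>"
      and \<xi>: "\<xi> \<in> ell2"
    show "l2norm (b \<xi>) \<le> (6 * e + h) * l2norm \<xi>"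
    proof (rule norm_bound_from_finite[OF b _ _ \<xi>])
      fix F :: "'a set" and \<xi> :: "'a \<Rightarrow> complex" assume F: "finite F"
      let ?\<mu> = "\<lambda>x. (cmod (\<xi> x))\<^sup>2"
      have "\<forall>x. 0 \<le> ?\<mu> x" by simp
      from S[THEN spec[of _ F], THEN spec[of _ ?\<mu>], THEN mp, OF F, THEN mp, OF this] obtain \<O> :: "'a set set" where
        "finite \<O> \<and> \<Union>\<O> \<subseteq> F \<and> (\<forall>E\<in>\<O>. \<exists>z. E \<subseteq> cball z S) \<and>
         (\<forall>E\<in>\<O>. \<forall>E'\<in>\<O>. E \<noteq> E' \<longrightarrow> sep (2 * R) E E') \<and> sum ?\<mu> (F - \<Union>\<O>) \<le> c * sum ?\<mu> F" ..
      then have O: "finite \<O>" "\<Union>\<O> \<subseteq> F" "\<forall>E\<in>\<O>. \<exists>z. E \<subseteq> cball z S"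
         "\<forall>E\<in>\<O>. \<forall>E'\<in>\<O>. E \<noteq> E' \<longrightarrow> sep (2 * R) E E'" "sum ?\<mu> (F - \<Union>\<O>) \<le> c * sum ?\<mu> F" by simp_all
      let ?r = "restr F \<xi>"
      have r: "?r \<in> ell2" by (rule ell2_restr_finite[OF F])
      have "l2norm (b (restr E \<zeta>)) \<le> h * l2norm (restr E \<zeta>)" if E: "E \<in> \<O>" and \<zeta>: "\<zeta> \<in> ell2" for E \<zeta>
      proof -
        obtain z where "E \<subseteq> cball z S" using O(3) E by blast
        then have "restr E \<zeta> = restr (cball z S) (restr E \<zeta>)" by (simp add: Int_absorb1)
        then show ?thesis using loc[rule_format, OF ell2_restr[OF \<zeta>], of z E] by simp
      qed
      from quasi_local_norm_on_separated_pieces[OF b q less_imp_le[OF e] less_imp_le[OF R] h O(1) O(4)[rule_format] this r]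
      have 1: "l2norm (b (restr (\<Union>\<O>) ?r)) \<le> (5 * e + h) * l2norm ?r" .
      let ?t = "restr (- \<Union>\<O>) ?r"
      have t: "?t \<in> ell2" by (rule ell2_restr[OF r])
      have "?t = restr (F - \<Union>\<O>) \<xi>" by (simp add: Diff_eq Int_commute)
      then have "(l2norm ?t)\<^sup>2 = sum ?\<mu> (F - \<Union>\<O>)"
        using l2norm_restr_finite[of "F - \<Union>\<O>" \<xi>] F by (simp add: L2_set_def sum_nonneg)
      also have "\<dots> \<le> c * sum ?\<mu> F" by (rule O(5))
      also have "\<dots> = (e / (K + 1) * l2norm ?r)\<^sup>2"
        unfolding l2norm_restr_finite[OF F] power_mult_distrib c_def by (simp add: L2_set_def sum_nonneg)
      finally have "l2norm ?t \<le> e / (K + 1) * l2norm ?r"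
        by (rule power2_le_imp_le) (use e K in simp)
      then have "K * l2norm ?t \<le> K * (e / (K + 1) * l2norm ?r)" using K by (rule mult_left_mono)
      also have "\<dots> = (K * (e / (K + 1))) * l2norm ?r" by simp
      also have "\<dots> \<le> e * l2norm ?r"
        by (rule mult_right_mono) (use e K in \<open>simp_all add: field_simps\<close>)
      finally have 2: "l2norm (b ?t) \<le> e * l2norm ?r"
        using bK[rule_format, OF t] by linarith
      have "l2norm (b ?r) \<le> l2norm (b (restr (\<Union>\<O>) ?r)) + l2norm (b ?t)"
        unfolding bounded_op_restr_split[OF b r, of "\<Union>\<O>"] by (rule ell2_add(2)) (use b in auto)
      with 1 2 show "l2norm (b ?r) \<le> (6 * e + h) * l2norm ?r" by (simp add: algebra_simps)
    qed (use e h in simp)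
  qed
qed

section \<open>Band operators in the uniform Roe algebra\<close>

lemma finite_cball_ulf:
  assumes "unif_locally_finite TYPE('a::metric_space)"
  shows "finite (cball (x::'a) r)"
proof -
  have "max r 1 > 0" by simp
  then have "finite (cball x (max r 1))" using assms unfolding unif_locally_finite_def by blast
  then show ?thesis by (rule rev_finite_subset) auto
qed

lemma roe_alg_sum:
  assumes "finite I" "\<And>i. i \<in> I \<Longrightarrow> T i \<in> uniform_roe_alg"
  shows "(\<lambda>\<xi> x. \<Sum>i\<in>I. T i \<xi> x) \<in> uniform_roe_alg"
  using assms
proof (induction I rule: finite_induct)
  case empty
  have "op_scale 0 (chi {}) \<in> uniform_roe_alg" by (intro roe_alg_scale roe_alg_chi)
  then show ?case by (simp add: op_scale_def)
next
  case (insert i I)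
  then have "op_plus (T i) (\<lambda>\<xi> x. \<Sum>i\<in>I. T i \<xi> x) \<in> uniform_roe_alg" by (intro roe_alg_plus) auto
  with insert show ?case by (simp add: op_plus_def)
qed

definition diag_op :: "('a \<Rightarrow> complex) \<Rightarrow> 'a op" where
  "diag_op d = (\<lambda>\<xi>. if \<xi> \<in> ell2 then (\<lambda>x. d x * \<xi> x) else (\<lambda>_. 0))"

lemma diag_op_norm:
  assumes "\<And>x. cmod (d x) \<le> K" "\<xi> \<in> ell2"
  shows "(\<lambda>x. d x * \<xi> x) \<in> ell2" "l2norm (\<lambda>x. d x * \<xi> x) \<le> K * l2norm \<xi>"
proof -
  have K: "0 \<le> K" using assms(1) norm_ge_zero order_trans by blast
  have "cmod (d x * \<xi> x) \<le> cmod (complex_of_real K * \<xi> x)" for x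
    using assms(1)[of x] K by (simp add: norm_mult mult_right_mono)
  note * = ell2_mono[OF ell2_scale[OF assms(2)] this]
  show "(\<lambda>x. d x * \<xi> x) \<in> ell2" by (rule *(1))
  show "l2norm (\<lambda>x. d x * \<xi> x) \<le> K * l2norm \<xi>" using *(2) K by (simp add: l2norm_scale)
qed

lemma bounded_op_diag:
  assumes "\<And>x. cmod (d x) \<le> K"
  shows "bounded_op (diag_op d)"
  by (rule bounded_opI[where C = K])
    (use diag_op_norm[OF assms] in \<open>auto simp: diag_op_def ell2_add ell2_scale algebra_simps\<close>)

lemma roe_alg_diag_finite:
  fixes d :: "'a::metric_space \<Rightarrow> complex"
  assumes "finite (range d)"
  shows "diag_op d \<in> uniform_roe_alg"
proof -
  let ?U = "\<lambda>\<xi> x. \<Sum>v\<in>range d. op_scale v (chi (d -` {v})) \<xi> x"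
  have U: "?U \<in> uniform_roe_alg" by (intro roe_alg_sum assms roe_alg_scale roe_alg_chi)
  obtain K where K: "\<And>x. cmod (d x) \<le> K"
    using finite_imp_bounded[OF assms] unfolding bounded_iff by auto
  have "diag_op d = ?U"
  proof (rule bounded_op_eqI[OF bounded_op_diag[OF K] roe_alg_bounded[OF U]])
    fix \<xi> :: "'a \<Rightarrow> complex" assume \<xi>: "\<xi> \<in> ell2"
    have "?U \<xi> x = d x * \<xi> x" for x
    proof -
      have "?U \<xi> x = (\<Sum>v\<in>range d. if v = d x then v * \<xi> x else 0)"
        by (rule sum.cong) (auto simp: op_scale_def chi_apply[OF \<xi>] restr_def)
      then show ?thesis using assms by simp
    qed
    then show "diag_op d \<xi> = ?U \<xi>" using \<xi> by (auto simp: diag_op_def)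
  qed
  with U show ?thesis by simp
qed

text \<open>A disc in the plane is totally bounded, so \<open>d\<close> is uniformly close to a
  function with finitely many values, whose diagonal operator is a combination of projections
  \<open>chi\<close>.\<close>

lemma roe_alg_diag:
  fixes d :: "'a::metric_space \<Rightarrow> complex"
  assumes d: "\<And>x. cmod (d x) \<le> K"
  shows "diag_op d \<in> uniform_roe_alg"
proof (rule roe_alg_limit[OF bounded_op_diag[OF d]])
  fix e :: real assume e: "e > 0"
  have "\<forall>e>0. \<exists>k. finite k \<and> cball 0 K \<subseteq> (\<Union>x\<in>k. ball (x::complex) e)"
    using compact_cball[of "0::complex" K] by (simp add: compact_eq_totally_bounded)
  then obtain k where k: "finite k" "cball 0 K \<subseteq> (\<Union>x\<in>k. ball (x::complex) e)" using e by blast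
  have "\<forall>x. \<exists>v. v \<in> k \<and> cmod (v - d x) \<le> e"
  proof
    fix x
    have "d x \<in> cball 0 K" using d by simp
    then obtain v where "v \<in> k" "d x \<in> ball v e" using k(2) by blast
    then show "\<exists>v. v \<in> k \<and> cmod (v - d x) \<le> e" by (auto simp: dist_norm)
  qed
  from choice[OF this] obtain d' where d': "\<forall>x. d' x \<in> k \<and> cmod (d' x - d x) \<le> e" ..
  have "finite (range d')" by (rule finite_subset[OF _ k(1)]) (use d' in auto)
  then have "diag_op d' \<in> uniform_roe_alg" by (rule roe_alg_diag_finite)
  moreover have "l2norm (op_minus (diag_op d') (diag_op d) \<xi>) \<le> e * l2norm \<xi>" if "\<xi> \<in> ell2" for \<xi>
    using diag_op_norm(2)[of "\<lambda>x. d' x - d x" e \<xi>] d' that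
    by (simp add: op_minus_def diag_op_def left_diff_distrib)
  ultimately show "\<exists>U\<in>uniform_roe_alg. \<forall>\<xi>\<in>ell2. l2norm (op_minus U (diag_op d) \<xi>) \<le> e * l2norm \<xi>" by auto
qed

text \<open>The relation \<open>dist x y \<le> r\<close> is a finite union of graphs of partial translations: enumerate every
  ball of radius \<open>r\<close> and fix both the index of \<open>x\<close> in the ball of \<open>y\<close> and that of \<open>y\<close> in the ball of \<open>x\<close>.\<close>

lemma roe_alg_band_matrix:
  fixes m :: "'a::metric_space \<Rightarrow> 'a \<Rightarrow> complex"
  assumes ulf: "unif_locally_finite TYPE('a)" and r: "r > 0"
    and K: "\<And>x y. cmod (m x y) \<le> K" and m: "\<And>x y. m x y \<noteq> 0 \<Longrightarrow> dist x y \<le> r"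
  shows "\<exists>M\<in>uniform_roe_alg. \<forall>x y. M (delta y) x = m x y"
proof -
  obtain N where N: "\<And>x::'a. finite (cball x r)" "\<And>x::'a. card (cball x r) \<le> N"
    using ulf r unfolding unif_locally_finite_def by meson
  have "\<forall>x::'a. \<exists>f. inj_on f (cball x r) \<and> f ` cball x r \<subseteq> {..<N}"
  proof
    fix x :: 'a
    show "\<exists>f. inj_on f (cball x r) \<and> f ` cball x r \<subseteq> {..<N}"
      using card_le_inj[OF N(1)[of x] finite_lessThan[of N]] N(2)[of x] by auto
  qed
  from choice[OF this] obtain i :: "'a \<Rightarrow> 'a \<Rightarrow> nat" where
    i: "\<And>x. inj_on (i x) (cball x r)" "\<And>x. i x ` cball x r \<subseteq> {..<N}" by blast
  \<comment> \<open>The pair of indices acts as a colour. For a fixed colour, \<open>y\<close>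
    determines \<open>x\<close> through the first index and \<open>x\<close> determines
    \<open>y\<close> through the second.\<close>
  define P where "P = (\<lambda>p y x. dist x y \<le> r \<and> i y x = fst p \<and> i x y = snd p)"
  have Pu1: "x = x'" if "P p y x" "P p y x'" for p x x' y
    using that i(1)[of y] unfolding P_def inj_on_def by (metis dist_commute mem_cball)
  have Pu2: "y = y'" if "P p y x" "P p y' x" for p x y y'
    using that i(1)[of x] unfolding P_def inj_on_def by (metis mem_cball)
  define f where "f = (\<lambda>p y. if \<exists>x. P p y x then Some (SOME x. P p y x) else None)"
  have f: "f p y = Some x \<longleftrightarrow> P p y x" for p y x
  proof (cases "\<exists>x. P p y x")
    case True
    then have "P p y (SOME x. P p y x)" by (rule someI_ex)
    with True show ?thesis unfolding f_def by (auto intro: Pu1[of p y])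
  qed (auto simp: f_def)
  have inj: "inj_on (\<lambda>x. the (f p x)) (dom (f p))" for p
  proof (rule inj_onI)
    fix y y' assume "y \<in> dom (f p)" "y' \<in> dom (f p)" "the (f p y) = the (f p y')"
    then obtain x where "f p y = Some x" "f p y' = Some x" by auto
    then show "y = y'" unfolding f by (rule Pu2)
  qed
  have "\<forall>y\<in>dom (f p). dist y (the (f p y)) \<le> r" for p
  proof
    fix y assume "y \<in> dom (f p)"
    then obtain x where "f p y = Some x" by auto
    moreover from this have "P p y x" by (simp only: f)
    ultimately show "dist y (the (f p y)) \<le> r" by (simp add: P_def dist_commute)
  qed
  with inj have pt: "partial_translation (f p)" for p unfolding partial_translation_def by blast
  \<comment> \<open>A diagonal factor can carry the matrix entries, since row \<open>x\<close> has
    at most one entry of colour \<open>p\<close>.\<close>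
  define d where "d = (\<lambda>p x. if \<exists>y. P p y x then m x (SOME y. P p y x) else 0)"
  have d: "d p x = m x y" if "P p y x" for p x y
  proof -
    have "P p (SOME y. P p y x) x" using that by (rule someI)
    then have "(SOME y. P p y x) = y" using that by (rule Pu2)
    with that show ?thesis unfolding d_def by auto
  qed
  have K0: "0 \<le> K" using K norm_ge_zero order_trans by blast
  have dK: "cmod (d p x) \<le> K" for p x using K K0 by (simp add: d_def)
  let ?I = "{..<N} \<times> {..<N}"
  let ?T = "\<lambda>p. diag_op (d p) \<circ> transl_op (f p)"
  let ?M = "\<lambda>\<xi> x. \<Sum>p\<in>?I. ?T p \<xi> x"
  have "?M \<in> uniform_roe_alg"
    by (intro roe_alg_sum finite_cartesian_product finite_lessThan roe_alg_comp roe_alg_diag[OF dK] roe_alg_transl pt)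
  moreover have "?M (delta y) x = m x y" for x y
  proof -
    have T: "?T p (delta y) x = (if P p y x then m x y else 0)" for p
    proof -
      have "transl_op (f p) (delta y) x = (if P p y x then 1 else 0)"
      proof (cases "x \<in> ran (f p)")
        case True
        then obtain y' where y': "f p y' = Some x" by (auto simp: ran_def)
        then have "transl_op (f p) (delta y) x = delta y y'" by (intro transl_op_apply inj ell2_delta)
        moreover have "P p y x \<longleftrightarrow> y' = y" using y' Pu2[of p y' x y] by (auto simp: f)
        ultimately show ?thesis by (simp add: delta_def)
      next
        case False
        then have "\<not> P p y x" by (auto simp: ran_def f[symmetric])
        with False show ?thesis by (simp add: transl_op_outside_ran)
      qed
      moreover have "transl_op (f p) (delta y) \<in> ell2" using bounded_op_transl[OF inj] by simp
      ultimately show ?thesis by (simp add: diag_op_def d)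
    qed
    show ?thesis
    proof (cases "dist x y \<le> r")
      case True
      let ?p = "(i y x, i x y)"
      have "x \<in> cball y r" "y \<in> cball x r" using True by (auto simp: dist_commute)
      then have p: "?p \<in> ?I" using i(2) by blast
      have "P p y x \<longleftrightarrow> p = ?p" for p using True by (auto simp: P_def)
      then have "?M (delta y) x = (\<Sum>p\<in>?I. if p = ?p then m x y else 0)" by (simp only: T)
      also have "\<dots> = m x y" using p by (subst sum.delta) auto
      finally show ?thesis .
    next
      case False
      then have "\<not> P p y x" for p by (simp add: P_def)
      moreover have "m x y = 0" using False m by blast
      ultimately show ?thesis by (simp only: T) simp
    qed
  qed
  ultimately show ?thesis by (intro bexI[of _ ?M]) simp_all
qed

text \<open>The row operator \<open>(\<eta> z)\<close> to
  \<open>\<Sum>z. \<phi> x z * \<eta> z x\<close> is a contraction on the direct sum over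
  \<open>z\<close>, because the squares of the weights sum to at most 1 at each point.\<close>

lemma weighted_Cauchy_Schwarz:
  fixes \<phi> :: "'a \<Rightarrow> 'z \<Rightarrow> real" and \<eta> :: "'z \<Rightarrow> 'a \<Rightarrow> complex"
  assumes "finite G" "finite Z" "\<And>x. (\<Sum>z\<in>Z. (\<phi> x z)\<^sup>2) \<le> 1"
  shows "(L2_set (\<lambda>x. cmod (\<Sum>z\<in>Z. of_real (\<phi> x z) * \<eta> z x)) G)\<^sup>2 \<le> (\<Sum>z\<in>Z. \<Sum>x\<in>G. (cmod (\<eta> z x))\<^sup>2)"
proof -
  have "(cmod (\<Sum>z\<in>Z. of_real (\<phi> x z) * \<eta> z x))\<^sup>2 \<le> (\<Sum>z\<in>Z. (cmod (\<eta> z x))\<^sup>2)" for x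
  proof -
    have "cmod (\<Sum>z\<in>Z. of_real (\<phi> x z) * \<eta> z x) \<le> (\<Sum>z\<in>Z. \<bar>\<phi> x z\<bar> * \<bar>cmod (\<eta> z x)\<bar>)"
      by (rule order_trans[OF norm_sum]) (simp add: norm_mult)
    also have "\<dots> \<le> L2_set (\<phi> x) Z * L2_set (\<lambda>z. cmod (\<eta> z x)) Z" by (rule L2_set_mult_ineq)
    also have "\<dots> \<le> 1 * L2_set (\<lambda>z. cmod (\<eta> z x)) Z"
      by (rule mult_right_mono) (use assms(3) in \<open>auto simp: L2_set_def intro: sum_nonneg\<close>)
    finally have "(cmod (\<Sum>z\<in>Z. of_real (\<phi> x z) * \<eta> z x))\<^sup>2 \<le> (L2_set (\<lambda>z. cmod (\<eta> z x)) Z)\<^sup>2"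
      by (intro power_mono) auto
    then show ?thesis by (simp add: L2_set_def sum_nonneg)
  qed
  then have "(\<Sum>x\<in>G. (cmod (\<Sum>z\<in>Z. of_real (\<phi> x z) * \<eta> z x))\<^sup>2) \<le> (\<Sum>x\<in>G. \<Sum>z\<in>Z. (cmod (\<eta> z x))\<^sup>2)"
    by (rule sum_mono)
  also have "\<dots> = (\<Sum>z\<in>Z. \<Sum>x\<in>G. (cmod (\<eta> z x))\<^sup>2)" by (rule sum.swap)
  finally show ?thesis by (simp add: L2_set_def sum_nonneg)
qed

text \<open>The matching column operator: cut \<open>v\<close> by the weights and apply
  \<open>T\<close> to each piece. Composed with the row operator it controls sums of the form
  \<open>\<phi>\<close> times \<open>T\<close> times \<open>\<psi>\<close> without any factor for
  the size of \<open>Z\<close>.\<close>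

lemma sum_norm_images_le:
  fixes \<psi> :: "'a \<Rightarrow> 'z \<Rightarrow> real"
  assumes T: "\<And>\<xi>. \<xi> \<in> ell2 \<Longrightarrow> l2norm (T \<xi>) \<le> L * l2norm \<xi>" "\<And>\<xi>. T \<xi> \<in> ell2" and L: "0 \<le> L"
    and G: "finite G" and F: "finite F" and Z: "finite Z"
    and \<psi>: "\<And>y. y \<in> F \<Longrightarrow> (\<Sum>z\<in>Z. (\<psi> y z)\<^sup>2) \<le> c\<^sup>2"
  shows "(\<Sum>z\<in>Z. \<Sum>x\<in>G. (cmod (T (restr F (\<lambda>y. of_real (\<psi> y z) * v y)) x))\<^sup>2) \<le> (L * c * l2norm (restr F v))\<^sup>2"
proof -
  let ?v = "\<lambda>z. restr F (\<lambda>y. of_real (\<psi> y z) * v y)"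
  have "(\<Sum>x\<in>G. (cmod (T (?v z) x))\<^sup>2) \<le> L\<^sup>2 * (\<Sum>y\<in>F. (\<psi> y z)\<^sup>2 * (cmod (v y))\<^sup>2)" for z
  proof -
    have "(\<Sum>x\<in>G. (cmod (T (?v z) x))\<^sup>2) = (L2_set (\<lambda>x. cmod (T (?v z) x)) G)\<^sup>2"
      by (simp add: L2_set_def sum_nonneg)
    also have "\<dots> \<le> (L * l2norm (?v z))\<^sup>2"
      using order_trans[OF L2_set_le_l2norm[OF T(2) G] T(1)[OF ell2_restr_finite[OF F]]]
      by (intro power_mono) auto
    also have "\<dots> = L\<^sup>2 * (\<Sum>y\<in>F. (\<psi> y z)\<^sup>2 * (cmod (v y))\<^sup>2)"
      unfolding l2norm_restr_finite[OF F]
      by (simp add: L2_set_def sum_nonneg power_mult_distrib norm_mult)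
    finally show ?thesis .
  qed
  then have "(\<Sum>z\<in>Z. \<Sum>x\<in>G. (cmod (T (?v z) x))\<^sup>2) \<le> (\<Sum>z\<in>Z. L\<^sup>2 * (\<Sum>y\<in>F. (\<psi> y z)\<^sup>2 * (cmod (v y))\<^sup>2))"
    by (rule sum_mono)
  also have "\<dots> = L\<^sup>2 * (\<Sum>y\<in>F. (\<Sum>z\<in>Z. (\<psi> y z)\<^sup>2) * (cmod (v y))\<^sup>2)"
    unfolding sum_distrib_left[symmetric] sum_distrib_right by (subst sum.swap) simp
  also have "\<dots> \<le> L\<^sup>2 * (\<Sum>y\<in>F. c\<^sup>2 * (cmod (v y))\<^sup>2)"
    by (intro mult_left_mono sum_mono mult_right_mono \<psi>) auto
  also have "\<dots> = (L * c * l2norm (restr F v))\<^sup>2"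
    unfolding l2norm_restr_finite[OF F]
    by (simp add: L2_set_def sum_nonneg power_mult_distrib sum_distrib_left mult.assoc)
  finally show ?thesis .
qed

section \<open>Approximation of quasi-local operators\<close>

text \<open>The Gram kernel of the vectors \<open>\<phi> x\<close>. The sum is restricted to the
  ball that carries \<open>\<phi> x\<close>, which keeps it finite.\<close>

definition weight_kernel :: "('a::metric_space \<Rightarrow> 'a \<Rightarrow> real) \<Rightarrow> real \<Rightarrow> 'a \<Rightarrow> 'a \<Rightarrow> real" where
  "weight_kernel \<phi> S x y = (\<Sum>z\<in>cball x S. \<phi> x z * \<phi> y z)"

context
  fixes e R S :: real and \<phi> :: "'a::metric_space \<Rightarrow> 'a \<Rightarrow> real"
  assumes ulf: "unif_locally_finite TYPE('a)" and wf: "weight_family e R S \<phi>"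
begin

lemma kernel_eq_sum:
  assumes "finite Z" "cball x S \<subseteq> Z"
  shows "weight_kernel \<phi> S x y = (\<Sum>z\<in>Z. \<phi> x z * \<phi> y z)"
  unfolding weight_kernel_def
  by (rule sum.mono_neutral_left) (use assms weight_familyD(2)[OF wf] in force)+

lemma kernel_support: "weight_kernel \<phi> S x y \<noteq> 0 \<Longrightarrow> dist x y \<le> 2 * S"
proof -
  assume "weight_kernel \<phi> S x y \<noteq> 0"
  then obtain z where "\<phi> x z * \<phi> y z \<noteq> 0" unfolding weight_kernel_def by (meson sum.neutral)
  then have "dist x z \<le> S" "dist y z \<le> S" using weight_familyD(2)[OF wf] by auto
  then show ?thesis using dist_triangle2[of x y z] by linarith
qed

lemma kernel_le_1: "\<bar>weight_kernel \<phi> S x y\<bar> \<le> 1"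
proof -
  have f: "finite (cball x S)" by (rule finite_cball_ulf[OF ulf])
  have "\<bar>weight_kernel \<phi> S x y\<bar> \<le> (\<Sum>z\<in>cball x S. \<bar>\<phi> x z\<bar> * \<bar>\<phi> y z\<bar>)"
    unfolding weight_kernel_def by (rule order_trans[OF sum_abs]) (simp add: abs_mult)
  also have "\<dots> \<le> L2_set (\<phi> x) (cball x S) * L2_set (\<phi> y) (cball x S)" by (rule L2_set_mult_ineq)
  also have "\<dots> \<le> 1 * 1"
    by (rule mult_mono) (use weight_familyD(4)[OF wf f] in \<open>auto simp: L2_set_def intro: sum_nonneg\<close>)
  finally show ?thesis by simp
qed

text \<open>The Schur product of \<open>T\<close> with a Gram kernel is the sum over
  \<open>z\<close> of multiplication by \<open>\<phi>\<close> at \<open>z\<close>, then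
  \<open>T\<close>, then the same multiplication.\<close>

lemma kernel_multiplier_apply:
  assumes T: "bounded_op T" and M: "bounded_op M"
    and mat: "\<And>x y. M (delta y) x = of_real (weight_kernel \<phi> S x y) * T (delta y) x"
    and F: "finite F" and Z: "finite Z" "cball x S \<subseteq> Z"
  shows "M (restr F v) x = (\<Sum>z\<in>Z. of_real (\<phi> x z) * T (restr F (\<lambda>y. of_real (\<phi> y z) * v y)) x)"
proof -
  have "M (restr F v) x = (\<Sum>y\<in>F. \<Sum>z\<in>Z. v y * (of_real (\<phi> x z) * of_real (\<phi> y z) * T (delta y) x))"
    by (simp add: bounded_op_restr_finite[OF M F] mat kernel_eq_sum[OF Z] sum_distrib_right sum_distrib_left)
  also have "\<dots> = (\<Sum>z\<in>Z. \<Sum>y\<in>F. v y * (of_real (\<phi> x z) * of_real (\<phi> y z) * T (delta y) x))" by (rule sum.swap)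
  also have "\<dots> = (\<Sum>z\<in>Z. of_real (\<phi> x z) * T (restr F (\<lambda>y. of_real (\<phi> y z) * v y)) x)"
    by (simp add: bounded_op_restr_finite[OF T F] sum_distrib_left ac_simps)
  finally show ?thesis .
qed

text \<open>Factor the multiplier into the column operator, \<open>T\<close> on each summand, and
  the row operator; both outer factors are contractions.\<close>

lemma kernel_multiplier_norm_le:
  assumes T: "bounded_op T" and M: "bounded_op M"
    and mat: "\<And>x y. M (delta y) x = of_real (weight_kernel \<phi> S x y) * T (delta y) x"
    and L: "0 \<le> L" "\<And>\<xi>. \<xi> \<in> ell2 \<Longrightarrow> l2norm (T \<xi>) \<le> L * l2norm \<xi>"
    and \<xi>: "\<xi> \<in> ell2"
  shows "l2norm (M \<xi>) \<le> L * l2norm \<xi>"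
proof (rule norm_bound_from_finite[OF M L(1) _ \<xi>])
  fix F :: "'a set" and v :: "'a \<Rightarrow> complex" assume F: "finite F"
  show "l2norm (M (restr F v)) \<le> L * l2norm (restr F v)"
  proof (rule ell2_bounded(2))
    fix G :: "'a set" assume G: "finite G"
    define Z where "Z = (\<Union>x\<in>G. cball x S)"
    have Z: "finite Z" using G finite_cball_ulf[OF ulf] by (simp add: Z_def)
    let ?\<eta> = "\<lambda>z. T (restr F (\<lambda>y. of_real (\<phi> y z) * v y))"
    have "L2_set (\<lambda>x. cmod (M (restr F v) x)) G = L2_set (\<lambda>x. cmod (\<Sum>z\<in>Z. of_real (\<phi> x z) * ?\<eta> z x)) G"
    proof (rule L2_set_cong[OF refl])
      fix x assume "x \<in> G"
      then have "cball x S \<subseteq> Z" by (auto simp: Z_def)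
      from kernel_multiplier_apply[OF T M mat F Z this]
      show "cmod (M (restr F v) x) = cmod (\<Sum>z\<in>Z. of_real (\<phi> x z) * ?\<eta> z x)" by simp
    qed
    moreover have "(L2_set (\<lambda>x. cmod (\<Sum>z\<in>Z. of_real (\<phi> x z) * ?\<eta> z x)) G)\<^sup>2 \<le> (\<Sum>z\<in>Z. \<Sum>x\<in>G. (cmod (?\<eta> z x))\<^sup>2)"
      by (rule weighted_Cauchy_Schwarz[OF G Z weight_familyD(4)[OF wf Z]])
    moreover have "(\<Sum>z\<in>Z. \<Sum>x\<in>G. (cmod (?\<eta> z x))\<^sup>2) \<le> (L * 1 * l2norm (restr F v))\<^sup>2"
      by (rule sum_norm_images_le[OF L(2) bounded_op_in_ell2[OF T] L(1) G F Z])
        (use weight_familyD(4)[OF wf Z] in simp_all)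
    ultimately have "(L2_set (\<lambda>x. cmod (M (restr F v) x)) G)\<^sup>2 \<le> (L * l2norm (restr F v))\<^sup>2" by simp
    then show "L2_set (\<lambda>x. cmod (M (restr F v) x)) G \<le> L * l2norm (restr F v)"
      by (rule power2_le_imp_le) (use L(1) in simp)
  qed
qed

text \<open>Schur multiplication commutes with cutting rows and columns, so the norm bound applies
  to the corner \<open>chi C \<circ> T \<circ> chi D\<close>.\<close>

lemma kernel_multiplier_ql:
  assumes T: "bounded_op T" and M: "bounded_op M"
    and mat: "\<And>x y. M (delta y) x = of_real (weight_kernel \<phi> S x y) * T (delta y) x"
    and q: "ql d r T" and d: "0 \<le> d"
  shows "ql d r M"
proof (rule qlI)
  fix C D :: "'a set" and \<xi> :: "'a \<Rightarrow> complex" assume s: "sep r C D" and \<xi>: "\<xi> \<in> ell2"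
  have app: "(chi C \<circ> A \<circ> chi D) \<zeta> = restr C (A (restr D \<zeta>))" if "bounded_op A" "\<zeta> \<in> ell2" for A \<zeta>
    using that by (simp add: chi_apply)
  have "l2norm ((chi C \<circ> M \<circ> chi D) \<xi>) \<le> d * l2norm \<xi>"
  proof (rule kernel_multiplier_norm_le[of "chi C \<circ> T \<circ> chi D"])
    fix x y
    have dy: "restr D (delta y) = (if y \<in> D then delta y else (\<lambda>_. 0))"
      by (auto simp: restr_def delta_def)
    show "(chi C \<circ> M \<circ> chi D) (delta y) x = of_real (weight_kernel \<phi> S x y) * (chi C \<circ> T \<circ> chi D) (delta y) x"
      unfolding app[OF T ell2_delta] app[OF M ell2_delta] dy
      using bounded_op_zero[OF T] bounded_op_zero[OF M] by (simp add: restr_def mat)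
  next
    fix \<zeta> :: "'a \<Rightarrow> complex" assume "\<zeta> \<in> ell2"
    then show "l2norm ((chi C \<circ> T \<circ> chi D) \<zeta>) \<le> d * l2norm \<zeta>"
      unfolding app[OF T \<open>\<zeta> \<in> ell2\<close>] by (rule qlD[OF q s])
  qed (intro bounded_op_comp bounded_op_chi T M d \<xi>)+
  then show "l2norm (restr C (M (restr D \<xi>))) \<le> d * l2norm \<xi>" unfolding app[OF M \<xi>] .
qed

text \<open>On a vector \<open>v\<close> supported near \<open>z0\<close> all \<open>\<phi> y\<close> with \<open>y\<close> in the support of \<open>v\<close> are close to
  \<open>\<phi> z0\<close>, and \<open>T v\<close> is concentrated near \<open>z0\<close> by quasi-locality; hence
  \<open>T v - M v = (\<Sum>z. \<phi>\<^sub>z (\<phi>\<^sub>z T v - T (\<phi>\<^sub>z v)))\<close> is small.\<close>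

lemma kernel_multiplier_close_locally:
  assumes T: "bounded_op T" and M: "bounded_op M"
    and mat: "\<And>x y. M (delta y) x = of_real (weight_kernel \<phi> S x y) * T (delta y) x"
    and L: "\<And>\<xi>. \<xi> \<in> ell2 \<Longrightarrow> l2norm (T \<xi>) \<le> l2norm \<xi>"
    and q: "ql e r T" and e: "0 \<le> e" and s: "0 \<le> r" "s + r \<le> R"
    and v: "v \<in> ell2"
  shows "l2norm (op_minus T M (restr (cball z0 s) v)) \<le> 4 * e * l2norm v"
proof (rule ell2_bounded(2))
  fix G :: "'a set" assume G: "finite G"
  define F where "F = cball z0 s"
  have F: "finite F" unfolding F_def by (rule finite_cball_ulf[OF ulf])
  define Z where "Z = (\<Union>x\<in>G. cball x S)"
  have Z: "finite Z" using G finite_cball_ulf[OF ulf] by (simp add: Z_def)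
  let ?u = "restr F v"
  define w where "w = T ?u"
  have w: "w \<in> ell2" using T by (simp add: w_def)
  define \<alpha> where "\<alpha> = (\<lambda>z x. of_real (\<phi> x z - \<phi> z0 z) * w x)"
  define \<beta> where "\<beta> = (\<lambda>z. T (restr F (\<lambda>y. of_real (\<phi> y z - \<phi> z0 z) * v y)))"
  have un: "l2norm ?u \<le> l2norm v" by (rule l2norm_restr_le[OF v])
  \<comment> \<open>The normalisation writes \<open>T ?u\<close> as a sum of squares of weights;
    inserting the constant weight \<open>\<phi> z0 z\<close> on both sides of \<open>T\<close>
    cancels and leaves only weight differences.\<close>
  have eq: "op_minus T M ?u x = (\<Sum>z\<in>Z. of_real (\<phi> x z) * \<alpha> z x) - (\<Sum>z\<in>Z. of_real (\<phi> x z) * \<beta> z x)"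
    if x: "x \<in> G" for x
  proof -
    have sub: "cball x S \<subseteq> Z" using x by (auto simp: Z_def)
    have \<beta>: "\<beta> z x = T (restr F (\<lambda>y. of_real (\<phi> y z) * v y)) x - of_real (\<phi> z0 z) * w x" for z
      unfolding \<beta>_def w_def
      by (simp add: bounded_op_restr_finite[OF T F] sum_distrib_left sum_subtractf[symmetric] algebra_simps)
    have "w x = of_real (\<Sum>z\<in>Z. (\<phi> x z)\<^sup>2) * w x"
      using weight_familyD(3)[OF wf Z sub] by simp
    then have "w x = (\<Sum>z\<in>Z. of_real (\<phi> x z) * (of_real (\<phi> x z) * w x))"
      by (simp add: sum_distrib_right power2_eq_square mult.assoc)
    moreover have "M ?u x = (\<Sum>z\<in>Z. of_real (\<phi> x z) * T (restr F (\<lambda>y. of_real (\<phi> y z) * v y)) x)"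
      by (rule kernel_multiplier_apply[OF T M mat F Z sub])
    ultimately have "op_minus T M ?u x = (\<Sum>z\<in>Z. of_real (\<phi> x z) * (of_real (\<phi> x z) * w x))
        - (\<Sum>z\<in>Z. of_real (\<phi> x z) * T (restr F (\<lambda>y. of_real (\<phi> y z) * v y)) x)"
      by (simp add: op_minus_def w_def)
    also have "\<dots> = (\<Sum>z\<in>Z. of_real (\<phi> x z) * \<alpha> z x) - (\<Sum>z\<in>Z. of_real (\<phi> x z) * \<beta> z x)"
      unfolding \<beta> \<alpha>_def sum_subtractf[symmetric]
      by (rule sum.cong[OF refl]) (simp add: algebra_simps)
    finally show ?thesis .
  qed
  have near: "(\<Sum>z\<in>Z. (\<phi> y z - \<phi> z0 z)\<^sup>2) \<le> e\<^sup>2" if "dist y z0 \<le> s + r" for y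
    by (rule weight_familyD(5)[OF wf Z]) (use that s in linarith)
  \<comment> \<open>A crude bound for points where weights need not be close; there \<open>w\<close>
    is small instead.\<close>
  have far: "(\<Sum>z\<in>Z. (\<phi> y z - \<phi> z0 z)\<^sup>2) \<le> 4" for y
  proof -
    have "(\<Sum>z\<in>Z. (\<phi> y z - \<phi> z0 z)\<^sup>2) \<le> (\<Sum>z\<in>Z. 2 * (\<phi> y z)\<^sup>2 + 2 * (\<phi> z0 z)\<^sup>2)"
    proof (rule sum_mono)
      fix z
      have "0 \<le> (\<phi> y z + \<phi> z0 z)\<^sup>2" by simp
      then show "(\<phi> y z - \<phi> z0 z)\<^sup>2 \<le> 2 * (\<phi> y z)\<^sup>2 + 2 * (\<phi> z0 z)\<^sup>2"
        by (simp add: power2_eq_square algebra_simps)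
    qed
    also have "\<dots> = 2 * (\<Sum>z\<in>Z. (\<phi> y z)\<^sup>2) + 2 * (\<Sum>z\<in>Z. (\<phi> z0 z)\<^sup>2)"
      by (simp add: sum.distrib sum_distrib_left)
    also have "\<dots> \<le> 4" using weight_familyD(4)[OF wf Z, of y] weight_familyD(4)[OF wf Z, of z0] by linarith
    finally show ?thesis .
  qed
  define N where "N = cball z0 (s + r)"
  have B: "(\<Sum>z\<in>Z. \<Sum>x\<in>G. (cmod (\<beta> z x))\<^sup>2) \<le> (1 * e * l2norm ?u)\<^sup>2"
    unfolding \<beta>_def
  proof (rule sum_norm_images_le[OF _ bounded_op_in_ell2[OF T] _ G F Z])
    fix y assume "y \<in> F"
    then show "(\<Sum>z\<in>Z. (\<phi> y z - \<phi> z0 z)\<^sup>2) \<le> e\<^sup>2"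
      using s(1) by (intro near) (simp add: F_def dist_commute)
  qed (use L in simp_all)
  have A: "(\<Sum>z\<in>Z. \<Sum>x\<in>G. (cmod (\<alpha> z x))\<^sup>2) \<le> (3 * e * l2norm v)\<^sup>2"
  proof -
    have "(\<Sum>z\<in>Z. \<Sum>x\<in>G. (cmod (\<alpha> z x))\<^sup>2) = (\<Sum>x\<in>G. (\<Sum>z\<in>Z. (\<phi> x z - \<phi> z0 z)\<^sup>2) * (cmod (w x))\<^sup>2)"
      by (subst sum.swap) (simp add: \<alpha>_def norm_mult power_mult_distrib sum_distrib_right flip: of_real_diff)
    also have "\<dots> \<le> (\<Sum>x\<in>G. e\<^sup>2 * (cmod (w x))\<^sup>2 + 4 * (cmod (restr (- N) w x))\<^sup>2)"
    proof (rule sum_mono)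
      fix x
      show "(\<Sum>z\<in>Z. (\<phi> x z - \<phi> z0 z)\<^sup>2) * (cmod (w x))\<^sup>2 \<le> e\<^sup>2 * (cmod (w x))\<^sup>2 + 4 * (cmod (restr (- N) w x))\<^sup>2"
      proof (cases "x \<in> N")
        case True
        then have "(\<Sum>z\<in>Z. (\<phi> x z - \<phi> z0 z)\<^sup>2) \<le> e\<^sup>2" by (intro near) (simp add: N_def dist_commute)
        then show ?thesis using True by (simp add: restr_def mult_right_mono)
      next
        case False
        have "(\<Sum>z\<in>Z. (\<phi> x z - \<phi> z0 z)\<^sup>2) * (cmod (w x))\<^sup>2 \<le> 4 * (cmod (w x))\<^sup>2"
          by (rule mult_right_mono[OF far]) simp
        then show ?thesis using False by (simp add: restr_def add_increasing)
      qed
    qed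
    also have "\<dots> = e\<^sup>2 * (L2_set (\<lambda>x. cmod (w x)) G)\<^sup>2 + 4 * (L2_set (\<lambda>x. cmod (restr (- N) w x)) G)\<^sup>2"
      by (simp add: L2_set_def sum_nonneg sum.distrib sum_distrib_left)
    also have "\<dots> \<le> e\<^sup>2 * (l2norm v)\<^sup>2 + 4 * (e * l2norm v)\<^sup>2"
    proof (intro add_mono mult_left_mono power_mono)
      show "L2_set (\<lambda>x. cmod (w x)) G \<le> l2norm v"
        using L2_set_le_l2norm[OF w G] L[OF ell2_restr[OF v], of F] un unfolding w_def by linarith
      have "sep r (- N) F"
      proof -
        have "r < dist x y" if "x \<notin> N" "y \<in> F" for x y
          using that dist_triangle[of z0 x y] by (simp add: N_def F_def dist_commute)
        then show ?thesis by (simp add: sep_def)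
      qed
      from qlD[OF q this v] L2_set_le_l2norm[OF ell2_restr[OF w] G, of "- N"]
      show "L2_set (\<lambda>x. cmod (restr (- N) w x)) G \<le> e * l2norm v" unfolding w_def by linarith
    qed auto
    also have "\<dots> = 5 * (e * l2norm v)\<^sup>2" by (simp add: power_mult_distrib)
    \<comment> \<open>Rounded up to a square, so that this part contributes \<open>3 * e\<close> and
      together with \<open>\<beta>\<close> gives \<open>4 * e\<close>.\<close>
    also have "\<dots> \<le> 9 * (e * l2norm v)\<^sup>2" by simp
    also have "\<dots> = (3 * e * l2norm v)\<^sup>2" by (simp add: power_mult_distrib)
    finally show ?thesis .
  qed
  note cs = weighted_Cauchy_Schwarz[OF G Z weight_familyD(4)[OF wf Z]]
  have "L2_set (\<lambda>x. cmod (\<Sum>z\<in>Z. of_real (\<phi> x z) * \<alpha> z x)) G \<le> 3 * e * l2norm v"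
    by (rule power2_le_imp_le[OF order_trans[OF cs A]]) (use e in simp)
  moreover have "L2_set (\<lambda>x. cmod (\<Sum>z\<in>Z. of_real (\<phi> x z) * \<beta> z x)) G \<le> 1 * e * l2norm ?u"
    by (rule power2_le_imp_le[OF order_trans[OF cs B]]) (use e in simp)
  moreover have "1 * e * l2norm ?u \<le> e * l2norm v" using un e by (simp add: mult_left_mono)
  moreover have "L2_set (\<lambda>x. cmod (op_minus T M ?u x)) G
     \<le> L2_set (\<lambda>x. cmod (\<Sum>z\<in>Z. of_real (\<phi> x z) * \<alpha> z x) + cmod (\<Sum>z\<in>Z. of_real (\<phi> x z) * \<beta> z x)) G"
    by (rule L2_set_mono) (auto simp: eq intro: norm_triangle_ineq4)
  moreover have "\<dots> \<le> L2_set (\<lambda>x. cmod (\<Sum>z\<in>Z. of_real (\<phi> x z) * \<alpha> z x)) G + L2_set (\<lambda>x. cmod (\<Sum>z\<in>Z. of_real (\<phi> x z) * \<beta> z x)) G"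
    by (rule L2_set_triangle_ineq)
  ultimately show "L2_set (\<lambda>x. cmod (op_minus T M (restr (cball z0 s) v) x)) G \<le> 4 * e * l2norm v"
    unfolding F_def[symmetric] by linarith
qed

end

lemma quasi_local_contraction_in_roe_alg:
  fixes T :: "'a::metric_space op"
  assumes ulf: "unif_locally_finite TYPE('a)" and A: "property_A TYPE('a)"
    and ql: "quasi_local T" and L: "\<And>\<xi>. \<xi> \<in> ell2 \<Longrightarrow> l2norm (T \<xi>) \<le> l2norm \<xi>"
  shows "T \<in> uniform_roe_alg"
proof (rule roe_alg_limit)
  show T: "bounded_op T" using ql by (simp add: quasi_local_def)
  fix d :: real assume d: "d > 0"
  \<comment> \<open>The final error is \<open>6 * (2 * e) + 4 * e\<close>, that is
    \<open>16 * e\<close>.\<close>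
  define e where "e = d / 16"
  have e: "e > 0" using d by (simp add: e_def)
  obtain r0 where r0: "ql e r0 T" using ql e unfolding quasi_local_def by blast
  define r where "r = max r0 1"
  have r: "r > 0" "ql e r T" using r0 by (auto simp: r_def intro: ql_mono)
  \<comment> \<open>Constants for a difference of two contractions, each quasi-local with
    \<open>e\<close> at scale \<open>r\<close>.\<close>
  have "2 * e > 0" "(2::real) \<ge> 0" using e by auto
  from operator_norm_localization[OF A ulf r(1) this] obtain s where
    s: "\<forall>(b::'a op) h. bounded_op b \<longrightarrow> (\<forall>\<xi>\<in>ell2. l2norm (b \<xi>) \<le> 2 * l2norm \<xi>) \<longrightarrow> ql (2 * e) r b \<longrightarrow>
     0 \<le> h \<longrightarrow> (\<forall>z. \<forall>\<zeta>\<in>ell2. l2norm (b (restr (cball z s) \<zeta>)) \<le> h * l2norm \<zeta>) \<longrightarrow>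
     (\<forall>\<xi>\<in>ell2. l2norm (b \<xi>) \<le> (6 * (2 * e) + h) * l2norm \<xi>)" ..
  \<comment> \<open>Weights must vary little over the localization ball and the further distance
    \<open>r\<close> that \<open>T\<close> may spread; the absolute value covers a negative
    \<open>s\<close>.\<close>
  define R where "R = \<bar>s\<bar> + r"
  have R: "R > 0" "s + r \<le> R" using r by (auto simp: R_def)
  obtain S and \<phi> :: "'a \<Rightarrow> 'a \<Rightarrow> real" where wf: "weight_family e R S \<phi>"
    using property_A_weights[OF A e R(1)] by blast
  note kl = kernel_support[OF ulf wf] kernel_le_1[OF ulf wf]
  have mb: "cmod (of_real (weight_kernel \<phi> S x y) * T (delta y) x) \<le> 1" for x y
  proof -
    have "cmod (T (delta y) x) \<le> 1"
      using cmod_le_l2norm[OF bounded_op_in_ell2[OF T], of "delta y" x] L[OF ell2_delta, of y] by simp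
    then have "\<bar>weight_kernel \<phi> S x y\<bar> * cmod (T (delta y) x) \<le> 1 * 1" using kl(2) by (intro mult_mono) auto
    then show ?thesis by (simp add: norm_mult)
  qed
  have ms: "dist x y \<le> max (2 * S) 1" if "of_real (weight_kernel \<phi> S x y) * T (delta y) x \<noteq> (0::complex)" for x y
    using kl(1)[of x y] that by auto
  \<comment> \<open>The kernel has propagation \<open>2 * S\<close>; the maximum makes the band
    width positive.\<close>
  have "max (2 * S) 1 > 0" by simp
  from roe_alg_band_matrix[OF ulf this mb ms]
  obtain M where "M \<in> uniform_roe_alg" "\<forall>x y. M (delta y) x = of_real (weight_kernel \<phi> S x y) * T (delta y) x"
    by (rule bexE)
  note M = this(1) this(2)[rule_format]
  have Mb: "bounded_op M" by (rule roe_alg_bounded[OF M(1)])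
  define b where "b = op_minus T M"
  have b: "bounded_op b" unfolding b_def by (rule bounded_op_minus[OF T Mb])
  have M1: "l2norm (M \<xi>) \<le> 1 * l2norm \<xi>" if "\<xi> \<in> ell2" for \<xi>
    by (rule kernel_multiplier_norm_le[OF ulf wf T Mb M(2) _ _ that]) (use L in simp_all)
  have b2: "l2norm (b \<xi>) \<le> 2 * l2norm \<xi>" if "\<xi> \<in> ell2" for \<xi>
    using ell2_diff(2)[OF bounded_op_in_ell2[OF T] bounded_op_in_ell2[OF Mb], of \<xi> \<xi>] L[OF that] M1[OF that]
    unfolding b_def op_minus_def by linarith
  have "ql e r M" by (rule kernel_multiplier_ql[OF ulf wf T Mb M(2) r(2)]) (use e in simp)
  then have "ql (e + e) r b" unfolding b_def by (rule ql_minus[OF T Mb r(2)])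
  then have bq: "ql (2 * e) r b" by simp
  have bl: "l2norm (b (restr (cball z s) \<zeta>)) \<le> 4 * e * l2norm \<zeta>" if "\<zeta> \<in> ell2" for z \<zeta>
    unfolding b_def
    by (rule kernel_multiplier_close_locally[OF ulf wf T Mb M(2) L r(2) _ _ R(2) that]) (use e r in simp_all)
  have "l2norm (op_minus M T \<xi>) \<le> d * l2norm \<xi>" if \<xi>: "\<xi> \<in> ell2" for \<xi>
  proof -
    have "l2norm (b \<xi>) \<le> (6 * (2 * e) + 4 * e) * l2norm \<xi>"
      using s[THEN spec[of _ b], THEN spec[of _ "4 * e"]] b b2 bq bl e \<xi> by simp
    moreover have "l2norm (op_minus M T \<xi>) = l2norm (b \<xi>)"
      unfolding b_def op_minus_def by (rule l2norm_minus_commute)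
    moreover have "6 * (2 * e) + 4 * e = d" by (simp add: e_def)
    ultimately show ?thesis by simp
  qed
  with M(1) show "\<exists>U\<in>uniform_roe_alg. \<forall>\<xi>\<in>ell2. l2norm (op_minus U T \<xi>) \<le> d * l2norm \<xi>" by auto
qed

theorem theorem6p1p2:
  fixes \<sigma> :: "'a::metric_space op \<Rightarrow> 'a op" and w :: "'a op"
  assumes "unif_locally_finite TYPE('a)"
    and "property_A TYPE('a)"
    and "is_cstar_aut uniform_roe_alg \<sigma>"
    and "in_identity_component uniform_roe_alg \<sigma>"
    and "unitary_op w"
    and "\<forall>a\<in>uniform_roe_alg. \<sigma> a = w \<circ> a \<circ> op_adjoint w"
  shows "w \<in> uniform_roe_alg"
proof (rule quasi_local_contraction_in_roe_alg[OF assms(1,2)])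
  show "quasi_local w"
    by (rule implementing_unitary_quasi_local[OF loc_aut_identity_component[OF assms(4)] assms(5)])
      (use assms(6) roe_alg_chi in blast)
  show "l2norm (w \<xi>) \<le> l2norm \<xi>" if "\<xi> \<in> ell2" for \<xi>
    using unitary_op_norm[OF assms(5) that] by simp
qed

end
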